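(* Let $k$ be a commutative ring and let $A$ be a Hopf category in $\mathcal M_k^{\mathrm f}(X)$, i.e. a Hopf $\mathcal M_k^{\mathrm f}$-category with underlying class $X$. Then $A^*=(A^*_{x,y})_{x,y\in X}$ is a Hopf module, with structure maps $\rho_{x,y}:A^*_{x,y}\to A^*_{x,y}\otimes A_{x,y}$ and $\psi_{x,y,z}:A^*_{x,y}\otimes A_{y,z}\to A^*_{x,z}$ defined as follows: (1) for $a^*\in A^*_{x,y}$, $\rho_{x,y}(a^* )=\sum_ia^*a_i^*\otimes a_i$, where $\sum_ia_i^*\otimes a_i\in A^*_{x,y}\otimes A_{x,y}$ is the finite dual basis of $A_{x,y}$ and the multiplication on $A^*_{x,y}$ is the opposite convolution; (2) for $a^*\in A^*_{x,y}$ and $a\in A_{y,z}$, $\psi_{x,y,z}(a^*\otimes a)=a^*\leftharpoonup a\in A^*_{x,z}$ is given by the formula $\langle a^*\leftharpoonup a,b\rangle=\langle a^*,bS_{y,z}(a)\rangle$ for all $b\in A_{x,z}$.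
   Context: $\mathcal M_k^{\mathrm f}$ is the category of finitely generated projective $k$-modules; $\otimes=\otimes_k$ and $(-)^*=\mathrm{Hom}_k(-,k)$, so $A^*_{x,y}=\mathrm{Hom}_k(A_{x,y},k)$. A Hopf $\mathcal M_k^{\mathrm f}$-category $A$ with underlying class $X$ consists of $k$-coalgebras $A_{x,y}$ ($x,y\in X$), finitely generated and projective as $k$-modules, with comultiplication $\Delta_{x,y}(h)=h_{(1)}\otimes h_{(2)}$ and counit $\varepsilon_{x,y}$, coalgebra morphisms $A_{x,y}\otimes A_{y,z}\to A_{x,z}$, $h\otimes l\mapsto hl$, and $k\to A_{x,x}$, $1\mapsto1_x$, which are associative and unital, and $k$-linear maps $S_{x,y}:A_{x,y}\to A_{y,x}$ with $h_{(1)}S_{x,y}(h_{(2)})=\varepsilon_{x,y}(h)1_x$, $S_{x,y}(h_{(1)})h_{(2)}=\varepsilon_{x,y}(h)1_y$ for all $h\in A_{x,y}$. Opposite convolution on $A_{x,y}^*$: $\langle a^*b^*,h\rangle=\langle a^*,h_{(2)}\rangle\langle b^*,h_{(1)}\rangle$. A Hopf module is a family $M=(M_{x,y})_{x,y\in X}$ of finitely generated projective $k$-modules with $k$-linear maps $\psi_{x,y,z}:M_{x,y}\otimes A_{y,z}\to M_{x,z}$, $m\otimes a\mapsto ma$, satisfying $(ma)b=m(ab)$ and $m1_y=m$ for $m\in M_{x,y}$, and right $A_{x,y}$-comodule structures $\rho_{x,y}:M_{x,y}\to M_{x,y}\otimes A_{x,y}$, $\rho_{x,y}(m)=m_{[0]}\otimes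 m_{[1]}$, such that $\rho_{x,z}(ma)=m_{[0]}a_{(1)}\otimes m_{[1]}a_{(2)}$ for all $m\in M_{x,y}$, $a\in A_{y,z}$. *)

theory Defs
  imports "HOL-Algebra.Module" "HOL-Algebra.Free_Abelian_Groups"
begin

section \<open>Linear maps, free, projective and dual modules\<close>

definition linear_maps ::
  "'k ring \<Rightarrow> ('k, 'm, 'r) module_scheme \<Rightarrow> ('k, 'n, 's) module_scheme \<Rightarrow> ('m \<Rightarrow> 'n) set" where
  "linear_maps R M N = {f \<in> carrier M \<rightarrow> carrier N.
     (\<forall>m\<in>carrier M. \<forall>m'\<in>carrier M. f (m \<oplus>\<^bsub>M\<^esub> m') = f m \<oplus>\<^bsub>N\<^esub> f m') \<and>
     (\<forall>r\<in>carrier R. \<forall>m\<in>carrier M. f (r \<odot>\<^bsub>M\<^esub> m) = r \<odot>\<^bsub>N\<^esub> f m)}"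

definition regular_module :: "'k ring \<Rightarrow> ('k, 'k) module" where
  "regular_module R = \<lparr>carrier = carrier R, monoid.mult = monoid.mult R, one = one R,
     ring.zero = ring.zero R, add = add R, smult = monoid.mult R\<rparr>"

text \<open>A module is a record extending \<^typ>\<open>'b ring\<close>, but \<^locale>\<open>module\<close> ignores the fields
  \<^const>\<open>monoid.mult\<close> and \<^const>\<open>one\<close>; below they are left unspecified.\<close>

definition free_module :: "'k ring \<Rightarrow> 'i set \<Rightarrow> ('k, 'i \<Rightarrow> 'k) module" where
  "free_module R I = \<lparr>carrier = {c \<in> I \<rightarrow>\<^sub>E carrier R. finite {i \<in> I. c i \<noteq> \<zero>\<^bsub>R\<^esub>}},
     monoid.mult = undefined, one = undefined,
     ring.zero = (\<lambda>i\<in>I. \<zero>\<^bsub>R\<^esub>), add = (\<lambda>c d. \<lambda>i\<in>I. c i \<oplus>\<^bsub>R\<^esub> d i),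
     smult = (\<lambda>r c. \<lambda>i\<in>I. r \<otimes>\<^bsub>R\<^esub> c i)\<rparr>"

definition finitely_generated :: "'k ring \<Rightarrow> ('k, 'm, 'r) module_scheme \<Rightarrow> bool" where
  "finitely_generated R M \<longleftrightarrow> (\<exists>G \<subseteq> carrier M. finite G \<and>
     (\<forall>m\<in>carrier M. \<exists>c\<in>G \<rightarrow> carrier R. m = (\<Oplus>\<^bsub>M\<^esub>g\<in>G. c g \<odot>\<^bsub>M\<^esub> g)))"

text \<open>Projective: direct summand of a free module; bases of the free module may be taken
  inside the type of \<open>M\<close> because \<open>M\<close> is a quotient of the free module on its own carrier.\<close>

definition projective :: "'k ring \<Rightarrow> ('k, 'm, 'r) module_scheme \<Rightarrow> bool" where
  "projective R M \<longleftrightarrow> (\<exists>I :: 'm set. \<exists>\<sigma> \<in> linear_maps R M (free_module R I).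
     \<exists>\<pi> \<in> linear_maps R (free_module R I) M. \<forall>m\<in>carrier M. \<pi> (\<sigma> m) = m)"

definition fg_projective_module :: "'k ring \<Rightarrow> ('k, 'm, 'r) module_scheme \<Rightarrow> bool" where
  "fg_projective_module R M \<longleftrightarrow> module R M \<and> finitely_generated R M \<and> projective R M"

definition dual :: "'k ring \<Rightarrow> ('k, 'm, 'r) module_scheme \<Rightarrow> ('k, 'm \<Rightarrow> 'k) module" where
  "dual R M = \<lparr>carrier = linear_maps R M (regular_module R) \<inter> extensional (carrier M),
     monoid.mult = undefined, one = undefined,
     ring.zero = (\<lambda>m\<in>carrier M. \<zero>\<^bsub>R\<^esub>), add = (\<lambda>f g. \<lambda>m\<in>carrier M. f m \<oplus>\<^bsub>R\<^esub> g m),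
     smult = (\<lambda>r f. \<lambda>m\<in>carrier M. r \<otimes>\<^bsub>R\<^esub> f m)\<rparr>"

definition finite_dual_basis ::
  "'k ring \<Rightarrow> ('k, 'm, 'r) module_scheme \<Rightarrow> nat \<Rightarrow> (nat \<Rightarrow> 'm \<Rightarrow> 'k) \<Rightarrow> (nat \<Rightarrow> 'm) \<Rightarrow> bool" where
  "finite_dual_basis R M n f e \<longleftrightarrow>
     f \<in> {..<n} \<rightarrow> carrier (dual R M) \<and> e \<in> {..<n} \<rightarrow> carrier M \<and>
     (\<forall>m\<in>carrier M. m = (\<Oplus>\<^bsub>M\<^esub>i\<in>{..<n}. f i m \<odot>\<^bsub>M\<^esub> e i))"


section \<open>Tensor products\<close>

text \<open>The tensor product is the free abelian group on pairs modulo the usual relations, so its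
  elements are cosets of formal integer combinations of pairs.\<close>

type_synonym ('m, 'n) tensor = "('m \<times> 'n \<Rightarrow>\<^sub>0 int) set"

definition tensor_relations ::
  "'k ring \<Rightarrow> ('k, 'm, 'r) module_scheme \<Rightarrow> ('k, 'n, 's) module_scheme \<Rightarrow> ('m, 'n) tensor" where
  "tensor_relations R M N =
     {frag_of (m \<oplus>\<^bsub>M\<^esub> m', n) - frag_of (m, n) - frag_of (m', n) | m m' n.
        m \<in> carrier M \<and> m' \<in> carrier M \<and> n \<in> carrier N} \<union>
     {frag_of (m, n \<oplus>\<^bsub>N\<^esub> n') - frag_of (m, n) - frag_of (m, n') | m n n'.
        m \<in> carrier M \<and> n \<in> carrier N \<and> n' \<in> carrier N} \<union>
     {frag_of (r \<odot>\<^bsub>M\<^esub> m, n) - frag_of (m, r \<odot>\<^bsub>N\<^esub> n) | r m n.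
        r \<in> carrier R \<and> m \<in> carrier M \<and> n \<in> carrier N}"

definition tensor_kernel ::
  "'k ring \<Rightarrow> ('k, 'm, 'r) module_scheme \<Rightarrow> ('k, 'n, 's) module_scheme \<Rightarrow> ('m, 'n) tensor" where
  "tensor_kernel R M N =
     generate (free_Abelian_group (carrier M \<times> carrier N)) (tensor_relations R M N)"

text \<open>Scalars act by \<open>r (m \<otimes> n) = r m \<otimes> n\<close>; the image of a coset of the kernel under this
  action on representatives is again contained in a single coset.\<close>

definition tensor_product ::
  "'k ring \<Rightarrow> ('k, 'm, 'r) module_scheme \<Rightarrow> ('k, 'n, 's) module_scheme
    \<Rightarrow> ('k, ('m, 'n) tensor) module" where
  "tensor_product R M N =
     (let F = free_Abelian_group (carrier M \<times> carrier N); K = tensor_kernel R M N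
      in \<lparr>carrier = carrier (F Mod K), monoid.mult = undefined, one = undefined,
          ring.zero = one (F Mod K), add = monoid.mult (F Mod K),
          smult = (\<lambda>r t. K <#>\<^bsub>F\<^esub> (frag_extend (\<lambda>(m, n). frag_of (r \<odot>\<^bsub>M\<^esub> m, n)) ` t))\<rparr>)"

definition pure_tensor ::
  "'k ring \<Rightarrow> ('k, 'm, 'r) module_scheme \<Rightarrow> ('k, 'n, 's) module_scheme
    \<Rightarrow> 'm \<Rightarrow> 'n \<Rightarrow> ('m, 'n) tensor" where
  "pure_tensor R M N m n =
     tensor_kernel R M N #>\<^bsub>free_Abelian_group (carrier M \<times> carrier N)\<^esub> frag_of (m, n)"

text \<open>The linear map \<open>m \<otimes> n \<mapsto> \<beta> m n\<close> into \<open>P\<close> induced by a bilinear map \<open>\<beta>\<close>: all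
  representatives of a tensor have the same image.\<close>

definition tensor_lift ::
  "('p, 'q) ring_scheme \<Rightarrow> ('m \<Rightarrow> 'n \<Rightarrow> 'p) \<Rightarrow> ('m, 'n) tensor \<Rightarrow> 'p" where
  "tensor_lift P \<beta> t = the_elem
     ((\<lambda>c. \<Oplus>\<^bsub>P\<^esub>u\<in>Poly_Mapping.keys c. [Poly_Mapping.lookup c u] \<cdot>\<^bsub>P\<^esub> \<beta> (fst u) (snd u)) ` t)"

definition tensor_map ::
  "'k ring \<Rightarrow> ('k, 'p, 'r) module_scheme \<Rightarrow> ('k, 'q, 's) module_scheme
    \<Rightarrow> ('m \<Rightarrow> 'p) \<Rightarrow> ('n \<Rightarrow> 'q) \<Rightarrow> ('m, 'n) tensor \<Rightarrow> ('p, 'q) tensor" where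
  "tensor_map R P Q f g =
     tensor_lift (tensor_product R P Q) (\<lambda>m n. pure_tensor R P Q (f m) (g n))"

text \<open>\<open>(m \<otimes> n) \<otimes> p \<mapsto> m \<otimes> (n \<otimes> p)\<close>\<close>

definition tensor_assoc ::
  "'k ring \<Rightarrow> ('k, 'm, 'r) module_scheme \<Rightarrow> ('k, 'n, 's) module_scheme \<Rightarrow> ('k, 'p, 't) module_scheme
    \<Rightarrow> (('m, 'n) tensor, 'p) tensor \<Rightarrow> ('m, ('n, 'p) tensor) tensor" where
  "tensor_assoc R M N P =
     (let T = tensor_product R M (tensor_product R N P)
      in tensor_lift T (\<lambda>t p. tensor_lift T
           (\<lambda>m n. pure_tensor R M (tensor_product R N P) m (pure_tensor R N P n p)) t))"

text \<open>\<open>(m \<otimes> n) \<otimes> (p \<otimes> q) \<mapsto> (m \<otimes> p) \<otimes> (n \<otimes> q)\<close>\<close>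

definition tensor_swap_middle ::
  "'k ring \<Rightarrow> ('k, 'm, 'r) module_scheme \<Rightarrow> ('k, 'n, 's) module_scheme
    \<Rightarrow> ('k, 'p, 't) module_scheme \<Rightarrow> ('k, 'q, 'u) module_scheme
    \<Rightarrow> (('m, 'n) tensor, ('p, 'q) tensor) tensor \<Rightarrow> (('m, 'p) tensor, ('n, 'q) tensor) tensor" where
  "tensor_swap_middle R M N P Q =
     (let MP = tensor_product R M P; NQ = tensor_product R N Q; T = tensor_product R MP NQ
      in tensor_lift T (\<lambda>s t. tensor_lift T (\<lambda>m n. tensor_lift T
           (\<lambda>p q. pure_tensor R MP NQ (pure_tensor R M P m p) (pure_tensor R N Q n q)) t) s))"

text \<open>\<open>r \<otimes> m \<mapsto> r m\<close> and \<open>m \<otimes> r \<mapsto> r m\<close>\<close>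

definition tensor_unit_left ::
  "('k, 'm, 'r) module_scheme \<Rightarrow> ('k, 'm) tensor \<Rightarrow> 'm" where
  "tensor_unit_left M = tensor_lift M (\<lambda>r m. r \<odot>\<^bsub>M\<^esub> m)"

definition tensor_unit_right ::
  "('k, 'm, 'r) module_scheme \<Rightarrow> ('m, 'k) tensor \<Rightarrow> 'm" where
  "tensor_unit_right M = tensor_lift M (\<lambda>m r. r \<odot>\<^bsub>M\<^esub> m)"


section \<open>Coalgebras and comodules\<close>

record ('k, 'c) coalgebra = "('k, 'c) module" +
  comult :: "'c \<Rightarrow> ('c, 'c) tensor"
  counit :: "'c \<Rightarrow> 'k"

locale coalgebra = module R C for R :: "'k ring" (structure) and C :: "('k, 'c) coalgebra" (structure) +
  assumes comult_linear: "comult C \<in> linear_maps R C (tensor_product R C C)"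
    and counit_linear: "counit C \<in> linear_maps R C (regular_module R)"
    and coassoc: "\<And>h. h \<in> carrier C \<Longrightarrow>
      tensor_assoc R C C C (tensor_map R (tensor_product R C C) C (comult C) id (comult C h))
        = tensor_map R C (tensor_product R C C) id (comult C) (comult C h)"
    and counit_left: "\<And>h. h \<in> carrier C \<Longrightarrow>
      tensor_unit_left C (tensor_map R (regular_module R) C (counit C) id (comult C h)) = h"
    and counit_right: "\<And>h. h \<in> carrier C \<Longrightarrow>
      tensor_unit_right C (tensor_map R C (regular_module R) id (counit C) (comult C h)) = h"

definition coalgebra_morphisms ::
  "'k ring \<Rightarrow> ('k, 'c) coalgebra \<Rightarrow> ('k, 'd) coalgebra \<Rightarrow> ('c \<Rightarrow> 'd) set" where
  "coalgebra_morphisms R C D = {f \<in> linear_maps R C D. \<forall>h\<in>carrier C.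
     comult D (f h) = tensor_map R D D f f (comult C h) \<and> counit D (f h) = counit C h}"

definition unit_coalgebra :: "'k ring \<Rightarrow> ('k, 'k) coalgebra" where
  "unit_coalgebra R = module.extend (regular_module R) (coalgebra.fields
     (\<lambda>r. pure_tensor R (regular_module R) (regular_module R) r \<one>\<^bsub>R\<^esub>) (\<lambda>r. r))"

definition tensor_coalgebra ::
  "'k ring \<Rightarrow> ('k, 'c) coalgebra \<Rightarrow> ('k, 'd) coalgebra \<Rightarrow> ('k, ('c, 'd) tensor) coalgebra" where
  "tensor_coalgebra R C D = module.extend (tensor_product R C D) (coalgebra.fields
     (\<lambda>t. tensor_swap_middle R C C D D
            (tensor_map R (tensor_product R C C) (tensor_product R D D) (comult C) (comult D) t))
     (tensor_lift R (\<lambda>h l. counit C h \<otimes>\<^bsub>R\<^esub> counit D l)))"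

locale right_comodule = module R M
  for R :: "'k ring" (structure) and C :: "('k, 'c) coalgebra" and M :: "('k, 'm) module" (structure)
    and \<rho> :: "'m \<Rightarrow> ('m, 'c) tensor" +
  assumes coaction_linear: "\<rho> \<in> linear_maps R M (tensor_product R M C)"
    and coaction_coassoc: "\<And>m. m \<in> carrier M \<Longrightarrow>
      tensor_assoc R M C C (tensor_map R (tensor_product R M C) C \<rho> id (\<rho> m))
        = tensor_map R M (tensor_product R C C) id (comult C) (\<rho> m)"
    and coaction_counit: "\<And>m. m \<in> carrier M \<Longrightarrow>
      tensor_unit_right M (tensor_map R M (regular_module R) id (counit C) (\<rho> m)) = m"

text \<open>The opposite convolution: \<open>\<langle>a b, h\<rangle> = \<langle>a, h\<^sub>2\<rangle> \<langle>b, h\<^sub>1\<rangle>\<close>.\<close>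

definition opposite_convolution ::
  "'k ring \<Rightarrow> ('k, 'c) coalgebra \<Rightarrow> ('c \<Rightarrow> 'k) \<Rightarrow> ('c \<Rightarrow> 'k) \<Rightarrow> ('c \<Rightarrow> 'k)" where
  "opposite_convolution R C a b =
     (\<lambda>h\<in>carrier C. tensor_lift R (\<lambda>h\<^sub>1 h\<^sub>2. a h\<^sub>2 \<otimes>\<^bsub>R\<^esub> b h\<^sub>1) (comult C h))"


section \<open>Hopf categories and Hopf modules\<close>

text \<open>All \<open>A x y\<close> have elements in the same type, which is no restriction: any family of modules
  can be moved into the disjoint union of its carriers. The map \<open>\<mu> x y z\<close> is the composition
  \<open>A x y \<otimes> A y z \<rightarrow> A x z\<close>, and \<open>\<eta> x\<close> is the unit \<open>k \<rightarrow> A x x\<close>, \<open>1 \<mapsto> 1\<^sub>x\<close>.\<close>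

locale hopf_category =
  fixes R :: "'k ring" and Ob :: "'x set"
    and A :: "'x \<Rightarrow> 'x \<Rightarrow> ('k, 'a) coalgebra"
    and \<mu> :: "'x \<Rightarrow> 'x \<Rightarrow> 'x \<Rightarrow> ('a, 'a) tensor \<Rightarrow> 'a"
    and \<eta> :: "'x \<Rightarrow> 'k \<Rightarrow> 'a"
    and S :: "'x \<Rightarrow> 'x \<Rightarrow> 'a \<Rightarrow> 'a"
  assumes base_ring: "cring R"
    and fg_projective: "\<And>x y. \<lbrakk>x \<in> Ob; y \<in> Ob\<rbrakk> \<Longrightarrow> fg_projective_module R (A x y)"
    and hom_coalgebra: "\<And>x y. \<lbrakk>x \<in> Ob; y \<in> Ob\<rbrakk> \<Longrightarrow> coalgebra R (A x y)"
    and comp_coalgebra_morphism: "\<And>x y z. \<lbrakk>x \<in> Ob; y \<in> Ob; z \<in> Ob\<rbrakk> \<Longrightarrow>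
      \<mu> x y z \<in> coalgebra_morphisms R (tensor_coalgebra R (A x y) (A y z)) (A x z)"
    and unit_coalgebra_morphism: "\<And>x. x \<in> Ob \<Longrightarrow>
      \<eta> x \<in> coalgebra_morphisms R (unit_coalgebra R) (A x x)"
    and comp_assoc: "\<And>x y z w h l m. \<lbrakk>x \<in> Ob; y \<in> Ob; z \<in> Ob; w \<in> Ob;
        h \<in> carrier (A x y); l \<in> carrier (A y z); m \<in> carrier (A z w)\<rbrakk> \<Longrightarrow>
      \<mu> x z w (pure_tensor R (A x z) (A z w) (\<mu> x y z (pure_tensor R (A x y) (A y z) h l)) m)
        = \<mu> x y w (pure_tensor R (A x y) (A y w) h (\<mu> y z w (pure_tensor R (A y z) (A z w) l m)))"
    and comp_unit_left: "\<And>x y h. \<lbrakk>x \<in> Ob; y \<in> Ob; h \<in> carrier (A x y)\<rbrakk> \<Longrightarrow>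
      \<mu> x x y (pure_tensor R (A x x) (A x y) (\<eta> x \<one>\<^bsub>R\<^esub>) h) = h"
    and comp_unit_right: "\<And>x y h. \<lbrakk>x \<in> Ob; y \<in> Ob; h \<in> carrier (A x y)\<rbrakk> \<Longrightarrow>
      \<mu> x y y (pure_tensor R (A x y) (A y y) h (\<eta> y \<one>\<^bsub>R\<^esub>)) = h"
    and antipode_linear: "\<And>x y. \<lbrakk>x \<in> Ob; y \<in> Ob\<rbrakk> \<Longrightarrow> S x y \<in> linear_maps R (A x y) (A y x)"
    and antipode_right: "\<And>x y h. \<lbrakk>x \<in> Ob; y \<in> Ob; h \<in> carrier (A x y)\<rbrakk> \<Longrightarrow>
      \<mu> x y x (tensor_map R (A x y) (A y x) id (S x y) (comult (A x y) h))
        = counit (A x y) h \<odot>\<^bsub>A x x\<^esub> \<eta> x \<one>\<^bsub>R\<^esub>"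
    and antipode_left: "\<And>x y h. \<lbrakk>x \<in> Ob; y \<in> Ob; h \<in> carrier (A x y)\<rbrakk> \<Longrightarrow>
      \<mu> y x y (tensor_map R (A y x) (A x y) (S x y) id (comult (A x y) h))
        = counit (A x y) h \<odot>\<^bsub>A y y\<^esub> \<eta> y \<one>\<^bsub>R\<^esub>"

locale hopf_module =
  fixes R :: "'k ring" and Ob :: "'x set"
    and A :: "'x \<Rightarrow> 'x \<Rightarrow> ('k, 'a) coalgebra"
    and \<mu> :: "'x \<Rightarrow> 'x \<Rightarrow> 'x \<Rightarrow> ('a, 'a) tensor \<Rightarrow> 'a"
    and \<eta> :: "'x \<Rightarrow> 'k \<Rightarrow> 'a"
    and M :: "'x \<Rightarrow> 'x \<Rightarrow> ('k, 'm) module"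
    and \<psi> :: "'x \<Rightarrow> 'x \<Rightarrow> 'x \<Rightarrow> ('m, 'a) tensor \<Rightarrow> 'm"
    and \<rho> :: "'x \<Rightarrow> 'x \<Rightarrow> 'm \<Rightarrow> ('m, 'a) tensor"
  assumes module_fg_projective: "\<And>x y. \<lbrakk>x \<in> Ob; y \<in> Ob\<rbrakk> \<Longrightarrow> fg_projective_module R (M x y)"
    and action_linear: "\<And>x y z. \<lbrakk>x \<in> Ob; y \<in> Ob; z \<in> Ob\<rbrakk> \<Longrightarrow>
      \<psi> x y z \<in> linear_maps R (tensor_product R (M x y) (A y z)) (M x z)"
    and action_assoc: "\<And>x y z w m a b. \<lbrakk>x \<in> Ob; y \<in> Ob; z \<in> Ob; w \<in> Ob;
        m \<in> carrier (M x y); a \<in> carrier (A y z); b \<in> carrier (A z w)\<rbrakk> \<Longrightarrow>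
      \<psi> x z w (pure_tensor R (M x z) (A z w) (\<psi> x y z (pure_tensor R (M x y) (A y z) m a)) b)
        = \<psi> x y w (pure_tensor R (M x y) (A y w) m (\<mu> y z w (pure_tensor R (A y z) (A z w) a b)))"
    and action_unit: "\<And>x y m. \<lbrakk>x \<in> Ob; y \<in> Ob; m \<in> carrier (M x y)\<rbrakk> \<Longrightarrow>
      \<psi> x y y (pure_tensor R (M x y) (A y y) m (\<eta> y \<one>\<^bsub>R\<^esub>)) = m"
    and coaction_comodule: "\<And>x y. \<lbrakk>x \<in> Ob; y \<in> Ob\<rbrakk> \<Longrightarrow>
      right_comodule R (A x y) (M x y) (\<rho> x y)"
    and coaction_action: "\<And>x y z m a. \<lbrakk>x \<in> Ob; y \<in> Ob; z \<in> Ob;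
        m \<in> carrier (M x y); a \<in> carrier (A y z)\<rbrakk> \<Longrightarrow>
      \<rho> x z (\<psi> x y z (pure_tensor R (M x y) (A y z) m a))
        = tensor_map R (M x z) (A x z) (\<psi> x y z) (\<mu> x y z)
            (tensor_swap_middle R (M x y) (A x y) (A y z) (A y z)
              (pure_tensor R (tensor_product R (M x y) (A x y)) (tensor_product R (A y z) (A y z))
                (\<rho> x y m) (comult (A y z) a)))"

text \<open>\<open>\<rho>(a) = \<Sum>\<^sub>i a f\<^sub>i \<otimes> e\<^sub>i\<close> for a finite dual basis \<open>f\<^sub>i\<close>, \<open>e\<^sub>i\<close> with \<open>i < n\<close>\<close>

definition dual_coaction ::
  "'k ring \<Rightarrow> ('k, 'a) coalgebra \<Rightarrow> nat \<Rightarrow> (nat \<Rightarrow> 'a \<Rightarrow> 'k) \<Rightarrow> (nat \<Rightarrow> 'a)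
    \<Rightarrow> ('a \<Rightarrow> 'k) \<Rightarrow> ('a \<Rightarrow> 'k, 'a) tensor" where
  "dual_coaction R C n f e a = (\<Oplus>\<^bsub>tensor_product R (dual R C) C\<^esub>i\<in>{..<n}.
     pure_tensor R (dual R C) C (opposite_convolution R C a (f i)) (e i))"

text \<open>\<open>\<langle>a' \<leftharpoonup> a, b\<rangle> = \<langle>a', b S(a)\<rangle>\<close> for \<open>a'\<close> in the dual of \<open>A x y\<close>, \<open>a\<close> in \<open>A y z\<close> and \<open>b\<close> in
  \<open>A x z\<close>, where \<open>b S(a)\<close> is the composite of \<open>b\<close> and \<open>S y z a\<close> in \<open>A z y\<close>\<close>

definition dual_harpoon ::
  "'k ring \<Rightarrow> ('x \<Rightarrow> 'x \<Rightarrow> ('k, 'a) coalgebra) \<Rightarrow> ('x \<Rightarrow> 'x \<Rightarrow> 'x \<Rightarrow> ('a, 'a) tensor \<Rightarrow> 'a)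
    \<Rightarrow> ('x \<Rightarrow> 'x \<Rightarrow> 'a \<Rightarrow> 'a) \<Rightarrow> 'x \<Rightarrow> 'x \<Rightarrow> 'x \<Rightarrow> ('a \<Rightarrow> 'k) \<Rightarrow> 'a \<Rightarrow> 'a \<Rightarrow> 'k" where
  "dual_harpoon R A \<mu> S x y z a' a =
     (\<lambda>b\<in>carrier (A x z). a' (\<mu> x z y (pure_tensor R (A x z) (A z y) b (S y z a))))"

definition dual_action ::
  "'k ring \<Rightarrow> ('x \<Rightarrow> 'x \<Rightarrow> ('k, 'a) coalgebra) \<Rightarrow> ('x \<Rightarrow> 'x \<Rightarrow> 'x \<Rightarrow> ('a, 'a) tensor \<Rightarrow> 'a)
    \<Rightarrow> ('x \<Rightarrow> 'x \<Rightarrow> 'a \<Rightarrow> 'a) \<Rightarrow> 'x \<Rightarrow> 'x \<Rightarrow> 'x \<Rightarrow> ('a \<Rightarrow> 'k, 'a) tensor \<Rightarrow> 'a \<Rightarrow> 'k" where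
  "dual_action R A \<mu> S x y z = tensor_lift (dual R (A x z)) (dual_harpoon R A \<mu> S x y z)"

end

theory Submission
  imports Defs
begin

text \<open>Evaluating the first factor at the elements of \<open>A x y\<close> embeds \<open>A x y\<^sup>* \<otimes> N\<close> into the linear
  maps from \<open>A x y\<close> to \<open>N\<close>, because \<open>t = \<Sum>\<^sub>i f\<^sub>i \<otimes> t(e\<^sub>i)\<close> for a finite dual basis. Under this embedding
  \<open>\<rho>(a)\<close> becomes \<open>h \<mapsto> \<langle>a, h\<^sub>2\<rangle> h\<^sub>1\<close>, so the comodule axioms are coassociativity and counitality.
  The module axioms say that the antipode is antimultiplicative and unital. Compatibility amounts to
  \<open>h\<^sub>1 S(a\<^sub>1)\<^sub>1 a\<^sub>2 \<langle>a', h\<^sub>2 S(a\<^sub>1)\<^sub>2\<rangle> = h\<^sub>1 \<langle>a', h\<^sub>2 S(a)\<rangle>\<close>, which follows from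
  \<open>S(a\<^sub>1)\<^sub>1 a\<^sub>2 \<otimes> S(a\<^sub>1)\<^sub>2 = 1 \<otimes> S(a)\<close>.

  A Sweedler sum \<open>\<beta>(h\<^sub>1, h\<^sub>2)\<close> is written \<open>sweedler P C \<beta> h\<close>. It behaves like an integral: it commutes
  with linear maps, iterated sums may be interchanged, and coassociativity and the counit axioms become
  rewriting rules for iterated sums.\<close>

section \<open>Linear and bilinear maps\<close>

text \<open>\<open>tensor_lift\<close> reads its value off a coset with \<open>the_elem\<close>, so
  it is meaningful only for a bilinear map. Every rewriting of a Sweedler sum therefore carries a
  bilinearity obligation, and a large part of the development consists of rules that discharge such
  obligations by backward chaining.

  Finite generation and projectivity act only through finite dual bases. Without one, a tensor over
  the dual need not be determined by the linear map it induces, and the formula for the coaction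
  makes no sense. Once a coaction is evaluated the basis disappears. Hence the choice of bases is
  immaterial, and the two unrelated bases of \<open>A x y\<close> and \<open>A x z\<close> that meet
  in the compatibility condition need no comparison.

  Both nontrivial identities for the antipode are obtained by inserting the trivial factor
  \<open>c2 S(c3)\<close> and regrouping. For \<open>S(ab) = S(b) S(a)\<close> this is done in one
  argument at a time, which avoids a convolution algebra on the maps out of a tensor
  product.\<close>

lemma linear_mapsI:
  assumes "\<And>m. m \<in> carrier M \<Longrightarrow> f m \<in> carrier N"
    and "\<And>m m'. \<lbrakk>m \<in> carrier M; m' \<in> carrier M\<rbrakk> \<Longrightarrow> f (m \<oplus>\<^bsub>M\<^esub> m') = f m \<oplus>\<^bsub>N\<^esub> f m'"
    and "\<And>r m. \<lbrakk>r \<in> carrier R; m \<in> carrier M\<rbrakk> \<Longrightarrow> f (r \<odot>\<^bsub>M\<^esub> m) = r \<odot>\<^bsub>N\<^esub> f m"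
  shows "f \<in> linear_maps R M N"
  using assms by (auto simp: linear_maps_def)

lemma linear_closed: "f \<in> linear_maps R M N \<Longrightarrow> m \<in> carrier M \<Longrightarrow> f m \<in> carrier N"
  by (auto simp: linear_maps_def)

lemma linear_add: "f \<in> linear_maps R M N \<Longrightarrow> m \<in> carrier M \<Longrightarrow> m' \<in> carrier M
    \<Longrightarrow> f (m \<oplus>\<^bsub>M\<^esub> m') = f m \<oplus>\<^bsub>N\<^esub> f m'"
  by (auto simp: linear_maps_def)

lemma linear_smult: "f \<in> linear_maps R M N \<Longrightarrow> r \<in> carrier R \<Longrightarrow> m \<in> carrier M
    \<Longrightarrow> f (r \<odot>\<^bsub>M\<^esub> m) = r \<odot>\<^bsub>N\<^esub> f m"
  by (auto simp: linear_maps_def)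

lemma linear_id: "(\<lambda>m. m) \<in> linear_maps R M M"
  by (auto intro: linear_mapsI)

lemma linear_comp:
  assumes "g \<in> linear_maps R N P" "f \<in> linear_maps R M N"
  shows "(\<lambda>m. g (f m)) \<in> linear_maps R M P"
  using assms by (auto simp: linear_maps_def Pi_iff)

text \<open>Linearity constrains values on the carrier only. That \<open>M\<close> is a module keeps
  sums and multiples inside the carrier, where \<open>f\<close> and \<open>g\<close> agree.\<close>

lemma linear_cong:
  assumes "f \<in> linear_maps R M N" "\<And>m. m \<in> carrier M \<Longrightarrow> g m = f m" "module R M"
  shows "g \<in> linear_maps R M N"
proof -
  interpret module R M by fact
  show ?thesis using assms(1,2) by (auto simp: linear_maps_def Pi_iff)
qed

lemma linear_zero:
  assumes "f \<in> linear_maps R M N" "module R M" "module R N"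
  shows "f \<zero>\<^bsub>M\<^esub> = \<zero>\<^bsub>N\<^esub>"
proof -
  interpret M: module R M by fact
  interpret N: module R N by fact
  have "f \<zero>\<^bsub>M\<^esub> = f (\<zero>\<^bsub>R\<^esub> \<odot>\<^bsub>M\<^esub> \<zero>\<^bsub>M\<^esub>)" by simp
  also have "\<dots> = \<zero>\<^bsub>R\<^esub> \<odot>\<^bsub>N\<^esub> f \<zero>\<^bsub>M\<^esub>"
    using assms by (intro linear_smult) auto
  also have "\<dots> = \<zero>\<^bsub>N\<^esub>"
    using linear_closed[OF assms(1)] by simp
  finally show ?thesis .
qed

lemma linear_finsum:
  assumes f: "f \<in> linear_maps R M N" and M: "module R M" and N: "module R N"
    and "finite I" and g: "\<And>i. i \<in> I \<Longrightarrow> g i \<in> carrier M"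
  shows "f (\<Oplus>\<^bsub>M\<^esub>i\<in>I. g i) = (\<Oplus>\<^bsub>N\<^esub>i\<in>I. f (g i))"
proof -
  interpret M: module R M by fact
  interpret N: module R N by fact
  show ?thesis
    using \<open>finite I\<close> g
  proof (induction I)
    case empty
    then show ?case using linear_zero[OF f M N] by simp
  next
    case (insert i I)
    then show ?case
      using linear_closed[OF f] by (simp add: linear_add[OF f] Pi_iff)
  qed
qed

lemma linear_plus:
  assumes "module R N" "f \<in> linear_maps R M N" "g \<in> linear_maps R M N"
  shows "(\<lambda>m. f m \<oplus>\<^bsub>N\<^esub> g m) \<in> linear_maps R M N"
proof -
  interpret N: module R N by fact
  have "f m \<in> carrier N" "g m \<in> carrier N" if "m \<in> carrier M" for m
    using that assms(2,3) by (auto intro: linear_closed)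
  then show ?thesis using assms
    by (intro linear_mapsI) (auto simp: linear_add linear_smult N.smult_r_distr N.a_ac)
qed

lemma linear_scale:
  assumes "module R N" "f \<in> linear_maps R M N" "r \<in> carrier R"
  shows "(\<lambda>m. r \<odot>\<^bsub>N\<^esub> f m) \<in> linear_maps R M N"
proof -
  interpret N: module R N by fact
  have "f m \<in> carrier N" if "m \<in> carrier M" for m
    using that assms(2) by (auto intro: linear_closed)
  then show ?thesis using assms
    by (intro linear_mapsI)
      (auto simp: linear_add linear_smult N.smult_r_distr N.m_comm simp flip: N.smult_assoc1)
qed

lemma regular_module_simps [simp]:
  "carrier (regular_module R) = carrier R" "add (regular_module R) = add R"
  "ring.zero (regular_module R) = ring.zero R" "smult (regular_module R) = monoid.mult R"
  by (auto simp: regular_module_def)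

lemma module_regular: "cring R \<Longrightarrow> module R (regular_module R)"
proof -
  assume "cring R"
  then interpret cring R .
  show ?thesis
    by (rule moduleI)
      (auto simp: l_distr r_distr m_assoc is_cring intro!: abelian_groupI intro: a_ac
        bexI[where x="\<ominus>\<^bsub>R\<^esub> _"] l_neg)
qed

lemma linear_scale_left:
  assumes "module R N" "f \<in> linear_maps R M (regular_module R)" "n \<in> carrier N"
  shows "(\<lambda>m. f m \<odot>\<^bsub>N\<^esub> n) \<in> linear_maps R M N"
proof -
  interpret N: module R N by fact
  have "f m \<in> carrier R" if "m \<in> carrier M" for m
    using linear_closed[OF assms(2) that] by simp
  then show ?thesis using assms
    by (intro linear_mapsI)
      (auto simp: linear_add linear_smult N.smult_l_distr N.smult_assoc1)
qed

lemma linear_finsum_map: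
  assumes N: "module R N" and "finite I" "\<And>i. i \<in> I \<Longrightarrow> g i \<in> linear_maps R M N"
  shows "(\<lambda>m. \<Oplus>\<^bsub>N\<^esub>i\<in>I. g i m) \<in> linear_maps R M N"
proof -
  interpret N: module R N by (rule N)
  have gc: "g i m \<in> carrier N" if "i \<in> I" "m \<in> carrier M" for i m
    using linear_closed[OF assms(3)] that .
  show ?thesis
  proof (rule linear_mapsI)
    show "(\<Oplus>\<^bsub>N\<^esub>i\<in>I. g i m) \<in> carrier N" if "m \<in> carrier M" for m
      using gc that by (intro N.finsum_closed) auto
    show "(\<Oplus>\<^bsub>N\<^esub>i\<in>I. g i (m \<oplus>\<^bsub>M\<^esub> m')) = (\<Oplus>\<^bsub>N\<^esub>i\<in>I. g i m) \<oplus>\<^bsub>N\<^esub> (\<Oplus>\<^bsub>N\<^esub>i\<in>I. g i m')"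
      if "m \<in> carrier M" "m' \<in> carrier M" for m m'
      using gc that by (subst N.finsum_addf[symmetric], force, force, intro N.finsum_cong' refl)
        (auto simp: linear_add[OF assms(3)])
    show "(\<Oplus>\<^bsub>N\<^esub>i\<in>I. g i (r \<odot>\<^bsub>M\<^esub> m)) = r \<odot>\<^bsub>N\<^esub> (\<Oplus>\<^bsub>N\<^esub>i\<in>I. g i m)"
      if "r \<in> carrier R" "m \<in> carrier M" for r m
      using gc that assms(2) by (subst N.finsum_smult_ldistr, simp, simp, force, intro N.finsum_cong' refl)
        (auto simp: linear_smult[OF assms(3)])
  qed
qed

text \<open>Curried to match the argument of \<open>tensor_lift\<close>. Nothing is required outside
  the carriers, which is what makes \<open>bilinear_cong\<close> possible.\<close>

definition bilinear_maps where
  "bilinear_maps R M N P = {\<beta>. (\<forall>n\<in>carrier N. (\<lambda>m. \<beta> m n) \<in> linear_maps R M P) \<and>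
     (\<forall>m\<in>carrier M. \<beta> m \<in> linear_maps R N P)}"

lemma bilinearI:
  assumes "\<And>n. n \<in> carrier N \<Longrightarrow> (\<lambda>m. \<beta> m n) \<in> linear_maps R M P"
    and "\<And>m. m \<in> carrier M \<Longrightarrow> (\<lambda>n. \<beta> m n) \<in> linear_maps R N P"
  shows "\<beta> \<in> bilinear_maps R M N P"
  using assms by (auto simp: bilinear_maps_def)

lemma bilinear_left: "\<beta> \<in> bilinear_maps R M N P \<Longrightarrow> n \<in> carrier N \<Longrightarrow> (\<lambda>m. \<beta> m n) \<in> linear_maps R M P"
  and bilinear_right: "\<beta> \<in> bilinear_maps R M N P \<Longrightarrow> m \<in> carrier M \<Longrightarrow> \<beta> m \<in> linear_maps R N P"
  by (auto simp: bilinear_maps_def)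

lemma bilinear_closed:
  "\<beta> \<in> bilinear_maps R M N P \<Longrightarrow> m \<in> carrier M \<Longrightarrow> n \<in> carrier N \<Longrightarrow> \<beta> m n \<in> carrier P"
  by (metis bilinear_right linear_closed)

lemma bilinear_cong:
  assumes "\<beta> \<in> bilinear_maps R M N P" "module R M" "module R N"
    "\<And>m n. m \<in> carrier M \<Longrightarrow> n \<in> carrier N \<Longrightarrow> \<beta>' m n = \<beta> m n"
  shows "\<beta>' \<in> bilinear_maps R M N P"
proof (rule bilinearI)
  show "(\<lambda>m. \<beta>' m n) \<in> linear_maps R M P" if "n \<in> carrier N" for n
    by (rule linear_cong[OF bilinear_left[OF assms(1) that]]) (use assms that in auto)
  show "\<beta>' m \<in> linear_maps R N P" if "m \<in> carrier M" for m
    by (rule linear_cong[OF bilinear_right[OF assms(1) that]]) (use assms that in auto)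
qed

text \<open>This map and the one in the next lemma are those lifted by
  \<open>tensor_unit_left\<close> and \<open>tensor_unit_right\<close>.\<close>

lemma bilinear_smult_left: "module R M \<Longrightarrow> (\<lambda>r m. r \<odot>\<^bsub>M\<^esub> m) \<in> bilinear_maps R (regular_module R) M M"
  by (rule bilinearI) (auto intro!: linear_id linear_scale_left linear_scale)

lemma bilinear_smult_right: "module R M \<Longrightarrow> (\<lambda>m r. r \<odot>\<^bsub>M\<^esub> m) \<in> bilinear_maps R M (regular_module R) M"
  by (rule bilinearI) (auto intro!: linear_id linear_scale_left linear_scale)

section \<open>The universal property of the tensor product\<close>

text \<open>The sum that \<open>tensor_lift\<close> forms from a single representative, isolated
  here as the additive extension of \<open>f\<close> to formal integer combinations.\<close>

definition frag_lift :: "('p, 'q) ring_scheme \<Rightarrow> ('u \<Rightarrow> 'p) \<Rightarrow> ('u \<Rightarrow>\<^sub>0 int) \<Rightarrow> 'p" where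
  "frag_lift P f c = (\<Oplus>\<^bsub>P\<^esub>u\<in>Poly_Mapping.keys c. [Poly_Mapping.lookup c u] \<cdot>\<^bsub>P\<^esub> f u)"

lemma frag_lift_of:
  assumes "abelian_group P" "f x \<in> carrier P"
  shows "frag_lift P f (frag_of x) = f x"
proof -
  interpret abelian_group P by fact
  have "frag_lift P f (frag_of x) = [(1::int)] \<cdot>\<^bsub>P\<^esub> f x"
    using assms(2) by (simp add: frag_lift_def)
  also have "\<dots> = f x"
    using add.int_pow_1[OF assms(2)] .
  finally show ?thesis .
qed

lemma frag_lift_hom:
  assumes "abelian_group P" and f: "\<And>u. u \<in> S \<Longrightarrow> f u \<in> carrier P"
  shows "frag_lift P (f :: 'b \<Rightarrow> _) \<in> hom (free_Abelian_group S) (add_monoid P)"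
proof -
  interpret abelian_group P by fact
  have pc: "[k] \<cdot>\<^bsub>P\<^esub> f u \<in> carrier P" if "u \<in> S" for k :: int and u
    using add.int_pow_closed[OF f[OF that]] .
  \<comment> \<open>The supports of \<open>c\<close>, \<open>d\<close> and \<open>c + d\<close>
    differ, and cancellation may shrink the last one. Summing over a finite superset of the support,
    where the extra coefficients vanish, provides a common index set.\<close>
  have ext: "frag_lift P f c = (\<Oplus>\<^bsub>P\<^esub>u\<in>U. [Poly_Mapping.lookup c u] \<cdot>\<^bsub>P\<^esub> f u)"
    if "Poly_Mapping.keys c \<subseteq> U" "U \<subseteq> S" "finite U" for c :: "'b \<Rightarrow>\<^sub>0 int" and U
    unfolding frag_lift_def
  proof (rule add.finprod_mono_neutral_cong_left)
    fix u assume "u \<in> U - Poly_Mapping.keys c"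
    then have "Poly_Mapping.lookup c u = 0" by (simp add: in_keys_iff)
    then show "[Poly_Mapping.lookup c u] \<cdot>\<^bsub>P\<^esub> f u = \<zero>\<^bsub>P\<^esub>"
      by (simp add: add_pow_def)
  qed (use that pc in auto)
  show ?thesis
  proof (rule homI; clarsimp)
    fix c :: "'b \<Rightarrow>\<^sub>0 int" assume "Poly_Mapping.keys c \<subseteq> S"
    then show "frag_lift P f c \<in> carrier P"
      unfolding frag_lift_def by (intro finsum_closed) (use pc in auto)
  next
    fix c d :: "'b \<Rightarrow>\<^sub>0 int"
    assume cd: "Poly_Mapping.keys c \<subseteq> S" "Poly_Mapping.keys d \<subseteq> S"
    let ?U = "Poly_Mapping.keys c \<union> Poly_Mapping.keys d"
    have U: "?U \<subseteq> S" "finite ?U" using cd by auto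
    have "frag_lift P f (c + d) = (\<Oplus>\<^bsub>P\<^esub>u\<in>?U. [Poly_Mapping.lookup (c + d) u] \<cdot>\<^bsub>P\<^esub> f u)"
      using U keys_add[of c d] by (intro ext) auto
    also have "\<dots> = (\<Oplus>\<^bsub>P\<^esub>u\<in>?U. [Poly_Mapping.lookup c u] \<cdot>\<^bsub>P\<^esub> f u \<oplus>\<^bsub>P\<^esub> [Poly_Mapping.lookup d u] \<cdot>\<^bsub>P\<^esub> f u)"
      using U pc f by (intro finsum_cong') (auto simp: lookup_add add.int_pow_mult subset_iff)
    also have "\<dots> = frag_lift P f c \<oplus>\<^bsub>P\<^esub> frag_lift P f d"
      using U pc by (subst finsum_addf) (auto simp: ext[of c ?U] ext[of d ?U] subset_iff)
    finally show "frag_lift P f (c + d) = frag_lift P f c \<oplus>\<^bsub>P\<^esub> frag_lift P f d" .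
  qed
qed

lemma tensor_lift_eq_frag_lift:
  "tensor_lift P \<beta> t = the_elem (frag_lift P (\<lambda>u. \<beta> (fst u) (snd u)) ` t)"
  by (simp add: tensor_lift_def frag_lift_def)

text \<open>The additive structures coincide, but the two records have different types, so their
  integer multiples have to be compared through the definitions.\<close>

lemma add_pow_regular: "[k] \<cdot>\<^bsub>regular_module R\<^esub> x = [k] \<cdot>\<^bsub>R\<^esub> x" for k :: int
proof -
  have "inv\<^bsub>add_monoid (regular_module R)\<^esub> x = inv\<^bsub>add_monoid R\<^esub> x" for x
    unfolding m_inv_def by simp
  moreover have "x [^]\<^bsub>add_monoid (regular_module R)\<^esub> n = x [^]\<^bsub>add_monoid R\<^esub> n" for n :: nat
    by (simp add: nat_pow_def)
  ultimately show ?thesis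
    by (simp only: add_pow_def int_pow_def2[of _ x k])
qed

text \<open>The counit of a tensor coalgebra and the opposite convolution are lifts into the ring
  \<open>R\<close>, while the rules for lifts ask for a target module. This equation passes from one
  to the other.\<close>

lemma tensor_lift_regular: "tensor_lift R = tensor_lift (regular_module R)"
  by (intro ext) (simp add: tensor_lift_def finsum_def finprod_def add_pow_regular)

context
  fixes R :: "'k ring" and M :: "('k, 'm, 'r) module_scheme" and N :: "('k, 'n, 's) module_scheme"
  assumes M: "module R M" and N: "module R N"
begin

interpretation M: module R M by (rule M)
interpretation N: module R N by (rule N)

private abbreviation (input) "F \<equiv> free_Abelian_group (carrier M \<times> carrier N)"
private abbreviation (input) "K \<equiv> tensor_kernel R M N"
private abbreviation (input) "T \<equiv> tensor_product R M N"
private abbreviation (input) "act \<equiv> \<lambda>r. frag_extend (\<lambda>(m, n). frag_of (r \<odot>\<^bsub>M\<^esub> m, n))"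

interpretation F: comm_group F by (rule abelian_free_Abelian_group)

lemma tensor_relations_closed: "tensor_relations R M N \<subseteq> carrier F"
  unfolding tensor_relations_def
  by (auto dest!: subsetD[OF keys_diff])

lemma tensor_kernel_subgroup: "subgroup K F"
  unfolding tensor_kernel_def by (rule F.generate_is_subgroup[OF tensor_relations_closed])

lemma tensor_kernel_normal: "normal K F"
  using tensor_kernel_subgroup by (simp add: F.normal_iff_subgroup)

interpretation K: normal K F by (rule tensor_kernel_normal)

lemma tensor_zero: "\<zero>\<^bsub>T\<^esub> = K"
  by (simp add: tensor_product_def Let_def)

lemma tensor_carrier: "carrier T = (\<lambda>c. K #>\<^bsub>F\<^esub> c) ` carrier F"
  by (auto simp: tensor_product_def Let_def FactGroup_def RCOSETS_def)

lemma tensor_cosetE: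
  assumes "t \<in> carrier T"
  obtains c where "c \<in> carrier F" "t = K #>\<^bsub>F\<^esub> c"
  using assms unfolding tensor_carrier by (elim imageE)

lemma tensor_coset_add:
  "c \<in> carrier F \<Longrightarrow> d \<in> carrier F \<Longrightarrow>
    (K #>\<^bsub>F\<^esub> c) \<oplus>\<^bsub>T\<^esub> (K #>\<^bsub>F\<^esub> d) = K #>\<^bsub>F\<^esub> (c + d)"
  using K.rcos_sum[of c d] by (simp add: tensor_product_def Let_def)

lemma tensor_abelian: "abelian_group T"
proof -
  interpret Q: comm_group "F Mod K"
    by (rule F.abelian_FactGroup[OF tensor_kernel_subgroup])
  have eqs: "carrier T = carrier (F Mod K)" "add T = monoid.mult (F Mod K)" "\<zero>\<^bsub>T\<^esub> = \<one>\<^bsub>F Mod K\<^esub>"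
    by (auto simp: tensor_product_def Let_def)
  show ?thesis
    by (rule abelian_groupI; unfold eqs)
      (fact Q.m_closed Q.one_closed Q.m_assoc Q.m_comm Q.l_one | rule bexI, rule Q.l_inv, assumption, rule Q.inv_closed, assumption)+
qed

lemma frag_smult_closed: "r \<in> carrier R \<Longrightarrow> c \<in> carrier F \<Longrightarrow> act r c \<in> carrier F"
  by (auto dest!: subsetD[OF keys_frag_extend])

text \<open>The action changes only the left component, so each of the three kinds of relation goes
  to a relation of the same kind. For the third kind, \<open>r (s m) = s (r m)\<close> by
  commutativity of \<open>R\<close>.\<close>

lemma frag_smult_relations:
  assumes r: "r \<in> carrier R" and h: "h \<in> tensor_relations R M N"
  shows "act r h \<in> tensor_relations R M N"
  using h r unfolding tensor_relations_def
  apply (elim UnE CollectE exE conjE)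
    apply (rule UnI1, rule UnI1)
    apply (auto simp: frag_extend_diff M.smult_r_distr)[1]
   apply (rule UnI1, rule UnI2)
   apply (auto simp: frag_extend_diff)[1]
  apply (rule UnI2)
  apply (clarsimp simp: frag_extend_diff)
  by (metis M.smult_assoc1 M.smult_closed M.m_comm)

lemma frag_smult_kernel:
  assumes r: "r \<in> carrier R" and "c \<in> K"
  shows "act r c \<in> K"
  using assms(2) unfolding tensor_kernel_def
proof (induction rule: generate.induct)
  case one
  then show ?case using generate.one[of F] by simp
next
  case (incl h)
  then show ?case by (intro generate.incl frag_smult_relations[OF r])
next
  case (inv h)
  have "h \<in> carrier F" using inv by (rule subsetD[OF tensor_relations_closed])
  moreover have "act r h \<in> carrier F" using frag_smult_closed[OF r calculation] .
  ultimately show ?case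
    using generate.inv[OF frag_smult_relations[OF r inv], of F] by (simp add: frag_extend_minus)
next
  case (eng h1 h2)
  then show ?case using generate.eng[of "act r h1" F _ "act r h2"] by (simp add: frag_extend_add)
qed

text \<open>Well-definedness of the scalar action: on representatives it is additive and maps
  \<open>K\<close> into \<open>K\<close>, so the image of a coset lies in a single coset, and adding
  \<open>K\<close> fills that coset up.\<close>

lemma tensor_coset_smult:
  assumes r: "r \<in> carrier R" and c: "c \<in> carrier F"
  shows "r \<odot>\<^bsub>T\<^esub> (K #>\<^bsub>F\<^esub> c) = K #>\<^bsub>F\<^esub> act r c"
proof -
  have "r \<odot>\<^bsub>T\<^esub> (K #>\<^bsub>F\<^esub> c) = K <#>\<^bsub>F\<^esub> (act r ` (K #>\<^bsub>F\<^esub> c))"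
    by (simp add: tensor_product_def Let_def)
  also have "\<dots> = K #>\<^bsub>F\<^esub> act r c"
  proof (intro equalityI subsetI)
    fix x assume "x \<in> K <#>\<^bsub>F\<^esub> (act r ` (K #>\<^bsub>F\<^esub> c))"
    then obtain k k' where k: "k \<in> K" "k' \<in> K" "x = k + act r (k' + c)"
      by (auto simp: set_mult_def r_coset_def)
    have "k + act r k' \<in> K"
      using K.m_closed[OF k(1) frag_smult_kernel[OF r k(2)]] by simp
    then show "x \<in> K #>\<^bsub>F\<^esub> act r c"
      using k by (auto simp: r_coset_def frag_extend_add add.assoc)
  next
    fix x assume "x \<in> K #>\<^bsub>F\<^esub> act r c"
    then obtain k where k: "k \<in> K" "x = k + act r c"
      by (auto simp: r_coset_def)
    moreover have "c \<in> K #>\<^bsub>F\<^esub> c"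
      using K.one_closed by (auto simp: r_coset_def intro!: bexI[of _ 0])
    ultimately show "x \<in> K <#>\<^bsub>F\<^esub> (act r ` (K #>\<^bsub>F\<^esub> c))"
      by (auto simp: set_mult_def)
  qed
  finally show ?thesis .
qed

lemma pure_closed:
  "m \<in> carrier M \<Longrightarrow> n \<in> carrier N \<Longrightarrow> pure_tensor R M N m n \<in> carrier T"
  unfolding pure_tensor_def tensor_carrier by auto

lemma tensor_coset_eqI:
  assumes "c \<in> carrier F" "d \<in> carrier F" "c - d \<in> K"
  shows "K #>\<^bsub>F\<^esub> c = K #>\<^bsub>F\<^esub> d"
proof -
  have "c \<in> K #>\<^bsub>F\<^esub> d"
    using assms(3) by (force simp: r_coset_def)
  then show ?thesis using F.repr_independence[OF _ assms(2) tensor_kernel_subgroup] by simp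
qed

lemma tensor_relation_in_kernel: "c \<in> tensor_relations R M N \<Longrightarrow> c \<in> K"
  unfolding tensor_kernel_def by (rule generate.incl)

lemma pure_add_left:
  assumes "m \<in> carrier M" "m' \<in> carrier M" "n \<in> carrier N"
  shows "pure_tensor R M N (m \<oplus>\<^bsub>M\<^esub> m') n = pure_tensor R M N m n \<oplus>\<^bsub>T\<^esub> pure_tensor R M N m' n"
proof -
  have "frag_of (m \<oplus>\<^bsub>M\<^esub> m', n) - (frag_of (m, n) + frag_of (m', n)) \<in> K"
    using assms unfolding diff_diff_eq[symmetric]
    by (intro tensor_relation_in_kernel) (auto simp: tensor_relations_def)
  moreover have "frag_of (m, n) \<in> carrier F" "frag_of (m', n) \<in> carrier F" "frag_of (m \<oplus>\<^bsub>M\<^esub> m', n) \<in> carrier F"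
    using assms by auto
  ultimately show ?thesis
    using F.m_closed[of "frag_of (m, n)" "frag_of (m', n)"] unfolding pure_tensor_def
    by (simp only: tensor_coset_add) (rule tensor_coset_eqI; simp)
qed

lemma pure_add_right:
  assumes "m \<in> carrier M" "n \<in> carrier N" "n' \<in> carrier N"
  shows "pure_tensor R M N m (n \<oplus>\<^bsub>N\<^esub> n') = pure_tensor R M N m n \<oplus>\<^bsub>T\<^esub> pure_tensor R M N m n'"
proof -
  have "frag_of (m, n \<oplus>\<^bsub>N\<^esub> n') - (frag_of (m, n) + frag_of (m, n')) \<in> K"
    using assms unfolding diff_diff_eq[symmetric]
    by (intro tensor_relation_in_kernel) (auto simp: tensor_relations_def)
  moreover have "frag_of (m, n) \<in> carrier F" "frag_of (m, n') \<in> carrier F" "frag_of (m, n \<oplus>\<^bsub>N\<^esub> n') \<in> carrier F"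
    using assms by auto
  ultimately show ?thesis
    using F.m_closed[of "frag_of (m, n)" "frag_of (m, n')"] unfolding pure_tensor_def
    by (simp only: tensor_coset_add) (rule tensor_coset_eqI; simp)
qed

lemma pure_smult_left:
  assumes "r \<in> carrier R" "m \<in> carrier M" "n \<in> carrier N"
  shows "pure_tensor R M N (r \<odot>\<^bsub>M\<^esub> m) n = r \<odot>\<^bsub>T\<^esub> pure_tensor R M N m n"
  using assms unfolding pure_tensor_def by (subst tensor_coset_smult) auto

lemma pure_smult_right:
  assumes "r \<in> carrier R" "m \<in> carrier M" "n \<in> carrier N"
  shows "pure_tensor R M N m (r \<odot>\<^bsub>N\<^esub> n) = r \<odot>\<^bsub>T\<^esub> pure_tensor R M N m n"
proof -
  have "frag_of (r \<odot>\<^bsub>M\<^esub> m, n) - frag_of (m, r \<odot>\<^bsub>N\<^esub> n) \<in> K"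
    using assms by (intro tensor_relation_in_kernel) (auto simp: tensor_relations_def)
  then have "pure_tensor R M N (r \<odot>\<^bsub>M\<^esub> m) n = pure_tensor R M N m (r \<odot>\<^bsub>N\<^esub> n)"
    using assms unfolding pure_tensor_def by (intro tensor_coset_eqI) auto
  then show ?thesis using pure_smult_left[OF assms] by simp
qed

text \<open>Zero, negatives and scalar multiples need no cases of their own: zero is
  \<open>0 \<otimes> 0\<close>, the negative of \<open>m \<otimes> n\<close> is
  \<open>(-m) \<otimes> n\<close>, and integer combinations of pairs already exhaust the tensor
  product.\<close>

lemma tensor_induct [consumes 1, case_names pure add]:
  assumes t: "t \<in> carrier T"
    and pure: "\<And>m n. \<lbrakk>m \<in> carrier M; n \<in> carrier N\<rbrakk> \<Longrightarrow> P (pure_tensor R M N m n)"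
    and add: "\<And>s t. \<lbrakk>s \<in> carrier T; t \<in> carrier T; P s; P t\<rbrakk> \<Longrightarrow> P (s \<oplus>\<^bsub>T\<^esub> t)"
  shows "P t"
proof -
  interpret T: abelian_group T by (rule tensor_abelian)
  obtain c where c: "Poly_Mapping.keys c \<subseteq> carrier M \<times> carrier N" and t_eq: "t = K #>\<^bsub>F\<^esub> c"
    using tensor_cosetE[OF t] by auto
  have pure0: "pure_tensor R M N \<zero>\<^bsub>M\<^esub> n = K" if "n \<in> carrier N" for n
  proof -
    have "pure_tensor R M N \<zero>\<^bsub>M\<^esub> n \<oplus>\<^bsub>T\<^esub> pure_tensor R M N \<zero>\<^bsub>M\<^esub> n = pure_tensor R M N \<zero>\<^bsub>M\<^esub> n"
      using pure_add_left[of "\<zero>\<^bsub>M\<^esub>" "\<zero>\<^bsub>M\<^esub>" n] that by simp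
    then show ?thesis
      using pure_closed[of "\<zero>\<^bsub>M\<^esub>" n] that T.add.r_cancel_one by (simp add: tensor_zero)
  qed
  have addc: "P (K #>\<^bsub>F\<^esub> (c + d))" if "P (K #>\<^bsub>F\<^esub> c)" "P (K #>\<^bsub>F\<^esub> d)" "c \<in> carrier F" "d \<in> carrier F" for c d
    using add[OF _ _ that(1,2)] that(3,4) unfolding tensor_coset_add[OF that(3,4)]
    by (auto simp: tensor_carrier)
  \<comment> \<open>\<open>free_Abelian_group_induct\<close> builds combinations by subtraction,
    whereas the case \<open>add\<close> only permits sums; hence \<open>c\<close> and
    \<open>- c\<close> are treated together.\<close>
  have "P (K #>\<^bsub>F\<^esub> c) \<and> P (K #>\<^bsub>F\<^esub> (- c))"
    using c
  proof (induction c rule: free_Abelian_group_induct[consumes 1])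
    case 1
    have "K #>\<^bsub>F\<^esub> 0 = pure_tensor R M N \<zero>\<^bsub>M\<^esub> \<zero>\<^bsub>N\<^esub>"
      using pure0[of "\<zero>\<^bsub>N\<^esub>"] F.coset_mult_one[OF K.subset] by simp
    then show ?case using pure[of "\<zero>\<^bsub>M\<^esub>" "\<zero>\<^bsub>N\<^esub>"] by simp
  next
    case (2 x y)
    then show ?case using addc[of x "-y"] addc[of y "-x"] by simp
  next
    case (3 a)
    then obtain m n where a: "a = (m, n)" "m \<in> carrier M" "n \<in> carrier N" by auto
    have "K #>\<^bsub>F\<^esub> (- frag_of a) = pure_tensor R M N (\<ominus>\<^bsub>M\<^esub> m) n"
    proof -
      have "pure_tensor R M N (\<ominus>\<^bsub>M\<^esub> m) n \<oplus>\<^bsub>T\<^esub> pure_tensor R M N m n = \<zero>\<^bsub>T\<^esub>"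
        using a by (subst pure_add_left[symmetric]) (auto simp: M.l_neg pure0 tensor_zero)
      moreover have "(K #>\<^bsub>F\<^esub> (- frag_of a)) \<oplus>\<^bsub>T\<^esub> pure_tensor R M N m n = \<zero>\<^bsub>T\<^esub>"
        using a unfolding pure_tensor_def
        by (subst tensor_coset_add) (auto simp: tensor_zero F.coset_mult_one[OF K.subset, simplified])
      moreover have "K #>\<^bsub>F\<^esub> (- frag_of a) \<in> carrier T"
        using a unfolding tensor_carrier by auto
      ultimately show ?thesis
        using pure_closed[of m n] pure_closed[of "\<ominus>\<^bsub>M\<^esub> m" n] a by (metis M.a_inv_closed T.add.right_cancel)
    qed
    then show ?case using pure[of m n] pure[of "\<ominus>\<^bsub>M\<^esub> m" n] a by (simp add: pure_tensor_def)
  qed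
  then show ?thesis using t_eq by simp
qed

lemma tensor_module: "module R T"
proof -
  interpret T: abelian_group T by (rule tensor_abelian)
  \<comment> \<open>Closure and distributivity over tensor addition are computed on representatives,
    because the inductions for the remaining axioms use both in the case \<open>add\<close>.\<close>
  have smc: "r \<odot>\<^bsub>T\<^esub> t \<in> carrier T" if r: "r \<in> carrier R" and t: "t \<in> carrier T" for r t
  proof -
    obtain c where c: "c \<in> carrier F" "t = K #>\<^bsub>F\<^esub> c"
      by (rule tensor_cosetE[OF t])
    show ?thesis
      using imageI[OF frag_smult_closed[OF r c(1)], of "\<lambda>c. K #>\<^bsub>F\<^esub> c"]
      unfolding c(2) tensor_coset_smult[OF r c(1)] tensor_carrier .
  qed
  have sma: "r \<odot>\<^bsub>T\<^esub> (s \<oplus>\<^bsub>T\<^esub> t) = r \<odot>\<^bsub>T\<^esub> s \<oplus>\<^bsub>T\<^esub> r \<odot>\<^bsub>T\<^esub> t"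
    if r: "r \<in> carrier R" and st: "s \<in> carrier T" "t \<in> carrier T" for r s t
  proof -
    obtain c where c: "c \<in> carrier F" "s = K #>\<^bsub>F\<^esub> c"
      by (rule tensor_cosetE[OF st(1)])
    obtain d where d: "d \<in> carrier F" "t = K #>\<^bsub>F\<^esub> d"
      by (rule tensor_cosetE[OF st(2)])
    note cd = c d
    have "c + d \<in> carrier F" using F.m_closed[OF cd(1,3)] by simp
    then show ?thesis
      unfolding cd(2,4) tensor_coset_add[OF cd(1,3)]
      by (simp only: tensor_coset_smult[OF r] cd(1,3) frag_extend_add
          tensor_coset_add[OF frag_smult_closed[OF r cd(1)] frag_smult_closed[OF r cd(3)]])
  qed
  show ?thesis
  proof (rule moduleI)
    fix a b x assume ab: "a \<in> carrier R" "b \<in> carrier R" and "x \<in> carrier T"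
    from this(3) show "(a \<oplus>\<^bsub>R\<^esub> b) \<odot>\<^bsub>T\<^esub> x = a \<odot>\<^bsub>T\<^esub> x \<oplus>\<^bsub>T\<^esub> b \<odot>\<^bsub>T\<^esub> x"
    proof (induction rule: tensor_induct)
      case (pure m n)
      then show ?case using ab
        by (simp add: pure_smult_left[symmetric] pure_add_left[symmetric] M.smult_l_distr)
    next
      case (add s t)
      then show ?case using ab by (simp add: sma smc T.a_ac)
    qed
  next
    fix a b x assume ab: "a \<in> carrier R" "b \<in> carrier R" and "x \<in> carrier T"
    from this(3) show "(a \<otimes>\<^bsub>R\<^esub> b) \<odot>\<^bsub>T\<^esub> x = a \<odot>\<^bsub>T\<^esub> (b \<odot>\<^bsub>T\<^esub> x)"
    proof (induction rule: tensor_induct)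
      case (pure m n)
      then show ?case using ab
        by (simp add: pure_smult_left[symmetric] M.smult_assoc1)
    next
      case (add s t)
      then show ?case using ab by (simp add: sma smc)
    qed
  next
    fix x assume "x \<in> carrier T"
    then show "\<one>\<^bsub>R\<^esub> \<odot>\<^bsub>T\<^esub> x = x"
    proof (induction rule: tensor_induct)
      case (pure m n)
      then show ?case by (simp add: pure_smult_left[symmetric])
    next
      case (add s t)
      then show ?case by (simp add: sma smc)
    qed
  qed (use smc sma M.is_cring tensor_abelian in auto)
qed

lemma bilinear_pure: "pure_tensor R M N \<in> bilinear_maps R M N T"
  by (intro bilinearI linear_mapsI)
    (auto intro: pure_closed simp: pure_add_left pure_add_right pure_smult_left pure_smult_right)

lemma tensor_ext:
  assumes "f \<in> linear_maps R T P" "g \<in> linear_maps R T P"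
    and "\<And>m n. \<lbrakk>m \<in> carrier M; n \<in> carrier N\<rbrakk> \<Longrightarrow> f (pure_tensor R M N m n) = g (pure_tensor R M N m n)"
    and "t \<in> carrier T"
  shows "f t = g t"
  using assms(4) by (induction rule: tensor_induct) (auto simp: assms(3) linear_add[OF assms(1)] linear_add[OF assms(2)])

context
  fixes P :: "('k, 'p, 't) module_scheme" and \<beta>
  assumes P: "module R P" and \<beta>: "\<beta> \<in> bilinear_maps R M N P"
begin

interpretation P: module R P by (rule P)

private abbreviation (input) "ext \<equiv> frag_lift P (\<lambda>u. \<beta> (fst u) (snd u))"

lemma frag_lift_bilinear_hom: "ext \<in> hom F (add_monoid P)"
  by (rule frag_lift_hom[OF P.abelian_group_axioms]) (auto intro: bilinear_closed[OF \<beta>])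

interpretation ext: group_hom F "add_monoid P" ext
  by unfold_locales (rule frag_lift_bilinear_hom)

lemma frag_lift_frag_of:
  "m \<in> carrier M \<Longrightarrow> n \<in> carrier N \<Longrightarrow> ext (frag_of (m, n)) = \<beta> m n"
  by (subst frag_lift_of[OF P.abelian_group_axioms]) (auto intro: bilinear_closed[OF \<beta>])

lemma frag_lift_diff:
  assumes "c \<in> carrier F" "d \<in> carrier F"
  shows "ext (c - d) = ext c \<ominus>\<^bsub>P\<^esub> ext d"
proof -
  have "ext (c - d) = ext (c \<otimes>\<^bsub>F\<^esub> inv\<^bsub>F\<^esub> d)"
    using assms by simp
  also have "\<dots> = ext c \<ominus>\<^bsub>P\<^esub> ext d"
    using assms ext.hom_mult[of c "inv\<^bsub>F\<^esub> d"] ext.hom_inv[of d] F.inv_closed[of d] by (simp add: a_minus_def a_inv_def)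
  finally show ?thesis .
qed

text \<open>Bilinearity of \<open>\<beta>\<close> makes the extension vanish on each of the three
  kinds of relation, and the kernel of a homomorphism contains the subgroup they generate.\<close>

lemma frag_lift_kernel:
  assumes "c \<in> K"
  shows "ext c = \<zero>\<^bsub>P\<^esub>"
proof -
  \<comment> \<open>The common shape of the images of the two additivity relations.\<close>
  have cancel: "x \<oplus>\<^bsub>P\<^esub> y \<ominus>\<^bsub>P\<^esub> x \<ominus>\<^bsub>P\<^esub> y = \<zero>\<^bsub>P\<^esub>" if "x \<in> carrier P" "y \<in> carrier P" for x y
  proof -
    have "x \<oplus>\<^bsub>P\<^esub> y \<ominus>\<^bsub>P\<^esub> x \<ominus>\<^bsub>P\<^esub> y = (x \<oplus>\<^bsub>P\<^esub> y) \<ominus>\<^bsub>P\<^esub> (x \<oplus>\<^bsub>P\<^esub> y)"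
      using that by (simp add: P.minus_add a_minus_def P.a_assoc)
    then show ?thesis using that by (simp add: a_minus_def P.r_neg)
  qed
  have "tensor_relations R M N \<subseteq> kernel F (add_monoid P) ext"
  proof
    fix c assume c: "c \<in> tensor_relations R M N"
    have keys: "Poly_Mapping.keys (c - d) \<subseteq> carrier M \<times> carrier N" if "c \<in> carrier F" "d \<in> carrier F" for c d
      using that keys_diff[of c d] by auto
    have "ext c = \<zero>\<^bsub>P\<^esub>"
      using c unfolding tensor_relations_def
      apply (elim UnE CollectE exE conjE)
        apply (simp_all add: frag_lift_diff keys frag_lift_frag_of)
      apply (simp_all add: linear_add[OF bilinear_left[OF \<beta>]] linear_smult[OF bilinear_left[OF \<beta>]]
          linear_add[OF bilinear_right[OF \<beta>]] linear_smult[OF bilinear_right[OF \<beta>]] bilinear_closed[OF \<beta>])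
      apply (auto simp: cancel bilinear_closed[OF \<beta>])
      apply (auto simp: bilinear_closed[OF \<beta>] a_minus_def P.r_neg)
      done
    then show "c \<in> kernel F (add_monoid P) ext"
      using subsetD[OF tensor_relations_closed c] by (simp add: kernel_def)
  qed
  then have "K \<subseteq> kernel F (add_monoid P) ext"
    unfolding tensor_kernel_def by (intro F.generate_subgroup_incl ext.subgroup_kernel)
  then show ?thesis using assms by (auto simp: kernel_def)
qed

text \<open>The extension is constant on cosets, so the image of a coset is a singleton and
  \<open>the_elem\<close> returns its only element. This is what justifies the definition of
  \<open>tensor_lift\<close>.\<close>

lemma tensor_lift_coset:
  assumes c: "c \<in> carrier F"
  shows "tensor_lift P \<beta> (K #>\<^bsub>F\<^esub> c) = ext c"
proof -
  have "ext (k + c) = ext c" if "k \<in> K" for k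
    using ext.hom_mult[of k c] that c K.subset frag_lift_kernel[OF that] ext.hom_closed[OF c] by auto
  moreover have "K \<noteq> {}" using K.one_closed by auto
  moreover have "K #>\<^bsub>F\<^esub> c = (\<lambda>k. k + c) ` K"
    by (auto simp: r_coset_def)
  ultimately have "ext ` (K #>\<^bsub>F\<^esub> c) = {ext c}"
    by (simp add: image_image image_constant_conv)
  then show ?thesis by (simp add: tensor_lift_eq_frag_lift)
qed

lemma tensor_lift_pure:
  "m \<in> carrier M \<Longrightarrow> n \<in> carrier N \<Longrightarrow> tensor_lift P \<beta> (pure_tensor R M N m n) = \<beta> m n"
  unfolding pure_tensor_def by (subst tensor_lift_coset) (auto simp: frag_lift_frag_of)

lemma tensor_lift_linear: "tensor_lift P \<beta> \<in> linear_maps R T P"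
proof (rule linear_mapsI)
  have add: "tensor_lift P \<beta> (s \<oplus>\<^bsub>T\<^esub> t) = tensor_lift P \<beta> s \<oplus>\<^bsub>P\<^esub> tensor_lift P \<beta> t"
    if st: "s \<in> carrier T" "t \<in> carrier T" for s t
  proof -
    obtain c where c: "c \<in> carrier F" "s = K #>\<^bsub>F\<^esub> c"
      by (rule tensor_cosetE[OF st(1)])
    obtain d where d: "d \<in> carrier F" "t = K #>\<^bsub>F\<^esub> d"
      by (rule tensor_cosetE[OF st(2)])
    note cd = c d
    have "c + d \<in> carrier F" using F.m_closed[OF cd(1,3)] by simp
    then show ?thesis
      unfolding cd(2,4) tensor_coset_add[OF cd(1,3)]
      using ext.hom_mult[OF cd(1,3)] cd tensor_lift_coset by simp
  qed
  then show "tensor_lift P \<beta> (s \<oplus>\<^bsub>T\<^esub> t) = tensor_lift P \<beta> s \<oplus>\<^bsub>P\<^esub> tensor_lift P \<beta> t"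
    if "s \<in> carrier T" "t \<in> carrier T" for s t using that .
  have closed: "tensor_lift P \<beta> t \<in> carrier P" if "t \<in> carrier T" for t
    using that
  proof (induction rule: tensor_induct)
    case (pure m n)
    then show ?case using bilinear_closed[OF \<beta>] by (simp add: tensor_lift_pure)
  qed (simp add: add)
  then show "tensor_lift P \<beta> t \<in> carrier P" if "t \<in> carrier T" for t using that .
  interpret T: module R T by (rule tensor_module)
  show "tensor_lift P \<beta> (r \<odot>\<^bsub>T\<^esub> t) = r \<odot>\<^bsub>P\<^esub> tensor_lift P \<beta> t"
    if r: "r \<in> carrier R" and t: "t \<in> carrier T" for r t
    using t
  proof (induction rule: tensor_induct)
    case (pure m n)
    then show ?case using r
      by (simp add: pure_smult_left[symmetric] tensor_lift_pure linear_smult[OF bilinear_left[OF \<beta>]])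
  next
    case (add s t)
    then show ?case using r by (simp add: T.smult_r_distr P.smult_r_distr \<open>\<And>s t. _ \<Longrightarrow> _ \<Longrightarrow> tensor_lift P \<beta> (s \<oplus>\<^bsub>T\<^esub> t) = _\<close> closed)
  qed
qed

end

end

section \<open>Calculus of tensor lifts\<close>

text \<open>\<open>lin_intros\<close> decomposes linearity and bilinearity goals along the structure
  of the map; \<open>lin_closed\<close> supplies the membership and module conditions left over.
  Chained together they discharge most side conditions below.\<close>

named_theorems lin_intros
named_theorems lin_closed

declare linear_id [lin_intros] linear_scale [lin_intros] linear_scale_left [lin_intros]
  bilinearI [lin_intros] tensor_module [lin_closed] module_regular [lin_closed]
  pure_closed [lin_closed]

lemma module_smult_closed [lin_closed]:
  "module R M \<Longrightarrow> r \<in> carrier R \<Longrightarrow> m \<in> carrier M \<Longrightarrow> r \<odot>\<^bsub>M\<^esub> m \<in> carrier M"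
  by (rule module.smult_closed)

lemma linear_pure_left [lin_intros]:
  assumes "f \<in> linear_maps R L M" "n \<in> carrier N" "module R M" "module R N"
  shows "(\<lambda>x. pure_tensor R M N (f x) n) \<in> linear_maps R L (tensor_product R M N)"
  by (rule linear_comp[OF bilinear_left[OF bilinear_pure]]) (use assms in auto)

lemma linear_pure_right [lin_intros]:
  assumes "f \<in> linear_maps R L N" "m \<in> carrier M" "module R M" "module R N"
  shows "(\<lambda>x. pure_tensor R M N m (f x)) \<in> linear_maps R L (tensor_product R M N)"
  by (rule linear_comp[OF bilinear_right[OF bilinear_pure]]) (use assms in auto)

lemma tensor_lift_linear_arg [lin_intros]:
  assumes "f \<in> linear_maps R L (tensor_product R M N)" "\<beta> \<in> bilinear_maps R M N P"
    "module R M" "module R N" "module R P"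
  shows "(\<lambda>x. tensor_lift P \<beta> (f x)) \<in> linear_maps R L P"
  by (rule linear_comp[OF tensor_lift_linear]) (use assms in auto)

lemma tensor_lift_closed [lin_closed]:
  assumes "t \<in> carrier (tensor_product R M N)" "\<beta> \<in> bilinear_maps R M N P"
    "module R M" "module R N" "module R P"
  shows "tensor_lift P \<beta> t \<in> carrier P"
  by (rule linear_closed[OF tensor_lift_linear]) (use assms in auto)

text \<open>The counterpart of \<open>tensor_lift_linear_arg\<close> with the parameter in the
  bilinear map and the tensor fixed. Both sides of each required equation are linear in
  \<open>t\<close>, so it suffices to compare them on pure tensors, where they reduce to linearity
  of \<open>\<beta> x m n\<close> in \<open>x\<close>.\<close>

lemma tensor_lift_linear_body [lin_intros]:
  assumes t: "t \<in> carrier (tensor_product R M N)"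
    and lin: "\<And>m n. \<lbrakk>m \<in> carrier M; n \<in> carrier N\<rbrakk> \<Longrightarrow> (\<lambda>x. \<beta> x m n) \<in> linear_maps R L P"
    and bil: "\<And>x. x \<in> carrier L \<Longrightarrow> \<beta> x \<in> bilinear_maps R M N P"
    and M: "module R M" and N: "module R N" and P: "module R P" and L: "module R L"
  shows "(\<lambda>x. tensor_lift P (\<beta> x) t) \<in> linear_maps R L P"
proof (rule linear_mapsI)
  interpret L: module R L by (rule L)
  note tl = tensor_lift_linear[OF M N P bil] and tp = tensor_lift_pure[OF M N P bil]
  fix x assume x: "x \<in> carrier L"
  show "tensor_lift P (\<beta> x) t \<in> carrier P"
    by (rule linear_closed[OF tl[OF x] t])
  show "tensor_lift P (\<beta> (x \<oplus>\<^bsub>L\<^esub> y)) t = tensor_lift P (\<beta> x) t \<oplus>\<^bsub>P\<^esub> tensor_lift P (\<beta> y) t"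
    if y: "y \<in> carrier L" for y
    by (rule tensor_ext[OF M N tl linear_plus[OF P tl[OF x] tl[OF y]] _ t])
      (use x y in \<open>auto simp: tp linear_add[OF lin]\<close>)
  show "tensor_lift P (\<beta> (r \<odot>\<^bsub>L\<^esub> x)) t = r \<odot>\<^bsub>P\<^esub> tensor_lift P (\<beta> x) t"
    if r: "r \<in> carrier R" for r
    by (rule tensor_ext[OF M N tl linear_scale[OF P tl[OF x] r] _ t])
      (use x r in \<open>auto simp: tp linear_smult[OF lin]\<close>)
qed

lemma tensor_lift_cong:
  assumes "\<beta> \<in> bilinear_maps R M N P" "t \<in> carrier (tensor_product R M N)"
    "module R M" "module R N" "module R P"
    "\<And>m n. \<lbrakk>m \<in> carrier M; n \<in> carrier N\<rbrakk> \<Longrightarrow> \<beta> m n = \<beta>' m n"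
  shows "tensor_lift P \<beta> t = tensor_lift P \<beta>' t"
proof -
  have \<beta>': "\<beta>' \<in> bilinear_maps R M N P"
    by (rule bilinear_cong[OF assms(1,3,4)]) (simp add: assms(6))
  show ?thesis
    by (rule tensor_ext[OF assms(3,4) _ _ _ assms(2)])
      (use assms \<beta>' in \<open>auto intro: tensor_lift_linear simp: tensor_lift_pure\<close>)
qed

lemma bilinear_comp:
  assumes "\<beta> \<in> bilinear_maps R M N P" "g \<in> linear_maps R P Q"
  shows "(\<lambda>m n. g (\<beta> m n)) \<in> bilinear_maps R M N Q"
  by (intro bilinearI linear_comp[OF assms(2)] bilinear_left[OF assms(1)] bilinear_right[OF assms(1)])

lemma linear_tensor_lift:
  assumes g: "g \<in> linear_maps R P Q" and \<beta>: "\<beta> \<in> bilinear_maps R M N P"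
    and t: "t \<in> carrier (tensor_product R M N)"
    and mods: "module R M" "module R N" "module R P" "module R Q"
  shows "g (tensor_lift P \<beta> t) = tensor_lift Q (\<lambda>m n. g (\<beta> m n)) t"
  by (rule tensor_ext[OF mods(1,2) linear_comp[OF g] _ _ t])
    (use mods \<beta> bilinear_comp[OF \<beta> g] in \<open>auto intro: tensor_lift_linear simp: tensor_lift_pure\<close>)

lemma tensor_lift_pure_tensor:
  assumes "module R M" "module R N" "t \<in> carrier (tensor_product R M N)"
  shows "tensor_lift (tensor_product R M N) (pure_tensor R M N) t = t"
  by (rule tensor_ext[OF assms(1,2) _ linear_id _ assms(3)])
    (use assms in \<open>auto intro: tensor_lift_linear bilinear_pure tensor_module simp: tensor_lift_pure tensor_module bilinear_pure\<close>)

text \<open>Fubini for tensor lifts. Both sides are linear in \<open>t\<close>, so \<open>t\<close>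
  may be taken pure, and then the lift over \<open>t\<close> is plain application on either
  side.\<close>

lemma tensor_lift_swap:
  assumes t: "t \<in> carrier (tensor_product R M N)" and s: "s \<in> carrier (tensor_product R M' N')"
    and 1: "\<And>m n. \<lbrakk>m \<in> carrier M; n \<in> carrier N\<rbrakk> \<Longrightarrow> \<gamma> m n \<in> bilinear_maps R M' N' P"
    and 2: "\<And>m n. \<lbrakk>m \<in> carrier M'; n \<in> carrier N'\<rbrakk>
      \<Longrightarrow> (\<lambda>m' n'. \<gamma> m' n' m n) \<in> bilinear_maps R M N P"
    and mods: "module R M" "module R N" "module R M'" "module R N'" "module R P"
  shows "tensor_lift P (\<lambda>m n. tensor_lift P (\<gamma> m n) s) t
    = tensor_lift P (\<lambda>m' n'. tensor_lift P (\<lambda>m n. \<gamma> m n m' n') t) s"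
proof -
  have b1: "(\<lambda>m n. tensor_lift P (\<gamma> m n) s) \<in> bilinear_maps R M N P"
    by (assumption | rule lin_intros s 1 mods bilinear_left[OF 2] bilinear_right[OF 2])+
  \<comment> \<open>Needed for every \<open>u\<close>, since the right-hand side is about to be
    viewed as a function of its tensor \<open>t\<close>.\<close>
  have b2: "(\<lambda>m' n'. tensor_lift P (\<lambda>m n. \<gamma> m n m' n') u) \<in> bilinear_maps R M' N' P"
    if "u \<in> carrier (tensor_product R M N)" for u
    by (assumption | rule lin_intros that 2 mods bilinear_left[OF 1] bilinear_right[OF 1])+
  show ?thesis
  proof (rule tensor_ext[OF mods(1,2) tensor_lift_linear[OF mods(1,2,5) b1] _ _ t])
    show "(\<lambda>t. tensor_lift P (\<lambda>m' n'. tensor_lift P (\<lambda>m n. \<gamma> m n m' n') t) s)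
        \<in> linear_maps R (tensor_product R M N) P"
      by (intro tensor_lift_linear_body[OF s] tensor_lift_linear b2 2 mods tensor_module)
    show "tensor_lift P (\<lambda>m n. tensor_lift P (\<gamma> m n) s) (pure_tensor R M N m n)
        = tensor_lift P (\<lambda>m' n'. tensor_lift P (\<lambda>m n. \<gamma> m n m' n') (pure_tensor R M N m n)) s"
      if mn: "m \<in> carrier M" "n \<in> carrier N" for m n
      unfolding tensor_lift_pure[OF mods(1,2,5) b1 mn]
      by (rule tensor_lift_cong[OF 1[OF mn] s mods(3,4,5)])
        (simp add: tensor_lift_pure[OF mods(1,2,5) 2 mn])
  qed
qed

section \<open>Tensor products of maps, the associator and the interchange of middle factors\<close>

lemma tensor_map_bilinear:
  assumes "f \<in> linear_maps R M P" "g \<in> linear_maps R N Q" "module R P" "module R Q"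
  shows "(\<lambda>m n. pure_tensor R P Q (f m) (g n)) \<in> bilinear_maps R M N (tensor_product R P Q)"
  by (assumption | rule lin_intros assms lin_closed linear_closed[OF assms(1)] linear_closed[OF assms(2)])+

lemma tensor_map_pure:
  assumes "f \<in> linear_maps R M P" "g \<in> linear_maps R N Q" "m \<in> carrier M" "n \<in> carrier N"
    "module R M" "module R N" "module R P" "module R Q"
  shows "tensor_map R P Q f g (pure_tensor R M N m n) = pure_tensor R P Q (f m) (g n)"
  unfolding tensor_map_def
  by (rule tensor_lift_pure[OF _ _ _ tensor_map_bilinear]) (use assms in \<open>auto intro: tensor_module\<close>)

lemma tensor_map_linear:
  assumes "f \<in> linear_maps R M P" "g \<in> linear_maps R N Q"
    "module R M" "module R N" "module R P" "module R Q"
  shows "tensor_map R P Q f g \<in> linear_maps R (tensor_product R M N) (tensor_product R P Q)"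
  unfolding tensor_map_def
  by (rule tensor_lift_linear[OF _ _ _ tensor_map_bilinear]) (use assms in \<open>auto intro: tensor_module\<close>)

lemma linear_tensor_map:
  assumes "f \<in> linear_maps R M P" "g \<in> linear_maps R N Q"
    "l \<in> linear_maps R (tensor_product R P Q) L" "t \<in> carrier (tensor_product R M N)"
    "module R M" "module R N" "module R P" "module R Q" "module R L"
  shows "l (tensor_map R P Q f g t) = tensor_lift L (\<lambda>m n. l (pure_tensor R P Q (f m) (g n))) t"
  unfolding tensor_map_def
  by (rule linear_tensor_lift[OF assms(3) tensor_map_bilinear[OF assms(1,2)] assms(4)])
    (rule assms lin_closed)+

lemma tensor_lift_tensor_map:
  assumes f: "f \<in> linear_maps R M P" and g: "g \<in> linear_maps R N Q"
    and \<beta>: "\<beta> \<in> bilinear_maps R P Q L" and t: "t \<in> carrier (tensor_product R M N)"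
    and mods: "module R M" "module R N" "module R P" "module R Q" "module R L"
  shows "tensor_lift L \<beta> (tensor_map R P Q f g t) = tensor_lift L (\<lambda>m n. \<beta> (f m) (g n)) t"
proof -
  have "tensor_lift L \<beta> (tensor_map R P Q f g t)
      = tensor_lift L (\<lambda>m n. tensor_lift L \<beta> (pure_tensor R P Q (f m) (g n))) t"
    unfolding tensor_map_def
    by (rule linear_tensor_lift[OF tensor_lift_linear tensor_map_bilinear[OF f g]])
      (use assms in \<open>auto intro: tensor_module\<close>)
  also have "\<dots> = tensor_lift L (\<lambda>m n. \<beta> (f m) (g n)) t"
  proof (rule tensor_lift_cong[OF _ t mods(1,2,5)])
    show "(\<lambda>m n. tensor_lift L \<beta> (pure_tensor R P Q (f m) (g n))) \<in> bilinear_maps R M N L"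
      by (rule bilinear_comp[OF tensor_map_bilinear[OF f g] tensor_lift_linear]) (use mods \<beta> in auto)
  qed (use f g \<beta> mods in \<open>auto simp: tensor_lift_pure linear_closed\<close>)
  finally show ?thesis .
qed

lemma tensor_assoc_bilinear_inner:
  assumes "module R M" "module R N" "module R P" "p \<in> carrier P"
  shows "(\<lambda>m n. pure_tensor R M (tensor_product R N P) m (pure_tensor R N P n p))
    \<in> bilinear_maps R M N (tensor_product R M (tensor_product R N P))"
  by (assumption | rule lin_intros assms lin_closed)+

lemma tensor_assoc_bilinear:
  assumes "module R M" "module R N" "module R P"
  shows "(\<lambda>t p. tensor_lift (tensor_product R M (tensor_product R N P))
           (\<lambda>m n. pure_tensor R M (tensor_product R N P) m (pure_tensor R N P n p)) t)
    \<in> bilinear_maps R (tensor_product R M N) P (tensor_product R M (tensor_product R N P))"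
  by (assumption | rule lin_intros assms lin_closed)+

lemma tensor_assoc_linear:
  assumes "module R M" "module R N" "module R P"
  shows "tensor_assoc R M N P \<in> linear_maps R (tensor_product R (tensor_product R M N) P)
    (tensor_product R M (tensor_product R N P))"
  unfolding tensor_assoc_def Let_def
  by (rule tensor_lift_linear[OF _ _ _ tensor_assoc_bilinear]; (assumption | rule assms lin_closed)+)

lemma tensor_assoc_pure:
  assumes "module R M" "module R N" "module R P" "t \<in> carrier (tensor_product R M N)" "p \<in> carrier P"
  shows "tensor_assoc R M N P (pure_tensor R (tensor_product R M N) P t p)
    = tensor_lift (tensor_product R M (tensor_product R N P))
        (\<lambda>m n. pure_tensor R M (tensor_product R N P) m (pure_tensor R N P n p)) t"
  unfolding tensor_assoc_def Let_def
  by (rule tensor_lift_pure[OF _ _ _ tensor_assoc_bilinear]; (assumption | rule assms lin_closed)+)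

lemma tensor_swap_middle_bilinear_inner:
  assumes "module R M" "module R N" "module R P" "module R Q" "m \<in> carrier M" "n \<in> carrier N"
  shows "(\<lambda>p q. pure_tensor R (tensor_product R M P) (tensor_product R N Q)
        (pure_tensor R M P m p) (pure_tensor R N Q n q))
    \<in> bilinear_maps R P Q (tensor_product R (tensor_product R M P) (tensor_product R N Q))"
  by (assumption | rule lin_intros assms lin_closed)+

lemma tensor_swap_middle_bilinear:
  assumes "module R M" "module R N" "module R P" "module R Q"
  shows "(\<lambda>s t. tensor_lift (tensor_product R (tensor_product R M P) (tensor_product R N Q))
      (\<lambda>m n. tensor_lift (tensor_product R (tensor_product R M P) (tensor_product R N Q))
           (\<lambda>p q. pure_tensor R (tensor_product R M P) (tensor_product R N Q)
        (pure_tensor R M P m p) (pure_tensor R N Q n q)) t) s)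
    \<in> bilinear_maps R (tensor_product R M N) (tensor_product R P Q)
       (tensor_product R (tensor_product R M P) (tensor_product R N Q))"
  by (assumption | rule lin_intros assms lin_closed)+

lemma tensor_swap_middle_linear:
  assumes "module R M" "module R N" "module R P" "module R Q"
  shows "tensor_swap_middle R M N P Q
    \<in> linear_maps R (tensor_product R (tensor_product R M N) (tensor_product R P Q))
       (tensor_product R (tensor_product R M P) (tensor_product R N Q))"
  unfolding tensor_swap_middle_def Let_def
  by (rule tensor_lift_linear[OF _ _ _ tensor_swap_middle_bilinear]; (assumption | rule assms lin_closed)+)

lemma tensor_swap_middle_pure:
  assumes "module R M" "module R N" "module R P" "module R Q"
    "s \<in> carrier (tensor_product R M N)" "t \<in> carrier (tensor_product R P Q)"
  shows "tensor_swap_middle R M N P Q (pure_tensor R (tensor_product R M N) (tensor_product R P Q) s t)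
    = tensor_lift (tensor_product R (tensor_product R M P) (tensor_product R N Q))
      (\<lambda>m n. tensor_lift (tensor_product R (tensor_product R M P) (tensor_product R N Q))
           (\<lambda>p q. pure_tensor R (tensor_product R M P) (tensor_product R N Q)
        (pure_tensor R M P m p) (pure_tensor R N Q n q)) t) s"
  unfolding tensor_swap_middle_def Let_def
  by (rule tensor_lift_pure[OF _ _ _ tensor_swap_middle_bilinear]; (assumption | rule assms lin_closed)+)

text \<open>The interchange is always followed by a linear map when it is computed: once in the
  comultiplication of a product, once in the right-hand side of the Hopf module compatibility. This
  form turns both into iterated lifts.\<close>

lemma linear_tensor_swap_middle:
  assumes g: "g \<in> linear_maps R (tensor_product R (tensor_product R M P) (tensor_product R N Q)) L"
    and s: "s \<in> carrier (tensor_product R M N)" and t: "t \<in> carrier (tensor_product R P Q)"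
    and mods: "module R M" "module R N" "module R P" "module R Q" "module R L"
  shows "g (tensor_swap_middle R M N P Q (pure_tensor R (tensor_product R M N) (tensor_product R P Q) s t))
    = tensor_lift L (\<lambda>m n. tensor_lift L (\<lambda>p q. g (pure_tensor R (tensor_product R M P) (tensor_product R N Q)
        (pure_tensor R M P m p) (pure_tensor R N Q n q))) t) s"
proof -
  let ?T = "tensor_product R (tensor_product R M P) (tensor_product R N Q)"
  let ?p = "\<lambda>m n p q. pure_tensor R (tensor_product R M P) (tensor_product R N Q)
        (pure_tensor R M P m p) (pure_tensor R N Q n q)"
  have T: "module R ?T" by (rule lin_closed mods)+
  note inner = tensor_swap_middle_bilinear_inner[OF mods(1-4)]
  have outer: "(\<lambda>m n. tensor_lift ?T (?p m n) t) \<in> bilinear_maps R M N ?T"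
    by (assumption | rule lin_intros t mods lin_closed)+
  have "g (tensor_swap_middle R M N P Q (pure_tensor R (tensor_product R M N) (tensor_product R P Q) s t))
    = tensor_lift L (\<lambda>m n. g (tensor_lift ?T (?p m n) t)) s"
    unfolding tensor_swap_middle_pure[OF mods(1-4) s t]
    by (rule linear_tensor_lift[OF g outer s mods(1,2) T mods(5)])
  also have "\<dots> = tensor_lift L (\<lambda>m n. tensor_lift L (\<lambda>p q. g (?p m n p q)) t) s"
    by (rule tensor_lift_cong[OF bilinear_comp[OF outer g] s mods(1,2,5)])
      (rule linear_tensor_lift[OF g inner t mods(3,4) T mods(5)])
  finally show ?thesis .
qed

section \<open>Dual modules and dual bases\<close>

lemma dual_carrier:
  "a \<in> carrier (dual R M) \<longleftrightarrow> a \<in> linear_maps R M (regular_module R) \<and> a \<in> extensional (carrier M)"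
  by (simp add: dual_def)

lemma dual_linear: "a \<in> carrier (dual R M) \<Longrightarrow> a \<in> linear_maps R M (regular_module R)"
  by (simp add: dual_carrier)

lemma dual_closed [lin_closed]: "a \<in> carrier (dual R M) \<Longrightarrow> m \<in> carrier M \<Longrightarrow> a m \<in> carrier R"
  using linear_closed[OF dual_linear] by fastforce

lemma dual_eqI:
  assumes "a \<in> carrier (dual R M)" "b \<in> carrier (dual R M)"
    "\<And>m. m \<in> carrier M \<Longrightarrow> a m = b m"
  shows "a = b"
  using assms by (auto simp: dual_carrier intro: extensionalityI)

lemma dual_apply [simp]:
  "m \<in> carrier M \<Longrightarrow> (a \<oplus>\<^bsub>dual R M\<^esub> b) m = a m \<oplus>\<^bsub>R\<^esub> b m"
  "m \<in> carrier M \<Longrightarrow> (r \<odot>\<^bsub>dual R M\<^esub> a) m = r \<otimes>\<^bsub>R\<^esub> a m"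
  "m \<in> carrier M \<Longrightarrow> \<zero>\<^bsub>dual R M\<^esub> m = \<zero>\<^bsub>R\<^esub>"
  by (auto simp: dual_def)

lemma restrict_dual:
  assumes "module R M" "f \<in> linear_maps R M (regular_module R)"
  shows "(\<lambda>m\<in>carrier M. f m) \<in> carrier (dual R M)"
  using linear_cong[OF assms(2) _ assms(1)] by (simp add: dual_carrier)

lemma dual_module [lin_closed]:
  assumes M: "module R M"
  shows "module R (dual R M)"
proof -
  interpret M: module R M by (rule M)
  note reg = module_regular[OF M.is_cring]
  interpret reg: module R "regular_module R" by (rule reg)
  have add: "a \<oplus>\<^bsub>dual R M\<^esub> b \<in> carrier (dual R M)"
    if "a \<in> carrier (dual R M)" "b \<in> carrier (dual R M)" for a b
    using restrict_dual[OF M linear_plus[OF reg dual_linear[OF that(1)] dual_linear[OF that(2)]]]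
    by (simp add: dual_def)
  have smult: "r \<odot>\<^bsub>dual R M\<^esub> a \<in> carrier (dual R M)"
    if "r \<in> carrier R" "a \<in> carrier (dual R M)" for a r
    using restrict_dual[OF M linear_scale[OF reg dual_linear[OF that(2)] that(1)]]
    by (simp add: dual_def)
  have zero: "\<zero>\<^bsub>dual R M\<^esub> \<in> carrier (dual R M)"
    using restrict_dual[OF M, of "\<lambda>_. \<zero>\<^bsub>R\<^esub>"] by (simp add: dual_def linear_maps_def)
  note dc = dual_closed[of _ R M]
  show ?thesis
  proof (rule moduleI[OF M.is_cring])
    show "abelian_group (dual R M)"
    proof (rule abelian_groupI[OF add zero])
      show "\<exists>b\<in>carrier (dual R M). b \<oplus>\<^bsub>dual R M\<^esub> a = \<zero>\<^bsub>dual R M\<^esub>" if a: "a \<in> carrier (dual R M)" for a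
      proof
        have *: "\<ominus>\<^bsub>R\<^esub> \<one>\<^bsub>R\<^esub> \<in> carrier R" by simp
        show "(\<ominus>\<^bsub>R\<^esub> \<one>\<^bsub>R\<^esub>) \<odot>\<^bsub>dual R M\<^esub> a \<in> carrier (dual R M)"
          by (rule smult[OF * a])
        show "(\<ominus>\<^bsub>R\<^esub> \<one>\<^bsub>R\<^esub>) \<odot>\<^bsub>dual R M\<^esub> a \<oplus>\<^bsub>dual R M\<^esub> a = \<zero>\<^bsub>dual R M\<^esub>"
          by (rule dual_eqI[OF add[OF smult[OF * a] a] zero])
            (use a dc in \<open>simp add: M.R.l_minus M.R.l_neg\<close>)
      qed
    qed (assumption | rule dual_eqI add zero | simp add: dc M.R.a_ac)+
  qed (assumption | rule dual_eqI add smult M.R.a_closed M.R.m_closed M.R.one_closed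
      | simp add: dc M.R.l_distr M.R.r_distr M.R.m_assoc)+
qed

lemma dual_apply_linear:
  "m \<in> carrier M \<Longrightarrow> (\<lambda>a. a m) \<in> linear_maps R (dual R M) (regular_module R)"
  by (intro linear_mapsI) (auto intro: dual_closed)

text \<open>The operations of the dual are pointwise, so linearity can be tested after evaluation at
  each \<open>h\<close>.\<close>

lemma linear_into_dual:
  assumes M: "module R M" and N: "module R N"
    and F: "\<And>m. m \<in> carrier M \<Longrightarrow> F m \<in> carrier (dual R N)"
    and lin: "\<And>h. h \<in> carrier N \<Longrightarrow> (\<lambda>m. F m h) \<in> linear_maps R M (regular_module R)"
  shows "F \<in> linear_maps R M (dual R N)"
proof -
  interpret M: module R M by (rule M)
  interpret D: module R "dual R N" by (rule dual_module[OF N])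
  show ?thesis
  proof (rule linear_mapsI)
    show "F (m \<oplus>\<^bsub>M\<^esub> m') = F m \<oplus>\<^bsub>dual R N\<^esub> F m'" if "m \<in> carrier M" "m' \<in> carrier M" for m m'
      by (rule dual_eqI[of _ R N]) (use that F linear_add[OF lin] in auto)
    show "F (r \<odot>\<^bsub>M\<^esub> m) = r \<odot>\<^bsub>dual R N\<^esub> F m" if "r \<in> carrier R" "m \<in> carrier M" for r m
      by (rule dual_eqI[of _ R N]) (use that F linear_smult[OF lin] in auto)
  qed (rule F)
qed

section \<open>Contraction of tensors over the dual\<close>

definition tensor_eval :: "('k, 'n, 's) module_scheme \<Rightarrow> 'm \<Rightarrow> ('m \<Rightarrow> 'k, 'n) tensor \<Rightarrow> 'n" where
  "tensor_eval N m = tensor_lift N (\<lambda>a n. a m \<odot>\<^bsub>N\<^esub> n)"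

context
  fixes R :: "'k ring" and M :: "('k, 'm, 'r) module_scheme" and N :: "('k, 'n, 's) module_scheme"
  assumes M: "module R M" and N: "module R N"
begin

lemma tensor_eval_bilinear:
  "m \<in> carrier M \<Longrightarrow> (\<lambda>a n. a m \<odot>\<^bsub>N\<^esub> n) \<in> bilinear_maps R (dual R M) N N"
  by (assumption | rule dual_apply_linear lin_intros M N lin_closed)+

lemma tensor_eval_linear:
  "m \<in> carrier M \<Longrightarrow> tensor_eval N m \<in> linear_maps R (tensor_product R (dual R M) N) N"
  unfolding tensor_eval_def
  by (rule tensor_lift_linear[OF _ _ _ tensor_eval_bilinear]; (assumption | rule M N lin_closed)+)

lemma tensor_eval_pure:
  assumes "m \<in> carrier M" "a \<in> carrier (dual R M)" "n \<in> carrier N"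
  shows "tensor_eval N m (pure_tensor R (dual R M) N a n) = a m \<odot>\<^bsub>N\<^esub> n"
  unfolding tensor_eval_def
  by (rule tensor_lift_pure[OF _ _ _ tensor_eval_bilinear]; (assumption | rule assms M N lin_closed)+)

text \<open>In the proof of coassociativity the evaluation point is itself a Sweedler leg, so
  linearity in that point is required too.\<close>

lemma tensor_eval_linear_left:
  "t \<in> carrier (tensor_product R (dual R M) N) \<Longrightarrow> (\<lambda>m. tensor_eval N m t) \<in> linear_maps R M N"
  unfolding tensor_eval_def
  by (assumption | rule tensor_lift_linear_body tensor_eval_bilinear linear_scale_left dual_linear M N lin_closed)+

end

text \<open>Evaluated at \<open>m\<close>, the right-hand side is \<open>a\<close> applied to the
  expansion of \<open>m\<close> in the dual basis, up to commutativity of \<open>R\<close>.\<close>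

lemma dual_basis_dual:
  assumes M: "module R M" and fdb: "finite_dual_basis R M n f e" and a: "a \<in> carrier (dual R M)"
  shows "a = (\<Oplus>\<^bsub>dual R M\<^esub>i\<in>{..<n}. a (e i) \<odot>\<^bsub>dual R M\<^esub> f i)"
proof -
  interpret M: module R M by (rule M)
  interpret D: module R "dual R M" by (rule dual_module[OF M])
  have f: "f i \<in> carrier (dual R M)" and e: "e i \<in> carrier M" if "i < n" for i
    using fdb that by (auto simp: finite_dual_basis_def)
  have fc: "f i m \<in> carrier R" if "i < n" "m \<in> carrier M" for i m
    by (rule dual_closed[OF f]) (use that in auto)
  have ac: "a m \<in> carrier R" if "m \<in> carrier M" for m
    by (rule dual_closed[OF a that])
  have cl: "a (e i) \<odot>\<^bsub>dual R M\<^esub> f i \<in> carrier (dual R M)" if "i < n" for i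
    using that e f ac by simp
  have reg: "module R (regular_module R)" by (rule module_regular[OF M.is_cring])
  show ?thesis
  proof (rule dual_eqI[OF a])
    show "(\<Oplus>\<^bsub>dual R M\<^esub>i\<in>{..<n}. a (e i) \<odot>\<^bsub>dual R M\<^esub> f i) \<in> carrier (dual R M)"
      using cl by (intro D.finsum_closed) auto
    fix m assume m: "m \<in> carrier M"
    have "(\<Oplus>\<^bsub>dual R M\<^esub>i\<in>{..<n}. a (e i) \<odot>\<^bsub>dual R M\<^esub> f i) m
        = (\<Oplus>\<^bsub>regular_module R\<^esub>i\<in>{..<n}. (a (e i) \<odot>\<^bsub>dual R M\<^esub> f i) m)"
      using linear_finsum[OF dual_apply_linear[OF m] D.module_axioms reg, of "{..<n}"] cl by auto
    also have "\<dots> = (\<Oplus>\<^bsub>regular_module R\<^esub>i\<in>{..<n}. a (f i m \<odot>\<^bsub>M\<^esub> e i))"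
    proof (rule abelian_monoid.finsum_cong'[OF _ refl])
      show "abelian_monoid (regular_module R)"
        using reg by (simp add: module_def abelian_group_def)
    qed (use m e f fc ac in \<open>auto simp: linear_smult[OF dual_linear[OF a]] M.R.m_comm\<close>)
    also have "\<dots> = a (\<Oplus>\<^bsub>M\<^esub>i\<in>{..<n}. f i m \<odot>\<^bsub>M\<^esub> e i)"
      by (rule linear_finsum[OF dual_linear[OF a] M reg, symmetric]) (use fc e m in auto)
    also have "(\<Oplus>\<^bsub>M\<^esub>i\<in>{..<n}. f i m \<odot>\<^bsub>M\<^esub> e i) = m"
      using fdb m by (simp add: finite_dual_basis_def)
    finally show "a m = (\<Oplus>\<^bsub>dual R M\<^esub>i\<in>{..<n}. a (e i) \<odot>\<^bsub>dual R M\<^esub> f i) m" by simp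
  qed
qed

text \<open>A tensor \<open>t\<close> over the dual is \<open>\<Sum>\<^sub>i f\<^sub>i \<otimes> t(e\<^sub>i)\<close>.\<close>

lemma tensor_eval_inject:
  assumes M: "module R M" and N: "module R N" and fdb: "finite_dual_basis R M n f e"
    and s: "s \<in> carrier (tensor_product R (dual R M) N)"
    and t: "t \<in> carrier (tensor_product R (dual R M) N)"
    and eq: "\<And>m. m \<in> carrier M \<Longrightarrow> tensor_eval N m s = tensor_eval N m t"
  shows "s = t"
proof -
  let ?D = "dual R M" and ?T = "tensor_product R (dual R M) N"
  interpret M: module R M by (rule M)
  interpret N: module R N by (rule N)
  have D: "module R ?D" by (rule dual_module[OF M])
  interpret D: module R ?D by (rule D)
  have T: "module R ?T" by (rule tensor_module[OF D N])
  interpret T: module R ?T by (rule T)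
  have f: "f i \<in> carrier ?D" and e: "e i \<in> carrier M" if "i < n" for i
    using fdb that by (auto simp: finite_dual_basis_def)
  have expand: "(\<Oplus>\<^bsub>?T\<^esub>i\<in>{..<n}. pure_tensor R ?D N (f i) (tensor_eval N (e i) t)) = t"
    if "t \<in> carrier ?T" for t
    using that
  proof (induction rule: tensor_induct[OF D N, consumes 1])
    \<comment> \<open>Contracting \<open>a \<otimes> x\<close> with \<open>e i\<close> gives
      \<open>a (e i)\<close> times \<open>x\<close>. This scalar moves across the tensor sign to
      \<open>f i\<close>, and \<open>dual_basis_dual\<close> sums the left factors to
      \<open>a\<close>.\<close>
    case (1 a x)
    have "(\<Oplus>\<^bsub>?T\<^esub>i\<in>{..<n}. pure_tensor R ?D N (f i) (tensor_eval N (e i) (pure_tensor R ?D N a x)))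
      = (\<Oplus>\<^bsub>?T\<^esub>i\<in>{..<n}. pure_tensor R ?D N (a (e i) \<odot>\<^bsub>?D\<^esub> f i) x)"
      using 1 f e dual_closed[OF 1(1)]
      by (intro T.finsum_cong') (auto simp: tensor_eval_pure[OF M N] pure_smult_left[OF D N]
          pure_smult_right[OF D N] intro!: pure_closed[OF D N])
    also have "\<dots> = pure_tensor R ?D N (\<Oplus>\<^bsub>?D\<^esub>i\<in>{..<n}. a (e i) \<odot>\<^bsub>?D\<^esub> f i) x"
      using linear_finsum[OF bilinear_left[OF bilinear_pure[OF D N] 1(2)] D T, of "{..<n}" "\<lambda>i. a (e i) \<odot>\<^bsub>?D\<^esub> f i"]
        f e dual_closed[OF 1(1)] by simp
    also have "\<dots> = pure_tensor R ?D N a x"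
      using dual_basis_dual[OF M fdb 1(1)] by simp
    finally show ?case .
  next
    case (2 s t)
    have cl: "pure_tensor R ?D N (f i) (tensor_eval N (e i) t) \<in> carrier ?T"
      if "i < n" "t \<in> carrier ?T" for i t
      using that f e by (intro pure_closed[OF D N] linear_closed[OF tensor_eval_linear[OF M N]]) auto
    have "(\<Oplus>\<^bsub>?T\<^esub>i\<in>{..<n}. pure_tensor R ?D N (f i) (tensor_eval N (e i) (s \<oplus>\<^bsub>?T\<^esub> t)))
      = (\<Oplus>\<^bsub>?T\<^esub>i\<in>{..<n}. pure_tensor R ?D N (f i) (tensor_eval N (e i) s)
          \<oplus>\<^bsub>?T\<^esub> pure_tensor R ?D N (f i) (tensor_eval N (e i) t))"
    proof (intro T.finsum_cong' refl)
      fix i assume "i \<in> {..<n}"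
      then have i: "i < n" by simp
      show "pure_tensor R ?D N (f i) (tensor_eval N (e i) (s \<oplus>\<^bsub>?T\<^esub> t)) = pure_tensor R ?D N (f i) (tensor_eval N (e i) s)
          \<oplus>\<^bsub>?T\<^esub> pure_tensor R ?D N (f i) (tensor_eval N (e i) t)"
        unfolding linear_add[OF tensor_eval_linear[OF M N e[OF i]] 2(1,2)]
        by (rule pure_add_right[OF D N f[OF i]])
          (use 2 in \<open>auto intro: linear_closed[OF tensor_eval_linear[OF M N e[OF i]]]\<close>)
    qed (use 2 cl in auto)
    also have "\<dots> = s \<oplus>\<^bsub>?T\<^esub> t"
      using 2 cl by (subst T.finsum_addf) auto
    finally show ?case .
  qed
  have "s = (\<Oplus>\<^bsub>?T\<^esub>i\<in>{..<n}. pure_tensor R ?D N (f i) (tensor_eval N (e i) s))"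
    by (rule expand[OF s, symmetric])
  also have "\<dots> = (\<Oplus>\<^bsub>?T\<^esub>i\<in>{..<n}. pure_tensor R ?D N (f i) (tensor_eval N (e i) t))"
    using e f eq t linear_closed[OF tensor_eval_linear[OF M N]]
    by (intro T.finsum_cong') (auto intro!: pure_closed[OF D N])
  also have "\<dots> = t" by (rule expand[OF t])
  finally show ?thesis .
qed

section \<open>Finite dual bases and finitely generated projective modules\<close>

lemma free_module_simps:
  "c \<in> carrier (free_module R I) \<longleftrightarrow> c \<in> I \<rightarrow>\<^sub>E carrier R \<and> finite {i \<in> I. c i \<noteq> \<zero>\<^bsub>R\<^esub>}"
  "\<zero>\<^bsub>free_module R I\<^esub> = (\<lambda>i\<in>I. \<zero>\<^bsub>R\<^esub>)"
  "c \<oplus>\<^bsub>free_module R I\<^esub> d = (\<lambda>i\<in>I. c i \<oplus>\<^bsub>R\<^esub> d i)"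
  "r \<odot>\<^bsub>free_module R I\<^esub> c = (\<lambda>i\<in>I. r \<otimes>\<^bsub>R\<^esub> c i)"
  by (auto simp: free_module_def)

lemma free_module_module:
  assumes "cring R"
  shows "module R (free_module R I)"
proof -
  interpret cring R by fact
  have cl: "c i \<in> carrier R" if "c \<in> carrier (free_module R I)" "i \<in> I" for c i
    using that by (auto simp: free_module_simps)
  have ext: "c = d" if "c \<in> carrier (free_module R I)" "d \<in> carrier (free_module R I)"
    "\<And>i. i \<in> I \<Longrightarrow> c i = d i" for c d
    using that by (auto simp: free_module_simps intro: PiE_ext)
  have add: "c \<oplus>\<^bsub>free_module R I\<^esub> d \<in> carrier (free_module R I)"
    if "c \<in> carrier (free_module R I)" "d \<in> carrier (free_module R I)" for c d
  proof -
    have "{i \<in> I. c i \<oplus>\<^bsub>R\<^esub> d i \<noteq> \<zero>\<^bsub>R\<^esub>} \<subseteq> {i \<in> I. c i \<noteq> \<zero>\<^bsub>R\<^esub>} \<union> {i \<in> I. d i \<noteq> \<zero>\<^bsub>R\<^esub>}"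
      by auto
    then have "finite {i \<in> I. c i \<oplus>\<^bsub>R\<^esub> d i \<noteq> \<zero>\<^bsub>R\<^esub>}"
      by (rule finite_subset) (use that in \<open>simp add: free_module_simps\<close>)
    then show ?thesis using that by (auto simp: free_module_simps cong: conj_cong)
  qed
  have smult: "r \<odot>\<^bsub>free_module R I\<^esub> c \<in> carrier (free_module R I)"
    if "r \<in> carrier R" "c \<in> carrier (free_module R I)" for r c
  proof -
    have "{i \<in> I. r \<otimes>\<^bsub>R\<^esub> c i \<noteq> \<zero>\<^bsub>R\<^esub>} \<subseteq> {i \<in> I. c i \<noteq> \<zero>\<^bsub>R\<^esub>}"
      using that by auto
    then have "finite {i \<in> I. r \<otimes>\<^bsub>R\<^esub> c i \<noteq> \<zero>\<^bsub>R\<^esub>}"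
      by (rule finite_subset) (use that in \<open>simp add: free_module_simps\<close>)
    then show ?thesis using that by (auto simp: free_module_simps cong: conj_cong)
  qed
  have zero: "\<zero>\<^bsub>free_module R I\<^esub> \<in> carrier (free_module R I)"
    by (auto simp: free_module_simps cong: conj_cong)
  show ?thesis
  proof (rule moduleI[OF is_cring])
    show "abelian_group (free_module R I)"
    proof (rule abelian_groupI[OF add zero])
      show "\<exists>d\<in>carrier (free_module R I). d \<oplus>\<^bsub>free_module R I\<^esub> c = \<zero>\<^bsub>free_module R I\<^esub>"
        if c: "c \<in> carrier (free_module R I)" for c
      proof
        have *: "\<ominus>\<^bsub>R\<^esub> \<one>\<^bsub>R\<^esub> \<in> carrier R" by simp
        show "(\<ominus>\<^bsub>R\<^esub> \<one>\<^bsub>R\<^esub>) \<odot>\<^bsub>free_module R I\<^esub> c \<in> carrier (free_module R I)"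
          by (rule smult[OF * c])
        show "(\<ominus>\<^bsub>R\<^esub> \<one>\<^bsub>R\<^esub>) \<odot>\<^bsub>free_module R I\<^esub> c \<oplus>\<^bsub>free_module R I\<^esub> c = \<zero>\<^bsub>free_module R I\<^esub>"
          by (rule ext[OF add[OF smult[OF * c] c] zero])
            (use cl[OF c] in \<open>simp add: free_module_simps l_minus l_neg\<close>)
      qed
    qed (assumption | rule ext add zero | simp add: free_module_simps(2-) cl a_ac)+
  qed (assumption | rule ext add smult a_closed m_closed one_closed
      | simp add: free_module_simps(2-) cl l_distr r_distr m_assoc)+
qed

lemma free_module_coord_linear:
  "i \<in> I \<Longrightarrow> (\<lambda>c. c i) \<in> linear_maps R (free_module R I) (regular_module R)"
  by (rule linear_mapsI) (auto simp: free_module_simps)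

lemma finsum_regular: "finsum (regular_module R) = finsum R"
  by (intro ext) (simp add: finsum_def finprod_def)

text \<open>The dual basis lemma. A splitting of the projection from a free module gives coordinate
  functionals \<open>\<sigma> m i\<close> and vectors \<open>\<pi> (\<delta> i)\<close> that
  reproduce every \<open>m\<close>; finite generation cuts the index set down to a finite
  one.\<close>

lemma finite_dual_basis_exists:
  fixes M :: "('k, 'm, 'r) module_scheme"
  assumes "fg_projective_module R M"
  obtains n f e where "finite_dual_basis R M n f e"
proof -
  have M: "module R M" using assms by (simp add: fg_projective_module_def)
  interpret M: module R M by (rule M)
  obtain G where G: "G \<subseteq> carrier M" "finite G"
    and gen: "\<And>m. m \<in> carrier M \<Longrightarrow> \<exists>c\<in>G \<rightarrow> carrier R. m = (\<Oplus>\<^bsub>M\<^esub>g\<in>G. c g \<odot>\<^bsub>M\<^esub> g)"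
    using assms unfolding fg_projective_module_def finitely_generated_def by blast
  obtain I :: "'m set" and \<sigma> \<pi> where \<sigma>: "\<sigma> \<in> linear_maps R M (free_module R I)"
    and \<pi>: "\<pi> \<in> linear_maps R (free_module R I) M" and retract: "\<And>m. m \<in> carrier M \<Longrightarrow> \<pi> (\<sigma> m) = m"
    using assms unfolding fg_projective_module_def projective_def by blast
  let ?F = "free_module R I"
  have F: "module R ?F" by (rule free_module_module[OF M.is_cring])
  interpret F: module R ?F by (rule F)
  have reg: "module R (regular_module R)" by (rule module_regular[OF M.is_cring])
  \<comment> \<open>The union of the supports of the generators. Coordinates are linear, so all
    coordinates of every \<open>m\<close> outside \<open>J\<close> vanish, although \<open>I\<close>
    itself may be infinite.\<close>
  define J where "J = (\<Union>g\<in>G. {i \<in> I. \<sigma> g i \<noteq> \<zero>\<^bsub>R\<^esub>})"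
  have J: "finite J" "J \<subseteq> I"
    using G linear_closed[OF \<sigma>] by (auto simp: J_def free_module_simps(1))
  have coord: "(\<lambda>m. \<sigma> m i) \<in> linear_maps R M (regular_module R)" if "i \<in> I" for i
    by (rule linear_comp[OF free_module_coord_linear[OF that] \<sigma>])
  have coord_closed: "\<sigma> m i \<in> carrier R" if "i \<in> I" "m \<in> carrier M" for i m
    using linear_closed[OF coord] that by simp
  have support: "\<sigma> m i = \<zero>\<^bsub>R\<^esub>" if i: "i \<in> I - J" and m: "m \<in> carrier M" for i m
  proof -
    obtain c where c: "c \<in> G \<rightarrow> carrier R" "m = (\<Oplus>\<^bsub>M\<^esub>g\<in>G. c g \<odot>\<^bsub>M\<^esub> g)"
      using gen[OF m] by blast
    have "\<sigma> m i = (\<Oplus>\<^bsub>R\<^esub>g\<in>G. \<sigma> (c g \<odot>\<^bsub>M\<^esub> g) i)"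
      unfolding c(2) using c(1) G i linear_finsum[OF coord M reg G(2), of i "\<lambda>g. c g \<odot>\<^bsub>M\<^esub> g"]
      by (auto simp: finsum_regular)
    also have "\<dots> = (\<Oplus>\<^bsub>R\<^esub>g\<in>G. \<zero>\<^bsub>R\<^esub>)"
      using c(1) G i by (intro M.R.finsum_cong') (auto simp: linear_smult[OF coord] J_def Pi_iff subset_iff)
    finally show ?thesis by simp
  qed
  define \<delta> where "\<delta> i = (\<lambda>j\<in>I. if j = i then \<one>\<^bsub>R\<^esub> else \<zero>\<^bsub>R\<^esub>)" for i
  have \<delta>: "\<delta> i \<in> carrier ?F" for i
    by (auto simp: \<delta>_def free_module_simps(1) cong: conj_cong)
  have expand: "\<sigma> m = (\<Oplus>\<^bsub>?F\<^esub>i\<in>J. \<sigma> m i \<odot>\<^bsub>?F\<^esub> \<delta> i)" if m: "m \<in> carrier M" for m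
  proof -
    have cl: "\<sigma> m i \<odot>\<^bsub>?F\<^esub> \<delta> i \<in> carrier ?F" if "i \<in> J" for i
      using coord_closed[of i m] that J m \<delta> by auto
    have sum: "(\<Oplus>\<^bsub>?F\<^esub>i\<in>J. \<sigma> m i \<odot>\<^bsub>?F\<^esub> \<delta> i) \<in> carrier ?F"
      using cl by (intro F.finsum_closed) auto
    show ?thesis
    proof (rule PiE_ext)
      show "\<sigma> m \<in> I \<rightarrow>\<^sub>E carrier R" "(\<Oplus>\<^bsub>?F\<^esub>i\<in>J. \<sigma> m i \<odot>\<^bsub>?F\<^esub> \<delta> i) \<in> I \<rightarrow>\<^sub>E carrier R"
        using linear_closed[OF \<sigma> m] sum by (simp_all add: free_module_simps(1))
      fix j assume j: "j \<in> I"
      have "(\<Oplus>\<^bsub>?F\<^esub>i\<in>J. \<sigma> m i \<odot>\<^bsub>?F\<^esub> \<delta> i) j = (\<Oplus>\<^bsub>R\<^esub>i\<in>J. (\<sigma> m i \<odot>\<^bsub>?F\<^esub> \<delta> i) j)"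
        using linear_finsum[OF free_module_coord_linear[OF j] F reg J(1)] cl by (simp add: finsum_regular)
      also have "\<dots> = (\<Oplus>\<^bsub>R\<^esub>i\<in>J. if j = i then \<sigma> m i else \<zero>\<^bsub>R\<^esub>)"
        using j J coord_closed m by (intro M.R.finsum_cong') (auto simp: free_module_simps(4) \<delta>_def)
      also have "\<dots> = \<sigma> m j"
      proof (cases "j \<in> J")
        case True
        then show ?thesis
          using M.R.finsum_singleton[OF True J(1), of "\<sigma> m"] J coord_closed m by auto
      next
        case False
        then have "(\<Oplus>\<^bsub>R\<^esub>i\<in>J. if j = i then \<sigma> m i else \<zero>\<^bsub>R\<^esub>) = (\<Oplus>\<^bsub>R\<^esub>i\<in>J. \<zero>\<^bsub>R\<^esub>)"
          by (intro M.R.finsum_cong') auto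
        then show ?thesis using False j support m by simp
      qed
      finally show "\<sigma> m j = (\<Oplus>\<^bsub>?F\<^esub>i\<in>J. \<sigma> m i \<odot>\<^bsub>?F\<^esub> \<delta> i) j" by simp
    qed
  qed
  have recover: "m = (\<Oplus>\<^bsub>M\<^esub>i\<in>J. \<sigma> m i \<odot>\<^bsub>M\<^esub> \<pi> (\<delta> i))" if m: "m \<in> carrier M" for m
  proof -
    have "m = \<pi> (\<sigma> m)" using retract m by simp
    also have "\<dots> = \<pi> (\<Oplus>\<^bsub>?F\<^esub>i\<in>J. \<sigma> m i \<odot>\<^bsub>?F\<^esub> \<delta> i)"
      using expand[OF m] by simp
    also have "\<dots> = (\<Oplus>\<^bsub>M\<^esub>i\<in>J. \<pi> (\<sigma> m i \<odot>\<^bsub>?F\<^esub> \<delta> i))"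
      using J coord_closed m \<delta> by (intro linear_finsum[OF \<pi> F M]) auto
    also have "\<dots> = (\<Oplus>\<^bsub>M\<^esub>i\<in>J. \<sigma> m i \<odot>\<^bsub>M\<^esub> \<pi> (\<delta> i))"
      using J coord_closed m \<delta> linear_closed[OF \<pi> \<delta>]
      by (intro M.finsum_cong') (auto intro!: linear_smult[OF \<pi>])
    finally show ?thesis .
  qed
  \<comment> \<open>\<open>finite_dual_basis\<close> is indexed by the numbers below
    \<open>n\<close>, so \<open>J\<close> is enumerated.\<close>
  obtain h where h: "bij_betw h {..<card J} J"
    using ex_bij_betw_nat_finite[OF J(1)] by (auto simp: atLeast0LessThan)
  have hJ: "h i \<in> J" if "i < card J" for i
    using h that by (auto simp: bij_betw_def)
  have "finite_dual_basis R M (card J) (\<lambda>i. \<lambda>m\<in>carrier M. \<sigma> m (h i)) (\<lambda>i. \<pi> (\<delta> (h i)))"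
    unfolding finite_dual_basis_def
  proof (intro conjI ballI)
    show "(\<lambda>i. \<lambda>m\<in>carrier M. \<sigma> m (h i)) \<in> {..<card J} \<rightarrow> carrier (dual R M)"
      using hJ J by (auto intro!: restrict_dual[OF M] coord)
    show "(\<lambda>i. \<pi> (\<delta> (h i))) \<in> {..<card J} \<rightarrow> carrier M"
      using linear_closed[OF \<pi> \<delta>] by auto
    fix m assume m: "m \<in> carrier M"
    have "(\<Oplus>\<^bsub>M\<^esub>i\<in>h ` {..<card J}. \<sigma> m i \<odot>\<^bsub>M\<^esub> \<pi> (\<delta> i))
        = (\<Oplus>\<^bsub>M\<^esub>i\<in>{..<card J}. \<sigma> m (h i) \<odot>\<^bsub>M\<^esub> \<pi> (\<delta> (h i)))"
      by (rule M.add.finprod_reindex)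
        (use h hJ J m coord_closed linear_closed[OF \<pi> \<delta>] in \<open>auto simp: bij_betw_def\<close>)
    then show "m = (\<Oplus>\<^bsub>M\<^esub>i\<in>{..<card J}. (\<lambda>m\<in>carrier M. \<sigma> m (h i)) m \<odot>\<^bsub>M\<^esub> \<pi> (\<delta> (h i)))"
      using recover[OF m] h m by (simp add: bij_betw_def)
  qed
  then show thesis by (rule that)
qed

text \<open>The converse direction, applied later to the dual. The definition of
  \<open>projective\<close> wants the basis of the free module inside the type of \<open>M\<close>,
  so the free module is taken on the set of vectors \<open>e i\<close> and not on the
  indices.\<close>

lemma finite_dual_basis_fg_projective:
  fixes M :: "('k, 'm, 'r) module_scheme"
  assumes M: "module R M" and fdb: "finite_dual_basis R M n f e"
  shows "fg_projective_module R M"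
proof -
  interpret M: module R M by (rule M)
  have reg: "module R (regular_module R)" by (rule module_regular[OF M.is_cring])
  have f: "f i \<in> carrier (dual R M)" and e: "e i \<in> carrier M" if "i < n" for i
    using fdb that by (auto simp: finite_dual_basis_def)
  have fc: "f i m \<in> carrier R" if "i < n" "m \<in> carrier M" for i m
    by (rule dual_closed[OF f]) (use that in auto)
  define G where "G = e ` {..<n}"
  have G: "finite G" "G \<subseteq> carrier M" using e by (auto simp: G_def)
  \<comment> \<open>The function \<open>e\<close> may take the same value several times, so the
    coordinate at \<open>g\<close> collects all functionals whose vector is
    \<open>g\<close>.\<close>
  define c where "c m g = (\<Oplus>\<^bsub>R\<^esub>i\<in>{..<n}. if e i = g then f i m else \<zero>\<^bsub>R\<^esub>)" for m g
  have cc: "c m g \<in> carrier R" if "m \<in> carrier M" for m g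
    unfolding c_def using fc that by (intro M.R.finsum_closed) auto
  have clin: "(\<lambda>m. c m g) \<in> linear_maps R M (regular_module R)" for g
  proof (rule linear_mapsI; simp add: cc)
    show "c (m \<oplus>\<^bsub>M\<^esub> m') g = c m g \<oplus>\<^bsub>R\<^esub> c m' g" if "m \<in> carrier M" "m' \<in> carrier M" for m m'
      unfolding c_def using that fc
      by (subst M.R.finsum_addf[symmetric], force, force, intro M.R.finsum_cong' refl)
        (auto simp: linear_add[OF dual_linear[OF f]])
    show "c (r \<odot>\<^bsub>M\<^esub> m) g = r \<otimes>\<^bsub>R\<^esub> c m g" if "r \<in> carrier R" "m \<in> carrier M" for r m
      unfolding c_def using that fc
      by (subst M.R.finsum_rdistr) (auto intro!: M.R.finsum_cong' simp: linear_smult[OF dual_linear[OF f]])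
  qed
  \<comment> \<open>Regrouping a sum along the fibres of \<open>e\<close>. The induction runs over
    subsets of the index set while \<open>G\<close> stays fixed; a new index \<open>j\<close>
    changes only the summand at \<open>g = e j\<close>.\<close>
  have collect: "(\<Oplus>\<^bsub>M\<^esub>g\<in>G. (\<Oplus>\<^bsub>R\<^esub>i\<in>I. if e i = g then f i m else \<zero>\<^bsub>R\<^esub>) \<odot>\<^bsub>M\<^esub> g) = (\<Oplus>\<^bsub>M\<^esub>i\<in>I. f i m \<odot>\<^bsub>M\<^esub> e i)"
    if m: "m \<in> carrier M" and "finite I" "I \<subseteq> {..<n}" for m I
    using that(2,3)
  proof (induction I)
    case empty
    have "(\<Oplus>\<^bsub>M\<^esub>g\<in>G. \<zero>\<^bsub>R\<^esub> \<odot>\<^bsub>M\<^esub> g) = (\<Oplus>\<^bsub>M\<^esub>g\<in>G. \<zero>\<^bsub>M\<^esub>)"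
      using G by (intro M.finsum_cong') auto
    then show ?case by simp
  next
    case (insert j I)
    let ?s = "\<lambda>g. \<Oplus>\<^bsub>R\<^esub>i\<in>I. if e i = g then f i m else \<zero>\<^bsub>R\<^esub>"
    have j: "j < n" and I: "\<And>i. i \<in> I \<Longrightarrow> i < n" using insert by auto
    have sc: "?s g \<in> carrier R" for g
      using I fc m by (intro M.R.finsum_closed) auto
    have "(\<Oplus>\<^bsub>M\<^esub>g\<in>G. (\<Oplus>\<^bsub>R\<^esub>i\<in>insert j I. if e i = g then f i m else \<zero>\<^bsub>R\<^esub>) \<odot>\<^bsub>M\<^esub> g)
      = (\<Oplus>\<^bsub>M\<^esub>g\<in>G. (if e j = g then f j m \<odot>\<^bsub>M\<^esub> g else \<zero>\<^bsub>M\<^esub>) \<oplus>\<^bsub>M\<^esub> ?s g \<odot>\<^bsub>M\<^esub> g)"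
    proof (rule M.finsum_cong'[OF refl])
      fix g assume g: "g \<in> G"
      then show "(\<Oplus>\<^bsub>R\<^esub>i\<in>insert j I. if e i = g then f i m else \<zero>\<^bsub>R\<^esub>) \<odot>\<^bsub>M\<^esub> g
          = (if e j = g then f j m \<odot>\<^bsub>M\<^esub> g else \<zero>\<^bsub>M\<^esub>) \<oplus>\<^bsub>M\<^esub> ?s g \<odot>\<^bsub>M\<^esub> g"
        using insert(1,2) j I fc m G sc by (subst M.R.finsum_insert) (auto simp: M.smult_l_distr)
    qed (use G sc fc j m in auto)
    also have "\<dots> = (\<Oplus>\<^bsub>M\<^esub>g\<in>G. if e j = g then f j m \<odot>\<^bsub>M\<^esub> g else \<zero>\<^bsub>M\<^esub>) \<oplus>\<^bsub>M\<^esub> (\<Oplus>\<^bsub>M\<^esub>g\<in>G. ?s g \<odot>\<^bsub>M\<^esub> g)"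
      using G sc fc j m by (intro M.finsum_addf) auto
    also have "(\<Oplus>\<^bsub>M\<^esub>g\<in>G. if e j = g then f j m \<odot>\<^bsub>M\<^esub> g else \<zero>\<^bsub>M\<^esub>) = f j m \<odot>\<^bsub>M\<^esub> e j"
      using G fc j m by (intro M.finsum_singleton) (auto simp: G_def)
    also have "(\<Oplus>\<^bsub>M\<^esub>g\<in>G. ?s g \<odot>\<^bsub>M\<^esub> g) = (\<Oplus>\<^bsub>M\<^esub>i\<in>I. f i m \<odot>\<^bsub>M\<^esub> e i)"
      using insert by simp
    finally show ?case
      using insert(1,2) I e fc m j by (subst M.finsum_insert) auto
  qed
  have expand: "m = (\<Oplus>\<^bsub>M\<^esub>g\<in>G. c m g \<odot>\<^bsub>M\<^esub> g)" if "m \<in> carrier M" for m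
    using collect[OF that finite_lessThan subset_refl] fdb that
    by (simp add: finite_dual_basis_def c_def)
  have "finitely_generated R M"
    unfolding finitely_generated_def
  proof (intro exI conjI ballI)
    show "\<exists>c\<in>G \<rightarrow> carrier R. m = (\<Oplus>\<^bsub>M\<^esub>g\<in>G. c g \<odot>\<^bsub>M\<^esub> g)" if "m \<in> carrier M" for m
      using expand[OF that] cc[OF that] by (intro bexI[of _ "c m"]) auto
  qed (use G in auto)
  moreover have "projective R M"
    unfolding projective_def
  proof (intro exI bexI ballI)
    show "(\<lambda>m. \<lambda>g\<in>G. c m g) \<in> linear_maps R M (free_module R G)"
      using G cc by (intro linear_mapsI)
        (auto simp: free_module_simps linear_add[OF clin] linear_smult[OF clin])
    show "(\<lambda>d. \<Oplus>\<^bsub>M\<^esub>g\<in>G. d g \<odot>\<^bsub>M\<^esub> g) \<in> linear_maps R (free_module R G) M"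
    proof (rule linear_mapsI)
      have dc: "d g \<odot>\<^bsub>M\<^esub> g \<in> carrier M" "d g \<in> carrier R" "g \<in> carrier M"
        if "d \<in> carrier (free_module R G)" "g \<in> G" for d g
        using that G by (auto simp: free_module_simps)
      fix d assume d: "d \<in> carrier (free_module R G)"
      show "(\<Oplus>\<^bsub>M\<^esub>g\<in>G. d g \<odot>\<^bsub>M\<^esub> g) \<in> carrier M"
        using dc d by (intro M.finsum_closed) auto
      show "(\<Oplus>\<^bsub>M\<^esub>g\<in>G. (d \<oplus>\<^bsub>free_module R G\<^esub> d') g \<odot>\<^bsub>M\<^esub> g)
          = (\<Oplus>\<^bsub>M\<^esub>g\<in>G. d g \<odot>\<^bsub>M\<^esub> g) \<oplus>\<^bsub>M\<^esub> (\<Oplus>\<^bsub>M\<^esub>g\<in>G. d' g \<odot>\<^bsub>M\<^esub> g)"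
        if d': "d' \<in> carrier (free_module R G)" for d'
        using dc[OF d] dc[OF d']
        by (subst M.finsum_addf[symmetric], force, force, intro M.finsum_cong' refl)
          (auto simp: free_module_simps(3) M.smult_l_distr)
      show "(\<Oplus>\<^bsub>M\<^esub>g\<in>G. (r \<odot>\<^bsub>free_module R G\<^esub> d) g \<odot>\<^bsub>M\<^esub> g) = r \<odot>\<^bsub>M\<^esub> (\<Oplus>\<^bsub>M\<^esub>g\<in>G. d g \<odot>\<^bsub>M\<^esub> g)"
        if r: "r \<in> carrier R" for r
        using dc[OF d] r G(1)
        by (subst M.finsum_smult_ldistr)
          (auto intro!: M.finsum_cong' simp: free_module_simps(4) M.smult_assoc1)
    qed
    show "(\<Oplus>\<^bsub>M\<^esub>g\<in>G. (\<lambda>g\<in>G. c m g) g \<odot>\<^bsub>M\<^esub> g) = m" if "m \<in> carrier M" for m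
    proof -
      have "(\<Oplus>\<^bsub>M\<^esub>g\<in>G. (\<lambda>g\<in>G. c m g) g \<odot>\<^bsub>M\<^esub> g) = (\<Oplus>\<^bsub>M\<^esub>g\<in>G. c m g \<odot>\<^bsub>M\<^esub> g)"
        using G cc[OF that] by (intro M.finsum_cong') auto
      then show ?thesis using expand[OF that] by simp
    qed
  qed
  ultimately show ?thesis using M by (simp add: fg_projective_module_def)
qed

text \<open>The roles are exchanged: \<open>e i\<close> acts on the dual by evaluation, and
  \<open>dual_basis_dual\<close> is the required expansion. Its purpose is to show that the dual is
  again finitely generated and projective.\<close>

lemma finite_dual_basis_dual:
  assumes M: "module R M" and fdb: "finite_dual_basis R M n f e"
  shows "finite_dual_basis R (dual R M) n (\<lambda>i. \<lambda>a\<in>carrier (dual R M). a (e i)) f"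
  unfolding finite_dual_basis_def
proof (intro conjI ballI)
  interpret D: module R "dual R M" by (rule dual_module[OF M])
  have f: "f i \<in> carrier (dual R M)" and e: "e i \<in> carrier M" if "i < n" for i
    using fdb that by (auto simp: finite_dual_basis_def)
  show "(\<lambda>i. \<lambda>a\<in>carrier (dual R M). a (e i)) \<in> {..<n} \<rightarrow> carrier (dual R (dual R M))"
    using e by (auto intro!: restrict_dual dual_module[OF M] dual_apply_linear)
  show "f \<in> {..<n} \<rightarrow> carrier (dual R M)" using f by auto
  show "a = (\<Oplus>\<^bsub>dual R M\<^esub>i\<in>{..<n}. (\<lambda>a\<in>carrier (dual R M). a (e i)) a \<odot>\<^bsub>dual R M\<^esub> f i)"
    if "a \<in> carrier (dual R M)" for a
    using dual_basis_dual[OF M fdb that] that by simp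
qed

section \<open>Sweedler calculus\<close>

definition sweedler :: "('p, 'q) ring_scheme \<Rightarrow> ('k, 'c) coalgebra \<Rightarrow> ('c \<Rightarrow> 'c \<Rightarrow> 'p) \<Rightarrow> 'c \<Rightarrow> 'p" where
  "sweedler P C \<beta> h = tensor_lift P \<beta> (comult C h)"

context coalgebra
begin

lemma reg_module: "module R (regular_module R)"
  by (rule module_regular[OF R.is_cring])

lemma comult_closed: "h \<in> carrier C \<Longrightarrow> comult C h \<in> carrier (tensor_product R C C)"
  by (rule linear_closed[OF comult_linear])

lemma counit_closed: "h \<in> carrier C \<Longrightarrow> counit C h \<in> carrier R"
  using linear_closed[OF counit_linear] by fastforce

lemma sweedler_linear_arg:
  assumes "f \<in> linear_maps R L C" "\<beta> \<in> bilinear_maps R C C P" "module R P"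
  shows "(\<lambda>x. sweedler P C \<beta> (f x)) \<in> linear_maps R L P"
  unfolding sweedler_def
  by (rule tensor_lift_linear_arg[OF linear_comp[OF comult_linear assms(1)] assms(2)
        module_axioms module_axioms assms(3)])

lemma sweedler_closed:
  assumes "h \<in> carrier C" "\<beta> \<in> bilinear_maps R C C P" "module R P"
  shows "sweedler P C \<beta> h \<in> carrier P"
  by (rule linear_closed[OF sweedler_linear_arg[OF linear_id assms(2,3)] assms(1)])

lemma sweedler_linear_body:
  assumes "h \<in> carrier C"
    and "\<And>m n. \<lbrakk>m \<in> carrier C; n \<in> carrier C\<rbrakk> \<Longrightarrow> (\<lambda>x. \<beta> x m n) \<in> linear_maps R L P"
    and "\<And>x. x \<in> carrier L \<Longrightarrow> \<beta> x \<in> bilinear_maps R C C P"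
    and "module R P" "module R L"
  shows "(\<lambda>x. sweedler P C (\<beta> x) h) \<in> linear_maps R L P"
  unfolding sweedler_def
  by (rule tensor_lift_linear_body[OF comult_closed[OF assms(1)]]) (use assms module_axioms in auto)

lemma sweedler_cong:
  assumes "\<beta> \<in> bilinear_maps R C C P" "h \<in> carrier C" "module R P"
    "\<And>m n. \<lbrakk>m \<in> carrier C; n \<in> carrier C\<rbrakk> \<Longrightarrow> \<beta> m n = \<beta>' m n"
  shows "sweedler P C \<beta> h = sweedler P C \<beta>' h"
  unfolding sweedler_def
  by (rule tensor_lift_cong[OF assms(1) comult_closed[OF assms(2)] module_axioms module_axioms assms(3,4)])

lemma linear_sweedler:
  assumes "g \<in> linear_maps R P Q" "\<beta> \<in> bilinear_maps R C C P" "h \<in> carrier C" "module R P" "module R Q"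
  shows "g (sweedler P C \<beta> h) = sweedler Q C (\<lambda>u v. g (\<beta> u v)) h"
  unfolding sweedler_def
  by (rule linear_tensor_lift[OF assms(1,2) comult_closed[OF assms(3)] module_axioms module_axioms assms(4,5)])

lemma sweedler_pure_tensor: "h \<in> carrier C \<Longrightarrow> sweedler (tensor_product R C C) C (pure_tensor R C C) h = comult C h"
  unfolding sweedler_def
  by (rule tensor_lift_pure_tensor[OF module_axioms module_axioms comult_closed])

text \<open>The counit axiom transported along a linear map \<open>g\<close>; in this form it
  removes one leg from a Sweedler sum without isolating \<open>h\<close> first.\<close>

lemma sweedler_counit_left:
  assumes g: "g \<in> linear_maps R C P" and h: "h \<in> carrier C" and P: "module R P"
  shows "sweedler P C (\<lambda>u v. counit C u \<odot>\<^bsub>P\<^esub> g v) h = g h"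
proof -
  have bil: "(\<lambda>u v. counit C u \<odot>\<^bsub>C\<^esub> v) \<in> bilinear_maps R C C C"
    by (assumption | rule lin_intros module_axioms counit_linear counit_closed)+
  have "g h = g (sweedler C C (\<lambda>u v. counit C u \<odot>\<^bsub>C\<^esub> v) h)"
    using counit_left[OF h, unfolded tensor_unit_left_def]
      tensor_lift_tensor_map[OF counit_linear linear_id bilinear_smult_left[OF module_axioms] comult_closed[OF h]
        module_axioms module_axioms reg_module module_axioms module_axioms]
    by (simp add: sweedler_def id_def)
  also have "\<dots> = sweedler P C (\<lambda>u v. g (counit C u \<odot>\<^bsub>C\<^esub> v)) h"
    by (rule linear_sweedler[OF g bil h module_axioms P])
  also have "\<dots> = sweedler P C (\<lambda>u v. counit C u \<odot>\<^bsub>P\<^esub> g v) h"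
    by (rule sweedler_cong[OF bilinear_comp[OF bil g] h P]) (rule linear_smult[OF g counit_closed])
  finally show ?thesis by simp
qed

lemma sweedler_counit_right:
  assumes g: "g \<in> linear_maps R C P" and h: "h \<in> carrier C" and P: "module R P"
  shows "sweedler P C (\<lambda>u v. counit C v \<odot>\<^bsub>P\<^esub> g u) h = g h"
proof -
  have bil: "(\<lambda>u v. counit C v \<odot>\<^bsub>C\<^esub> u) \<in> bilinear_maps R C C C"
    by (assumption | rule lin_intros module_axioms counit_linear counit_closed)+
  have "g h = g (sweedler C C (\<lambda>u v. counit C v \<odot>\<^bsub>C\<^esub> u) h)"
    using counit_right[OF h, unfolded tensor_unit_right_def]
      tensor_lift_tensor_map[OF linear_id counit_linear bilinear_smult_right[OF module_axioms] comult_closed[OF h]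
        module_axioms module_axioms module_axioms reg_module module_axioms]
    by (simp add: sweedler_def id_def)
  also have "\<dots> = sweedler P C (\<lambda>u v. g (counit C v \<odot>\<^bsub>C\<^esub> u)) h"
    by (rule linear_sweedler[OF g bil h module_axioms P])
  also have "\<dots> = sweedler P C (\<lambda>u v. counit C v \<odot>\<^bsub>P\<^esub> g u) h"
    by (rule sweedler_cong[OF bilinear_comp[OF bil g] h P]) (rule linear_smult[OF g counit_closed])
  finally show ?thesis by simp
qed

text \<open>A map linear in each of three arguments factors through
  \<open>C \<otimes> (C \<otimes> C)\<close>. Applying the resulting linear map
  \<open>\<Gamma>\<close> to both sides of the coassociativity axiom yields the two iterated
  sums.\<close>

lemma sweedler_coassoc:
  assumes l1: "\<And>q r. \<lbrakk>q \<in> carrier C; r \<in> carrier C\<rbrakk> \<Longrightarrow> (\<lambda>p. \<gamma> p q r) \<in> linear_maps R C P"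
    and l2: "\<And>p r. \<lbrakk>p \<in> carrier C; r \<in> carrier C\<rbrakk> \<Longrightarrow> (\<lambda>q. \<gamma> p q r) \<in> linear_maps R C P"
    and l3: "\<And>p q. \<lbrakk>p \<in> carrier C; q \<in> carrier C\<rbrakk> \<Longrightarrow> \<gamma> p q \<in> linear_maps R C P"
    and h: "h \<in> carrier C" and P: "module R P"
  shows "sweedler P C (\<lambda>u r. sweedler P C (\<lambda>p q. \<gamma> p q r) u) h
    = sweedler P C (\<lambda>p v. sweedler P C (\<gamma> p) v) h"
proof -
  let ?T = "tensor_product R C C" and ?T3 = "tensor_product R C (tensor_product R C C)"
  note C = module_axioms
  have T: "module R ?T" "module R ?T3" by (rule lin_closed C)+
  have b1: "\<gamma> p \<in> bilinear_maps R C C P" if "p \<in> carrier C" for p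
    by (rule bilinearI) (use l2 l3 that in auto)
  have b2: "(\<lambda>p q. \<gamma> p q r) \<in> bilinear_maps R C C P" if "r \<in> carrier C" for r
    by (rule bilinearI) (use l1 l2 that in auto)
  have b3: "(\<lambda>p s. tensor_lift P (\<gamma> p) s) \<in> bilinear_maps R C ?T P"
    by (assumption | rule lin_intros C P b1 l1)+
  define \<Gamma> where "\<Gamma> = tensor_lift P (\<lambda>p s. tensor_lift P (\<gamma> p) s)"
  have \<Gamma>: "\<Gamma> \<in> linear_maps R ?T3 P"
    unfolding \<Gamma>_def by (rule tensor_lift_linear[OF C T(1) P b3])
  have \<Gamma>pure: "\<Gamma> (pure_tensor R C ?T p (pure_tensor R C C q r)) = \<gamma> p q r"
    if "p \<in> carrier C" "q \<in> carrier C" "r \<in> carrier C" for p q r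
    unfolding \<Gamma>_def using that
    by (simp add: tensor_lift_pure[OF C T(1) P b3] pure_closed[OF C C] tensor_lift_pure[OF C C P b1])
  note \<Gamma>assoc = linear_comp[OF \<Gamma> tensor_assoc_linear[OF C C C]]
  have "\<Gamma> (tensor_assoc R C C C (tensor_map R ?T C (comult C) (\<lambda>x. x) (comult C h)))
    = tensor_lift P (\<lambda>u r. \<Gamma> (tensor_assoc R C C C (pure_tensor R ?T C (comult C u) r))) (comult C h)"
    by (rule linear_tensor_map[OF comult_linear linear_id \<Gamma>assoc comult_closed[OF h] C C T(1) C P])
  also have "\<dots> = tensor_lift P (\<lambda>u r. tensor_lift P (\<lambda>p q. \<gamma> p q r) (comult C u)) (comult C h)"
  proof (rule tensor_lift_cong[OF _ comult_closed[OF h] C C P])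
    show "(\<lambda>u r. \<Gamma> (tensor_assoc R C C C (pure_tensor R ?T C (comult C u) r))) \<in> bilinear_maps R C C P"
      by (rule bilinear_comp[OF tensor_map_bilinear[OF comult_linear linear_id T(1) C] \<Gamma>assoc])
    fix u r assume ur: "u \<in> carrier C" "r \<in> carrier C"
    have bil: "(\<lambda>m n. pure_tensor R C ?T m (pure_tensor R C C n r)) \<in> bilinear_maps R C C ?T3"
      by (rule tensor_assoc_bilinear_inner[OF C C C ur(2)])
    show "\<Gamma> (tensor_assoc R C C C (pure_tensor R ?T C (comult C u) r)) = tensor_lift P (\<lambda>p q. \<gamma> p q r) (comult C u)"
      unfolding tensor_assoc_pure[OF C C C comult_closed[OF ur(1)] ur(2)]
        linear_tensor_lift[OF \<Gamma> bil comult_closed[OF ur(1)] C C T(2) P]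
      by (rule tensor_lift_cong[OF bilinear_comp[OF bil \<Gamma>] comult_closed[OF ur(1)] C C P])
        (rule \<Gamma>pure[OF _ _ ur(2)])
  qed
  finally have L: "\<Gamma> (tensor_assoc R C C C (tensor_map R ?T C (comult C) (\<lambda>x. x) (comult C h)))
    = sweedler P C (\<lambda>u r. sweedler P C (\<lambda>p q. \<gamma> p q r) u) h"
    by (simp add: sweedler_def)
  have "\<Gamma> (tensor_map R C ?T (\<lambda>x. x) (comult C) (comult C h)) = sweedler P C (\<lambda>p v. sweedler P C (\<gamma> p) v) h"
    unfolding \<Gamma>_def sweedler_def
    by (rule tensor_lift_tensor_map[OF linear_id comult_linear b3 comult_closed[OF h] C C C T(1) P])
  then show ?thesis
    using L coassoc[OF h] by (simp add: id_def)
qed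

end

lemma sweedler_swap:
  assumes C: "coalgebra R C" and D: "coalgebra R D"
    and c: "c \<in> carrier C" and d: "d \<in> carrier D"
    and 1: "\<And>m n. \<lbrakk>m \<in> carrier C; n \<in> carrier C\<rbrakk> \<Longrightarrow> \<gamma> m n \<in> bilinear_maps R D D P"
    and 2: "\<And>m n. \<lbrakk>m \<in> carrier D; n \<in> carrier D\<rbrakk>
      \<Longrightarrow> (\<lambda>m' n'. \<gamma> m' n' m n) \<in> bilinear_maps R C C P"
    and P: "module R P"
  shows "sweedler P C (\<lambda>m n. sweedler P D (\<gamma> m n) d) c
    = sweedler P D (\<lambda>m' n'. sweedler P C (\<lambda>m n. \<gamma> m n m' n') c) d"
proof -
  interpret C: coalgebra R C by (rule C)
  interpret D: coalgebra R D by (rule D)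
  show ?thesis unfolding sweedler_def
    by (rule tensor_lift_swap[OF C.comult_closed[OF c] D.comult_closed[OF d] 1 2
          C.module_axioms C.module_axioms D.module_axioms D.module_axioms P])
qed

declare coalgebra.sweedler_linear_arg [lin_intros] coalgebra.sweedler_linear_body [lin_intros]
  coalgebra.sweedler_closed [lin_closed]

section \<open>The coaction on the dual\<close>

context coalgebra
begin

text \<open>The product of \<open>R\<close> is written as the scalar action of
  \<open>regular_module R\<close>, so that the rules for linear maps into modules apply. The first
  leg is \<open>u\<close> and the second is \<open>v\<close>; that \<open>a\<close> takes
  \<open>v\<close> is what makes the convolution opposite.\<close>

lemma
  assumes a: "a \<in> carrier (dual R C)" and b: "b \<in> carrier (dual R C)"
  shows convolution_closed: "opposite_convolution R C a b \<in> carrier (dual R C)"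
    and convolution_apply: "h \<in> carrier C \<Longrightarrow> opposite_convolution R C a b h
      = sweedler (regular_module R) C (\<lambda>u v. a v \<odot>\<^bsub>regular_module R\<^esub> b u) h"
    and convolution_bilinear: "(\<lambda>u v. a v \<odot>\<^bsub>regular_module R\<^esub> b u) \<in> bilinear_maps R C C (regular_module R)"
proof -
  have eq: "opposite_convolution R C a b
    = (\<lambda>h\<in>carrier C. sweedler (regular_module R) C (\<lambda>u v. a v \<odot>\<^bsub>regular_module R\<^esub> b u) h)"
    by (simp add: opposite_convolution_def sweedler_def tensor_lift_regular)
  show bil: "(\<lambda>u v. a v \<odot>\<^bsub>regular_module R\<^esub> b u) \<in> bilinear_maps R C C (regular_module R)"
    by (assumption | rule bilinearI linear_scale linear_scale_left dual_linear a b reg_module lin_closed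
        linear_closed[OF dual_linear])+
  show "opposite_convolution R C a b \<in> carrier (dual R C)"
    unfolding eq by (intro restrict_dual module_axioms sweedler_linear_arg linear_id bil reg_module)
  show "h \<in> carrier C \<Longrightarrow> opposite_convolution R C a b h
      = sweedler (regular_module R) C (\<lambda>u v. a v \<odot>\<^bsub>regular_module R\<^esub> b u) h"
    unfolding eq by simp
qed

lemma coaction_bilinear:
  assumes a: "a \<in> carrier (dual R C)" and M: "module R M" and g: "g \<in> linear_maps R C M"
  shows "(\<lambda>u v. a v \<odot>\<^bsub>M\<^esub> g u) \<in> bilinear_maps R C C M"
  by (assumption | rule bilinearI linear_scale linear_scale_left dual_linear a g M lin_closed
        linear_closed[OF g])+

context
  fixes n f e
  assumes fdb: "finite_dual_basis R C n f e"
begin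

lemma dual_coaction_closed:
  assumes a: "a \<in> carrier (dual R C)"
  shows "dual_coaction R C n f e a \<in> carrier (tensor_product R (dual R C) C)"
proof -
  note D = dual_module[OF module_axioms]
  interpret T: module R "tensor_product R (dual R C) C" by (rule tensor_module[OF D module_axioms])
  show ?thesis
    unfolding dual_coaction_def
    by (rule T.finsum_closed)
      (use fdb in \<open>auto simp: finite_dual_basis_def intro!: pure_closed D module_axioms convolution_closed[OF a]\<close>)
qed

text \<open>The contraction is the sum over \<open>i\<close> of
  \<open><a, h2> <f i, h1> e i\<close>, and summing over \<open>i\<close> expands \<open>h1\<close>
  in the dual basis. The result no longer mentions the basis.\<close>

lemma tensor_eval_dual_coaction:
  assumes a: "a \<in> carrier (dual R C)" and h: "h \<in> carrier C"
  shows "tensor_eval C h (dual_coaction R C n f e a) = sweedler C C (\<lambda>u v. a v \<odot>\<^bsub>C\<^esub> u) h"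
proof -
  note C = module_axioms
  note D = dual_module[OF C]
  let ?T = "tensor_product R C C"
  have f: "f i \<in> carrier (dual R C)" and e: "e i \<in> carrier C" if "i < n" for i
    using fdb that by (auto simp: finite_dual_basis_def)
  let ?b = "\<lambda>i u v. (a v \<odot>\<^bsub>regular_module R\<^esub> f i u) \<odot>\<^bsub>C\<^esub> e i"
  have scale: "(\<lambda>r. r \<odot>\<^bsub>C\<^esub> e i) \<in> linear_maps R (regular_module R) C" if "i < n" for i
    by (rule linear_scale_left[OF C linear_id e[OF that]])
  have bil: "?b i \<in> bilinear_maps R C C C" if "i < n" for i
    by (rule bilinear_comp[OF convolution_bilinear[OF a f[OF that]] scale[OF that]])
  have "tensor_eval C h (dual_coaction R C n f e a)
      = (\<Oplus>\<^bsub>C\<^esub>i\<in>{..<n}. tensor_eval C h (pure_tensor R (dual R C) C (opposite_convolution R C a (f i)) (e i)))"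
    unfolding dual_coaction_def
    by (rule linear_finsum[OF tensor_eval_linear[OF C C h] tensor_module[OF D C] C])
      (auto intro!: pure_closed D C e f convolution_closed[OF a])
  also have "\<dots> = (\<Oplus>\<^bsub>C\<^esub>i\<in>{..<n}. sweedler C C (?b i) h)"
  proof (intro M.finsum_cong' refl)
    fix i assume "i \<in> {..<n}"
    then have i: "i < n" by simp
    show "tensor_eval C h (pure_tensor R (dual R C) C (opposite_convolution R C a (f i)) (e i)) = sweedler C C (?b i) h"
      unfolding tensor_eval_pure[OF C C h convolution_closed[OF a f[OF i]] e[OF i]]
        convolution_apply[OF a f[OF i] h]
      by (rule linear_sweedler[OF scale[OF i] convolution_bilinear[OF a f[OF i]] h reg_module C])
  qed (auto intro!: sweedler_closed h bil[simplified] C)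
  \<comment> \<open>Both sides are values at \<open>comult C h\<close> of linear maps on
    \<open>C \<otimes> C\<close>, so the dual basis expansion only has to be carried out on a pure
    tensor of \<open>u\<close> and \<open>v\<close>.\<close>
  also have "\<dots> = sweedler C C (\<lambda>u v. a v \<odot>\<^bsub>C\<^esub> u) h"
    unfolding sweedler_def
  proof (rule tensor_ext[OF C C linear_finsum_map[OF C] tensor_lift_linear[OF C C C] _ comult_closed[OF h]])
    show bil2: "(\<lambda>u v. a v \<odot>\<^bsub>C\<^esub> u) \<in> bilinear_maps R C C C"
      by (rule coaction_bilinear[OF a C linear_id])
    show "tensor_lift C (?b i) \<in> linear_maps R ?T C" if "i \<in> {..<n}" for i
      using that by (intro tensor_lift_linear C bil) auto
    fix u v assume u: "u \<in> carrier C" and v: "v \<in> carrier C"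
    have av: "a v \<in> carrier R" by (rule dual_closed[OF a v])
    have fu: "f i u \<in> carrier R" if "i < n" for i by (rule dual_closed[OF f[OF that] u])
    have "(\<Oplus>\<^bsub>C\<^esub>i\<in>{..<n}. tensor_lift C (?b i) (pure_tensor R C C u v))
      = (\<Oplus>\<^bsub>C\<^esub>i\<in>{..<n}. a v \<odot>\<^bsub>C\<^esub> (f i u \<odot>\<^bsub>C\<^esub> e i))"
      using av fu e by (intro M.finsum_cong' refl)
        (auto simp: tensor_lift_pure[OF C C C bil[simplified] u v] smult_assoc1)
    also have "\<dots> = a v \<odot>\<^bsub>C\<^esub> (\<Oplus>\<^bsub>C\<^esub>i\<in>{..<n}. f i u \<odot>\<^bsub>C\<^esub> e i)"
      using av fu e by (intro finsum_smult_ldistr[symmetric]) auto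
    also have "(\<Oplus>\<^bsub>C\<^esub>i\<in>{..<n}. f i u \<odot>\<^bsub>C\<^esub> e i) = u"
      using fdb u by (simp add: finite_dual_basis_def)
    finally show "(\<Oplus>\<^bsub>C\<^esub>i\<in>{..<n}. tensor_lift C (?b i) (pure_tensor R C C u v))
        = tensor_lift C (\<lambda>u v. a v \<odot>\<^bsub>C\<^esub> u) (pure_tensor R C C u v)"
      using tensor_lift_pure[OF C C C bil2 u v] by simp
  qed auto
  finally show ?thesis .
qed

text \<open>After evaluation the claim is linearity of \<open><a, h2> h1\<close> in
  \<open>a\<close>; \<open>tensor_eval_inject\<close> carries it back to tensors.\<close>

lemma dual_coaction_linear:
  "dual_coaction R C n f e \<in> linear_maps R (dual R C) (tensor_product R (dual R C) C)"
proof (rule linear_mapsI)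
  note C = module_axioms
  note D = dual_module[OF C]
  interpret D: module R "dual R C" by (rule D)
  interpret T: module R "tensor_product R (dual R C) C" by (rule tensor_module[OF D C])
  note ev = tensor_eval_dual_coaction and lin = tensor_eval_linear[OF C C]
  note cl = dual_coaction_closed
  have slin: "(\<lambda>a. sweedler C C (\<lambda>u v. a v \<odot>\<^bsub>C\<^esub> u) h) \<in> linear_maps R (dual R C) C" if "h \<in> carrier C" for h
    by (assumption | rule sweedler_linear_body that linear_scale_left dual_apply_linear C D
        coaction_bilinear linear_id)+
  fix a assume a: "a \<in> carrier (dual R C)"
  show "dual_coaction R C n f e a \<in> carrier (tensor_product R (dual R C) C)"
    by (rule cl[OF a])
  show "dual_coaction R C n f e (a \<oplus>\<^bsub>dual R C\<^esub> b)
      = dual_coaction R C n f e a \<oplus>\<^bsub>tensor_product R (dual R C) C\<^esub> dual_coaction R C n f e b"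
    if b: "b \<in> carrier (dual R C)" for b
    by (rule tensor_eval_inject[OF C C fdb])
      (use a b cl in \<open>simp_all add: linear_add[OF lin] ev linear_add[OF slin]\<close>)
  show "dual_coaction R C n f e (r \<odot>\<^bsub>dual R C\<^esub> a)
      = r \<odot>\<^bsub>tensor_product R (dual R C) C\<^esub> dual_coaction R C n f e a"
    if r: "r \<in> carrier R" for r
    by (rule tensor_eval_inject[OF C C fdb])
      (use a r cl in \<open>simp_all add: linear_smult[OF lin] ev linear_smult[OF slin]\<close>)
qed

text \<open>Evaluated at \<open>h\<close>, both sides become
  \<open><a, h3> (h1 \<otimes> h2)\<close>.\<close>

lemma dual_coaction_coassoc:
  assumes a: "a \<in> carrier (dual R C)"
  shows "tensor_assoc R (dual R C) C C (tensor_map R (tensor_product R (dual R C) C) C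
      (dual_coaction R C n f e) id (dual_coaction R C n f e a))
    = tensor_map R (dual R C) (tensor_product R C C) id (comult C) (dual_coaction R C n f e a)"
    (is "?lhs = ?rhs")
proof -
  note C = module_axioms
  note D = dual_module[OF C]
  let ?D = "dual R C" and ?\<rho> = "dual_coaction R C n f e"
  let ?CC = "tensor_product R C C" and ?DC = "tensor_product R ?D C"
  let ?DCC = "tensor_product R ?D ?CC"
  have CC: "module R ?CC" and DC: "module R ?DC" and DCC: "module R ?DCC"
    by (rule lin_closed C)+
  note \<rho> = dual_coaction_linear and \<rho>c = dual_coaction_closed[OF a]
  have lmap: "tensor_map R ?DC C ?\<rho> (\<lambda>x. x) \<in> linear_maps R ?DC (tensor_product R ?DC C)"
    by (rule tensor_map_linear[OF \<rho> linear_id D C DC C])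
  have rmap: "tensor_map R ?D ?CC (\<lambda>x. x) (comult C) \<in> linear_maps R ?DC ?DCC"
    by (rule tensor_map_linear[OF linear_id comult_linear D C D CC])
  note left = linear_comp[OF tensor_assoc_linear[OF D C C] lmap]
  have abil: "(\<lambda>u v. b v \<odot>\<^bsub>M\<^esub> g u) \<in> bilinear_maps R C C M"
    if "b \<in> carrier ?D" "module R M" "g \<in> linear_maps R C M" for b M g
    using coaction_bilinear that by blast
  show ?thesis
    unfolding id_def
  proof (rule tensor_eval_inject[OF C CC fdb linear_closed[OF left \<rho>c] linear_closed[OF rmap \<rho>c]])
    fix h assume h: "h \<in> carrier C"
    note ev = tensor_eval_linear[OF C CC h]
    have bilu: "(\<lambda>u v. pure_tensor R C C u (tensor_eval C v t)) \<in> bilinear_maps R C C ?CC" if "t \<in> carrier ?DC" for t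
      by (assumption | rule bilinearI linear_pure_left linear_pure_right linear_id C
          tensor_eval_linear_left that linear_closed[OF tensor_eval_linear])+
    \<comment> \<open>For any \<open>t\<close> in place of the inner \<open>\<rho>(a)\<close>,
      evaluating at \<open>h\<close> after applying the coaction to the first factor gives
      \<open>h1 \<otimes> t(h2)\<close>. This is linear in \<open>t\<close>, hence checked on
      \<open>b \<otimes> c\<close>, where the scalar \<open><b, h2>\<close> moves from
      \<open>h1\<close> to \<open>c\<close>.\<close>
    have "tensor_eval ?CC h (tensor_assoc R ?D C C (tensor_map R ?DC C ?\<rho> (\<lambda>x. x) (?\<rho> a)))
        = sweedler ?CC C (\<lambda>u v. pure_tensor R C C u (tensor_eval C v (?\<rho> a))) h"
    proof (rule tensor_ext[OF D C linear_comp[OF ev left] _ _ \<rho>c])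
      show "(\<lambda>t. sweedler ?CC C (\<lambda>u v. pure_tensor R C C u (tensor_eval C v t)) h) \<in> linear_maps R ?DC ?CC"
        by (assumption | rule sweedler_linear_body h linear_pure_right tensor_eval_linear C CC DC bilu)+
      fix b c assume b: "b \<in> carrier ?D" and c: "c \<in> carrier C"
      have bil0: "(\<lambda>m n. pure_tensor R ?D ?CC m (pure_tensor R C C n c)) \<in> bilinear_maps R ?D C ?DCC"
        by (rule tensor_assoc_bilinear_inner[OF D C C c])
      have pl: "(\<lambda>x. pure_tensor R C C x c) \<in> linear_maps R C ?CC"
        by (rule linear_pure_left[OF linear_id c C C])
      have "tensor_eval ?CC h (tensor_assoc R ?D C C (tensor_map R ?DC C ?\<rho> (\<lambda>x. x) (pure_tensor R ?D C b c)))
        = tensor_eval ?CC h (tensor_lift ?DCC (\<lambda>m n. pure_tensor R ?D ?CC m (pure_tensor R C C n c)) (?\<rho> b))"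
        unfolding tensor_map_pure[OF \<rho> linear_id b c D C DC C]
          tensor_assoc_pure[OF D C C dual_coaction_closed[OF b] c] ..
      also have "\<dots> = tensor_lift ?CC (\<lambda>m n. tensor_eval ?CC h (pure_tensor R ?D ?CC m (pure_tensor R C C n c))) (?\<rho> b)"
        by (rule linear_tensor_lift[OF ev bil0 dual_coaction_closed[OF b] D C DCC CC])
      also have "\<dots> = tensor_lift ?CC (\<lambda>m n. pure_tensor R C C (m h \<odot>\<^bsub>C\<^esub> n) c) (?\<rho> b)"
        by (rule tensor_lift_cong[OF bilinear_comp[OF bil0 ev] dual_coaction_closed[OF b] D C CC])
          (simp add: tensor_eval_pure[OF C CC h] pure_closed[OF C C] c pure_smult_left[OF C C] dual_closed h)
      also have "\<dots> = pure_tensor R C C (tensor_eval C h (?\<rho> b)) c"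
        unfolding tensor_eval_def
        by (rule linear_tensor_lift[OF pl tensor_eval_bilinear[OF C C h] dual_coaction_closed[OF b] D C C CC, symmetric])
      also have "\<dots> = pure_tensor R C C (sweedler C C (\<lambda>u v. b v \<odot>\<^bsub>C\<^esub> u) h) c"
        by (simp add: tensor_eval_dual_coaction[OF b h])
      also have "\<dots> = sweedler ?CC C (\<lambda>u v. pure_tensor R C C (b v \<odot>\<^bsub>C\<^esub> u) c) h"
        by (rule linear_sweedler[OF pl abil[OF b C linear_id] h C CC])
      also have "\<dots> = sweedler ?CC C (\<lambda>u v. pure_tensor R C C u (tensor_eval C v (pure_tensor R ?D C b c))) h"
        by (rule sweedler_cong[OF bilinear_comp[OF abil[OF b C linear_id] pl] h CC])
          (simp add: tensor_eval_pure[OF C C] b c dual_closed[OF b] pure_smult_left[OF C C] pure_smult_right[OF C C])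
      finally show "tensor_eval ?CC h (tensor_assoc R ?D C C (tensor_map R ?DC C ?\<rho> (\<lambda>x. x) (pure_tensor R ?D C b c)))
        = sweedler ?CC C (\<lambda>u v. pure_tensor R C C u (tensor_eval C v (pure_tensor R ?D C b c))) h" .
    qed
    also have "\<dots> = sweedler ?CC C (\<lambda>u v. sweedler ?CC C (\<lambda>p q. a q \<odot>\<^bsub>?CC\<^esub> pure_tensor R C C u p) v) h"
    proof (rule sweedler_cong[OF bilu[OF \<rho>c] h CC])
      fix u v assume u: "u \<in> carrier C" and v: "v \<in> carrier C"
      have pl: "pure_tensor R C C u \<in> linear_maps R C ?CC"
        by (rule bilinear_right[OF bilinear_pure[OF C C] u])
      have "pure_tensor R C C u (tensor_eval C v (?\<rho> a)) = sweedler ?CC C (\<lambda>p q. pure_tensor R C C u (a q \<odot>\<^bsub>C\<^esub> p)) v"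
        unfolding tensor_eval_dual_coaction[OF a v]
        by (rule linear_sweedler[OF pl abil[OF a C linear_id] v C CC])
      also have "\<dots> = sweedler ?CC C (\<lambda>p q. a q \<odot>\<^bsub>?CC\<^esub> pure_tensor R C C u p) v"
        by (rule sweedler_cong[OF bilinear_comp[OF abil[OF a C linear_id] pl] v CC])
          (simp add: pure_smult_right[OF C C] u dual_closed[OF a])
      finally show "pure_tensor R C C u (tensor_eval C v (?\<rho> a)) = \<dots>" .
    qed
    also have "\<dots> = sweedler ?CC C (\<lambda>u r. sweedler ?CC C (\<lambda>p q. a r \<odot>\<^bsub>?CC\<^esub> pure_tensor R C C p q) u) h"
      by (rule sweedler_coassoc[symmetric])
        (assumption | rule h CC C linear_scale linear_scale_left dual_linear[OF a] dual_closed[OF a]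
          linear_pure_left linear_pure_right linear_id pure_closed)+
    also have "\<dots> = sweedler ?CC C (\<lambda>u v. a v \<odot>\<^bsub>?CC\<^esub> comult C u) h"
    proof (rule sweedler_cong[symmetric, OF abil[OF a CC comult_linear] h CC])
      fix u v assume u: "u \<in> carrier C" and v: "v \<in> carrier C"
      have "(\<lambda>t. a v \<odot>\<^bsub>?CC\<^esub> t) \<in> linear_maps R ?CC ?CC"
        by (rule linear_scale[OF CC linear_id dual_closed[OF a v]])
      from linear_sweedler[OF this bilinear_pure[OF C C] u CC CC]
      show "a v \<odot>\<^bsub>?CC\<^esub> comult C u = sweedler ?CC C (\<lambda>p q. a v \<odot>\<^bsub>?CC\<^esub> pure_tensor R C C p q) u"
        by (simp add: sweedler_pure_tensor u)
    qed
    also have "\<dots> = comult C (tensor_eval C h (?\<rho> a))"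
    proof -
      have "comult C (tensor_eval C h (?\<rho> a)) = sweedler ?CC C (\<lambda>u v. comult C (a v \<odot>\<^bsub>C\<^esub> u)) h"
        unfolding tensor_eval_dual_coaction[OF a h]
        by (rule linear_sweedler[OF comult_linear abil[OF a C linear_id] h C CC])
      also have "\<dots> = sweedler ?CC C (\<lambda>u v. a v \<odot>\<^bsub>?CC\<^esub> comult C u) h"
        by (rule sweedler_cong[OF bilinear_comp[OF abil[OF a C linear_id] comult_linear] h CC])
          (simp add: linear_smult[OF comult_linear] dual_closed[OF a])
      finally show ?thesis by simp
    qed
    \<comment> \<open>Evaluation consumes the first factor and \<open>comult C\<close> acts on the
      second, so the two commute.\<close>
    also have "\<dots> = tensor_eval ?CC h (tensor_map R ?D ?CC (\<lambda>x. x) (comult C) (?\<rho> a))"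
    proof (rule tensor_ext[OF D C linear_comp[OF comult_linear tensor_eval_linear[OF C C h]]
          linear_comp[OF ev rmap] _ \<rho>c])
      fix b c assume b: "b \<in> carrier ?D" and c: "c \<in> carrier C"
      show "comult C (tensor_eval C h (pure_tensor R ?D C b c))
        = tensor_eval ?CC h (tensor_map R ?D ?CC (\<lambda>x. x) (comult C) (pure_tensor R ?D C b c))"
        using b c by (simp add: tensor_map_pure[OF linear_id comult_linear b c D C D CC]
            tensor_eval_pure[OF C C h b c] tensor_eval_pure[OF C CC h b comult_closed[OF c]]
            linear_smult[OF comult_linear] dual_closed[OF b h])
    qed
    finally show "tensor_eval ?CC h (tensor_assoc R ?D C C (tensor_map R ?DC C ?\<rho> (\<lambda>x. x) (?\<rho> a)))
      = tensor_eval ?CC h (tensor_map R ?D ?CC (\<lambda>x. x) (comult C) (?\<rho> a))" .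
  qed
qed

text \<open>Applying the counit to the second factor commutes with evaluation at \<open>h\<close>,
  so the left-hand side takes the value \<open>\<epsilon>(h1) <a, h2> = <a, h>\<close>.\<close>

lemma dual_coaction_counit:
  assumes a: "a \<in> carrier (dual R C)"
  shows "tensor_unit_right (dual R C) (tensor_map R (dual R C) (regular_module R) id (counit C)
    (dual_coaction R C n f e a)) = a"
proof -
  note C = module_axioms
  note D = dual_module[OF C]
  let ?D = "dual R C" and ?\<rho> = "dual_coaction R C n f e" and ?K = "regular_module R"
  note \<rho>c = dual_coaction_closed[OF a]
  have bil: "(\<lambda>b c. counit C c \<odot>\<^bsub>?D\<^esub> b) \<in> bilinear_maps R ?D C ?D"
    by (assumption | rule bilinearI linear_scale linear_scale_left linear_id counit_linear counit_closed D)+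
  have eq: "tensor_unit_right ?D (tensor_map R ?D ?K id (counit C) (?\<rho> a))
    = tensor_lift ?D (\<lambda>b c. counit C c \<odot>\<^bsub>?D\<^esub> b) (?\<rho> a)"
    unfolding tensor_unit_right_def id_def
    by (rule tensor_lift_tensor_map[OF linear_id counit_linear bilinear_smult_right[OF D] \<rho>c D C D reg_module D])
  show ?thesis
    unfolding eq
  proof (rule dual_eqI[OF tensor_lift_closed[OF \<rho>c bil D C D] a])
    fix h assume h: "h \<in> carrier C"
    have abil: "(\<lambda>u v. a v \<odot>\<^bsub>C\<^esub> u) \<in> bilinear_maps R C C C"
      by (rule coaction_bilinear[OF a C linear_id])
    have "tensor_lift ?D (\<lambda>b c. counit C c \<odot>\<^bsub>?D\<^esub> b) (?\<rho> a) h
      = tensor_lift ?K (\<lambda>b c. (counit C c \<odot>\<^bsub>?D\<^esub> b) h) (?\<rho> a)"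
      by (rule linear_tensor_lift[OF dual_apply_linear[OF h] bil \<rho>c D C D reg_module])
    also have "\<dots> = tensor_lift ?K (\<lambda>b c. counit C (b h \<odot>\<^bsub>C\<^esub> c)) (?\<rho> a)"
      by (rule tensor_lift_cong[OF bilinear_comp[OF bil dual_apply_linear[OF h]] \<rho>c D C reg_module])
        (simp add: h linear_smult[OF counit_linear] dual_closed counit_closed R.m_comm)
    also have "\<dots> = counit C (tensor_eval C h (?\<rho> a))"
      unfolding tensor_eval_def
      by (rule linear_tensor_lift[OF counit_linear tensor_eval_bilinear[OF C C h] \<rho>c D C C reg_module, symmetric])
    also have "\<dots> = sweedler ?K C (\<lambda>u v. counit C (a v \<odot>\<^bsub>C\<^esub> u)) h"
      unfolding tensor_eval_dual_coaction[OF a h]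
      by (rule linear_sweedler[OF counit_linear abil h C reg_module])
    also have "\<dots> = sweedler ?K C (\<lambda>u v. counit C u \<odot>\<^bsub>?K\<^esub> a v) h"
      by (rule sweedler_cong[OF bilinear_comp[OF abil counit_linear] h reg_module])
        (simp add: linear_smult[OF counit_linear] dual_closed[OF a] counit_closed R.m_comm)
    also have "\<dots> = a h"
      by (rule sweedler_counit_left[OF dual_linear[OF a] h reg_module])
    finally show "tensor_lift ?D (\<lambda>b c. counit C c \<odot>\<^bsub>?D\<^esub> b) (?\<rho> a) h = a h" .
  qed
qed

lemma dual_comodule: "right_comodule R C (dual R C) (dual_coaction R C n f e)"
  by (intro right_comodule.intro right_comodule_axioms.intro dual_module module_axioms
      dual_coaction_linear dual_coaction_coassoc dual_coaction_counit)

end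

end

section \<open>Identities in a Hopf category\<close>

lemma tensor_coalgebra_simps:
  "linear_maps R (tensor_coalgebra R C D) = linear_maps R (tensor_product R C D)"
  "carrier (tensor_coalgebra R C D) = carrier (tensor_product R C D)"
  "comult (tensor_coalgebra R C D) t = tensor_swap_middle R C C D D
     (tensor_map R (tensor_product R C C) (tensor_product R D D) (comult C) (comult D) t)"
  "counit (tensor_coalgebra R C D) = tensor_lift R (\<lambda>h l. counit C h \<otimes>\<^bsub>R\<^esub> counit D l)"
  by (auto simp: linear_maps_def tensor_coalgebra_def module.defs coalgebra.defs)

lemma unit_coalgebra_simps:
  "linear_maps R (unit_coalgebra R) = linear_maps R (regular_module R)"
  "carrier (unit_coalgebra R) = carrier R"
  "comult (unit_coalgebra R) r = pure_tensor R (regular_module R) (regular_module R) r \<one>\<^bsub>R\<^esub>"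
  "counit (unit_coalgebra R) r = r"
  by (auto simp: linear_maps_def unit_coalgebra_def module.defs coalgebra.defs)

context hopf_category
begin

definition mul where
  "mul x y z a b = \<mu> x y z (pure_tensor R (A x y) (A y z) a b)"

definition unit where
  "unit x = \<eta> x \<one>\<^bsub>R\<^esub>"

lemma hom_module: "x \<in> Ob \<Longrightarrow> y \<in> Ob \<Longrightarrow> module R (A x y)"
  using fg_projective by (simp add: fg_projective_module_def)

lemma reg_module: "module R (regular_module R)"
  by (rule module_regular[OF base_ring])

lemma \<mu>_linear:
  "x \<in> Ob \<Longrightarrow> y \<in> Ob \<Longrightarrow> z \<in> Ob \<Longrightarrow> \<mu> x y z \<in> linear_maps R (tensor_product R (A x y) (A y z)) (A x z)"
  using comp_coalgebra_morphism by (simp add: coalgebra_morphisms_def tensor_coalgebra_simps)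

lemma mul_linear_left:
  assumes "f \<in> linear_maps R L (A x y)" "x \<in> Ob" "y \<in> Ob" "z \<in> Ob" "b \<in> carrier (A y z)"
  shows "(\<lambda>t. mul x y z (f t) b) \<in> linear_maps R L (A x z)"
  unfolding mul_def
  by (rule linear_comp[OF \<mu>_linear linear_pure_left]) (rule assms hom_module)+

lemma mul_linear_right:
  assumes "f \<in> linear_maps R L (A y z)" "x \<in> Ob" "y \<in> Ob" "z \<in> Ob" "a \<in> carrier (A x y)"
  shows "(\<lambda>t. mul x y z a (f t)) \<in> linear_maps R L (A x z)"
  unfolding mul_def
  by (rule linear_comp[OF \<mu>_linear linear_pure_right]) (rule assms hom_module)+

lemma mul_closed:
  assumes "x \<in> Ob" "y \<in> Ob" "z \<in> Ob" "a \<in> carrier (A x y)" "b \<in> carrier (A y z)"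
  shows "mul x y z a b \<in> carrier (A x z)"
  by (rule linear_closed[OF mul_linear_left[OF linear_id]]) (rule assms)+

lemma mul_smult:
  assumes "x \<in> Ob" "y \<in> Ob" "z \<in> Ob" "a \<in> carrier (A x y)" "b \<in> carrier (A y z)" "r \<in> carrier R"
  shows "mul x y z (r \<odot>\<^bsub>A x y\<^esub> a) b = r \<odot>\<^bsub>A x z\<^esub> mul x y z a b"
    and "mul x y z a (r \<odot>\<^bsub>A y z\<^esub> b) = r \<odot>\<^bsub>A x z\<^esub> mul x y z a b"
  using linear_smult[OF mul_linear_left[OF linear_id assms(1-3,5)] assms(6,4)]
    linear_smult[OF mul_linear_right[OF linear_id assms(1-4)] assms(6,5)] by auto

lemma \<eta>_linear: "x \<in> Ob \<Longrightarrow> \<eta> x \<in> linear_maps R (regular_module R) (A x x)"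
  using unit_coalgebra_morphism by (simp add: coalgebra_morphisms_def unit_coalgebra_simps)

lemma one_closed_R: "\<one>\<^bsub>R\<^esub> \<in> carrier R"
  using cring.cring_simprules(6)[OF base_ring] .

lemma unit_closed: "x \<in> Ob \<Longrightarrow> unit x \<in> carrier (A x x)"
  unfolding unit_def by (rule linear_closed[OF \<eta>_linear]) (simp_all add: one_closed_R)

lemma mul_assoc:
  assumes "x \<in> Ob" "y \<in> Ob" "z \<in> Ob" "w \<in> Ob" "a \<in> carrier (A x y)" "b \<in> carrier (A y z)" "c \<in> carrier (A z w)"
  shows "mul x z w (mul x y z a b) c = mul x y w a (mul y z w b c)"
  unfolding mul_def by (rule comp_assoc) (rule assms)+

lemma mul_unit_left: "x \<in> Ob \<Longrightarrow> y \<in> Ob \<Longrightarrow> a \<in> carrier (A x y) \<Longrightarrow> mul x x y (unit x) a = a"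
  and mul_unit_right: "x \<in> Ob \<Longrightarrow> y \<in> Ob \<Longrightarrow> a \<in> carrier (A x y) \<Longrightarrow> mul x y y a (unit y) = a"
  unfolding mul_def unit_def by (simp_all add: comp_unit_left comp_unit_right)

lemma S_linear:
  assumes "f \<in> linear_maps R L (A x y)" "x \<in> Ob" "y \<in> Ob"
  shows "(\<lambda>t. S x y (f t)) \<in> linear_maps R L (A y x)"
  by (rule linear_comp[OF antipode_linear]) (rule assms)+

lemma S_closed: "x \<in> Ob \<Longrightarrow> y \<in> Ob \<Longrightarrow> a \<in> carrier (A x y) \<Longrightarrow> S x y a \<in> carrier (A y x)"
  by (rule linear_closed[OF antipode_linear])

lemma counit_closed: "x \<in> Ob \<Longrightarrow> y \<in> Ob \<Longrightarrow> a \<in> carrier (A x y) \<Longrightarrow> counit (A x y) a \<in> carrier R"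
  by (rule coalgebra.counit_closed[OF hom_coalgebra])

lemma comult_closed:
  "x \<in> Ob \<Longrightarrow> y \<in> Ob \<Longrightarrow> a \<in> carrier (A x y) \<Longrightarrow> comult (A x y) a \<in> carrier (tensor_product R (A x y) (A x y))"
  by (rule coalgebra.comult_closed[OF hom_coalgebra])

lemmas hopf_intros = bilinearI mul_linear_left mul_linear_right S_linear
  coalgebra.sweedler_linear_arg coalgebra.sweedler_linear_body coalgebra.sweedler_closed
  linear_id mul_closed S_closed unit_closed hom_module hom_coalgebra

text \<open>The rule \<open>\<Delta>(ab) = \<Delta>(a) \<Delta>(b)\<close>, extracted from the
  condition that composition is a coalgebra morphism. The interchange in the tensor coalgebra is
  what pairs first legs with first legs and second with second.\<close>

lemma sweedler_mul:
  assumes x: "x \<in> Ob" and y: "y \<in> Ob" and z: "z \<in> Ob" and a: "a \<in> carrier (A x y)" and b: "b \<in> carrier (A y z)"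
    and \<beta>: "\<beta> \<in> bilinear_maps R (A x z) (A x z) P" and P: "module R P"
  shows "sweedler P (A x z) \<beta> (mul x y z a b) = sweedler P (A x y) (\<lambda>a\<^sub>1 a\<^sub>2.
    sweedler P (A y z) (\<lambda>b\<^sub>1 b\<^sub>2. \<beta> (mul x y z a\<^sub>1 b\<^sub>1) (mul x y z a\<^sub>2 b\<^sub>2)) b) a"
proof -
  let ?C = "A x y" and ?D = "A y z" and ?E = "A x z"
  have C: "module R ?C" and D: "module R ?D" and E: "module R ?E" by (rule hom_module x y z)+
  interpret C: coalgebra R ?C by (rule hom_coalgebra[OF x y])
  interpret D: coalgebra R ?D by (rule hom_coalgebra[OF y z])
  let ?CC = "tensor_product R ?C ?C" and ?DD = "tensor_product R ?D ?D" and ?CD = "tensor_product R ?C ?D"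
  have mods: "module R ?CC" "module R ?DD" "module R ?CD" "module R (tensor_product R ?CD ?CD)"
    "module R (tensor_product R ?E ?E)"
    by (rule lin_closed C D E)+
  have ab: "pure_tensor R ?C ?D a b \<in> carrier ?CD" by (rule pure_closed[OF C D a b])
  note \<mu> = \<mu>_linear[OF x y z]
  let ?\<sigma> = "tensor_swap_middle R ?C ?C ?D ?D (pure_tensor R ?CC ?DD (comult ?C a) (comult ?D b))"
  have \<sigma>: "?\<sigma> \<in> carrier (tensor_product R ?CD ?CD)"
    by (rule linear_closed[OF tensor_swap_middle_linear[OF C C D D]])
      (rule pure_closed mods C.comult_closed D.comult_closed a b)+
  have "comult ?E (mul x y z a b) = tensor_map R ?E ?E (\<mu> x y z) (\<mu> x y z) (comult (tensor_coalgebra R ?C ?D) (pure_tensor R ?C ?D a b))"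
    using comp_coalgebra_morphism[OF x y z] ab by (simp add: coalgebra_morphisms_def tensor_coalgebra_simps mul_def)
  also have "comult (tensor_coalgebra R ?C ?D) (pure_tensor R ?C ?D a b) = ?\<sigma>"
    by (simp add: tensor_coalgebra_simps tensor_map_pure[OF C.comult_linear D.comult_linear a b C D mods(1,2)])
  finally have "sweedler P ?E \<beta> (mul x y z a b) = tensor_lift P \<beta> (tensor_map R ?E ?E (\<mu> x y z) (\<mu> x y z) ?\<sigma>)"
    by (simp add: sweedler_def)
  also have "\<dots> = tensor_lift P (\<lambda>c\<^sub>1 c\<^sub>2. tensor_lift P (\<lambda>d\<^sub>1 d\<^sub>2. tensor_lift P \<beta> (tensor_map R ?E ?E (\<mu> x y z) (\<mu> x y z)
      (pure_tensor R ?CD ?CD (pure_tensor R ?C ?D c\<^sub>1 d\<^sub>1) (pure_tensor R ?C ?D c\<^sub>2 d\<^sub>2)))) (comult ?D b)) (comult ?C a)"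
    by (rule linear_tensor_swap_middle[OF linear_comp[OF tensor_lift_linear[OF E E P \<beta>]
          tensor_map_linear[OF \<mu> \<mu> mods(3,3) E E]] C.comult_closed[OF a] D.comult_closed[OF b] C C D D P])
  also have "\<dots> = tensor_lift P (\<lambda>a\<^sub>1 a\<^sub>2. tensor_lift P (\<lambda>b\<^sub>1 b\<^sub>2. \<beta> (mul x y z a\<^sub>1 b\<^sub>1) (mul x y z a\<^sub>2 b\<^sub>2)) (comult ?D b)) (comult ?C a)"
  proof -
    have val: "tensor_lift P \<beta> (tensor_map R ?E ?E (\<mu> x y z) (\<mu> x y z)
      (pure_tensor R ?CD ?CD (pure_tensor R ?C ?D c\<^sub>1 d\<^sub>1) (pure_tensor R ?C ?D c\<^sub>2 d\<^sub>2)))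
      = \<beta> (mul x y z c\<^sub>1 d\<^sub>1) (mul x y z c\<^sub>2 d\<^sub>2)"
      if "c\<^sub>1 \<in> carrier ?C" "c\<^sub>2 \<in> carrier ?C" "d\<^sub>1 \<in> carrier ?D" "d\<^sub>2 \<in> carrier ?D" for c\<^sub>1 c\<^sub>2 d\<^sub>1 d\<^sub>2
      unfolding tensor_map_pure[OF \<mu> \<mu> pure_closed[OF C D that(1,3)] pure_closed[OF C D that(2,4)] mods(3,3) E E]
      unfolding mul_def[symmetric]
      by (rule tensor_lift_pure[OF E E P \<beta>]) (rule mul_closed x y z that)+
    have inner: "(\<lambda>b\<^sub>1 b\<^sub>2. \<beta> (mul x y z a\<^sub>1 b\<^sub>1) (mul x y z a\<^sub>2 b\<^sub>2)) \<in> bilinear_maps R ?D ?D P"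
      if "a\<^sub>1 \<in> carrier ?C" "a\<^sub>2 \<in> carrier ?C" for a\<^sub>1 a\<^sub>2
      by (rule bilinearI)
        (rule linear_comp[OF bilinear_left[OF \<beta>]] linear_comp[OF bilinear_right[OF \<beta>]]
          mul_linear_right linear_id mul_closed x y z that | assumption)+
    have outer: "(\<lambda>a\<^sub>1 a\<^sub>2. tensor_lift P (\<lambda>b\<^sub>1 b\<^sub>2. \<beta> (mul x y z a\<^sub>1 b\<^sub>1) (mul x y z a\<^sub>2 b\<^sub>2)) (comult ?D b)) \<in> bilinear_maps R ?C ?C P"
      by (rule bilinearI; rule tensor_lift_linear_body[OF D.comult_closed[OF b] _ inner D D P C])
        (rule linear_comp[OF bilinear_left[OF \<beta>]] linear_comp[OF bilinear_right[OF \<beta>]]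
          mul_linear_left linear_id mul_closed x y z | assumption)+
    show ?thesis
      by (rule tensor_lift_cong[symmetric, OF outer C.comult_closed[OF a] C C P],
          rule tensor_lift_cong[OF inner D.comult_closed[OF b] D D P])
        (simp_all add: val)
  qed
  finally show ?thesis by (simp add: sweedler_def)
qed

lemma counit_mul:
  assumes x: "x \<in> Ob" and y: "y \<in> Ob" and z: "z \<in> Ob" and a: "a \<in> carrier (A x y)" and b: "b \<in> carrier (A y z)"
  shows "counit (A x z) (mul x y z a b) = counit (A x y) a \<otimes>\<^bsub>R\<^esub> counit (A y z) b"
proof -
  interpret C: coalgebra R "A x y" by (rule hom_coalgebra[OF x y])
  interpret D: coalgebra R "A y z" by (rule hom_coalgebra[OF y z])
  have bil: "(\<lambda>h l. counit (A x y) h \<odot>\<^bsub>regular_module R\<^esub> counit (A y z) l) \<in> bilinear_maps R (A x y) (A y z) (regular_module R)"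
    by (assumption | rule bilinearI linear_scale linear_scale_left C.counit_linear D.counit_linear reg_module
        C.counit_closed linear_closed[OF D.counit_linear])+
  have "counit (A x z) (mul x y z a b) = counit (tensor_coalgebra R (A x y) (A y z)) (pure_tensor R (A x y) (A y z) a b)"
    using comp_coalgebra_morphism[OF x y z] pure_closed[OF C.module_axioms D.module_axioms a b]
    by (simp add: coalgebra_morphisms_def tensor_coalgebra_simps mul_def)
  also have "\<dots> = counit (A x y) a \<otimes>\<^bsub>R\<^esub> counit (A y z) b"
    using tensor_lift_pure[OF C.module_axioms D.module_axioms reg_module bil a b]
    by (simp add: tensor_coalgebra_simps tensor_lift_regular)
  finally show ?thesis .
qed

text \<open>The unit is grouplike, being the image of \<open>1\<close> under a coalgebra morphism
  from the base ring, where \<open>\<Delta>(1) = 1 \<otimes> 1\<close>.\<close>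

lemma sweedler_unit:
  assumes x: "x \<in> Ob" and \<beta>: "\<beta> \<in> bilinear_maps R (A x x) (A x x) P" and P: "module R P"
  shows "sweedler P (A x x) \<beta> (unit x) = \<beta> (unit x) (unit x)"
proof -
  note E = hom_module[OF x x]
  have o: "\<one>\<^bsub>R\<^esub> \<in> carrier (regular_module R)" using one_closed_R by simp
  have "comult (A x x) (unit x) = tensor_map R (A x x) (A x x) (\<eta> x) (\<eta> x) (pure_tensor R (regular_module R) (regular_module R) \<one>\<^bsub>R\<^esub> \<one>\<^bsub>R\<^esub>)"
    using unit_coalgebra_morphism[OF x] one_closed_R by (simp add: coalgebra_morphisms_def unit_coalgebra_simps unit_def)
  also have "\<dots> = pure_tensor R (A x x) (A x x) (unit x) (unit x)"
    unfolding unit_def by (rule tensor_map_pure[OF \<eta>_linear[OF x] \<eta>_linear[OF x] o o reg_module reg_module E E])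
  finally show ?thesis
    using tensor_lift_pure[OF E E P \<beta> unit_closed[OF x] unit_closed[OF x]] by (simp add: sweedler_def)
qed

lemma counit_unit: "x \<in> Ob \<Longrightarrow> counit (A x x) (unit x) = \<one>\<^bsub>R\<^esub>"
  using unit_coalgebra_morphism one_closed_R by (simp add: coalgebra_morphisms_def unit_coalgebra_simps unit_def)

section \<open>Identities for the antipode\<close>

lemma sweedler_antipode_right:
  assumes x: "x \<in> Ob" and y: "y \<in> Ob" and h: "h \<in> carrier (A x y)"
  shows "sweedler (A x x) (A x y) (\<lambda>p q. mul x y x p (S x y q)) h = counit (A x y) h \<odot>\<^bsub>A x x\<^esub> unit x"
  using linear_tensor_map[OF linear_id antipode_linear[OF x y] \<mu>_linear[OF x y x] comult_closed[OF x y h]]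
    antipode_right[OF x y h] x y
  by (simp add: sweedler_def mul_def unit_def id_def hom_module)

lemma sweedler_antipode_left:
  assumes x: "x \<in> Ob" and y: "y \<in> Ob" and h: "h \<in> carrier (A x y)"
  shows "sweedler (A y y) (A x y) (\<lambda>p q. mul y x y (S x y p) q) h = counit (A x y) h \<odot>\<^bsub>A y y\<^esub> unit y"
  using linear_tensor_map[OF antipode_linear[OF x y] linear_id \<mu>_linear[OF y x y] comult_closed[OF x y h]]
    antipode_left[OF x y h] x y
  by (simp add: sweedler_def mul_def unit_def id_def hom_module)

text \<open>\<open>H(c1, c2 S(c3)) = \<epsilon>(c2) H(c1, 1) = H(c, 1)\<close>. Read from right to
  left it inserts the factor \<open>c2 S(c3)\<close>, which is how it is used.\<close>

lemma sweedler_antipode_cancel: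
  assumes x: "x \<in> Ob" and y: "y \<in> Ob" and c: "c \<in> carrier (A x y)"
    and H: "H \<in> bilinear_maps R (A x y) (A x x) P" and P: "module R P"
  shows "sweedler P (A x y) (\<lambda>p v. sweedler P (A x y) (\<lambda>q r. H p (mul x y x q (S x y r))) v) c = H c (unit x)"
proof -
  interpret C: coalgebra R "A x y" by (rule hom_coalgebra[OF x y])
  note C = hom_module[OF x y] and E = hom_module[OF x x]
  have bil: "(\<lambda>q r. mul x y x q (S x y r)) \<in> bilinear_maps R (A x y) (A x y) (A x x)"
    by (assumption | rule hopf_intros x y)+
  have val: "sweedler P (A x y) (\<lambda>q r. H p (mul x y x q (S x y r))) v = counit (A x y) v \<odot>\<^bsub>P\<^esub> H p (unit x)"
    if p: "p \<in> carrier (A x y)" and v: "v \<in> carrier (A x y)" for p v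
    using C.linear_sweedler[OF bilinear_right[OF H p] bil v E P] sweedler_antipode_right[OF x y v]
      linear_smult[OF bilinear_right[OF H p] C.counit_closed[OF v] unit_closed[OF x]] by simp
  have "sweedler P (A x y) (\<lambda>p v. counit (A x y) v \<odot>\<^bsub>P\<^esub> H p (unit x)) c = H c (unit x)"
    by (rule C.sweedler_counit_right[OF bilinear_left[OF H unit_closed[OF x]] c P])
  moreover have "sweedler P (A x y) (\<lambda>p v. counit (A x y) v \<odot>\<^bsub>P\<^esub> H p (unit x)) c
    = sweedler P (A x y) (\<lambda>p v. sweedler P (A x y) (\<lambda>q r. H p (mul x y x q (S x y r))) v) c"
  proof (rule C.sweedler_cong[OF _ c P])
    show "(\<lambda>p v. counit (A x y) v \<odot>\<^bsub>P\<^esub> H p (unit x)) \<in> bilinear_maps R (A x y) (A x y) P"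
      by (assumption | rule bilinearI linear_scale linear_scale_left P bilinear_left[OF H] unit_closed x
          C.counit_closed C.counit_linear bilinear_closed[OF H])+
  qed (simp add: val)
  ultimately show ?thesis by simp
qed

text \<open>In the convolution algebra, \<open>F = (F * id) * S\<close>.\<close>

lemma convolution_antipode:
  assumes x: "x \<in> Ob" and y: "y \<in> Ob" and w: "w \<in> Ob" and c: "c \<in> carrier (A x y)"
    and F: "F \<in> linear_maps R (A x y) (A w x)"
    and G: "\<And>u. u \<in> carrier (A x y) \<Longrightarrow> sweedler (A w y) (A x y) (\<lambda>p q. mul w x y (F p) q) u = G u"
  shows "F c = sweedler (A w x) (A x y) (\<lambda>u r. mul w y x (G u) (S x y r)) c"
proof -
  interpret C: coalgebra R "A x y" by (rule hom_coalgebra[OF x y])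
  note C = hom_module[OF x y] and P = hom_module[OF w x] and Q = hom_module[OF w y]
  note Fl = linear_comp[OF F] and Fc = linear_closed[OF F]
  have bilF: "(\<lambda>p q. mul w x y (F p) q) \<in> bilinear_maps R (A x y) (A x y) (A w y)"
    by (assumption | rule hopf_intros x y w F Fc)+
  have H: "(\<lambda>p e. mul w x x (F p) e) \<in> bilinear_maps R (A x y) (A x x) (A w x)"
    by (assumption | rule hopf_intros x y w F Fc)+
  have l1: "(\<lambda>p. mul w x x (F p) (mul x y x q (S x y r))) \<in> linear_maps R (A x y) (A w x)"
    if "q \<in> carrier (A x y)" "r \<in> carrier (A x y)" for q r
    by (assumption | rule hopf_intros x y w F Fc that)+
  have l2: "(\<lambda>q. mul w x x (F p) (mul x y x q (S x y r))) \<in> linear_maps R (A x y) (A w x)"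
    if "p \<in> carrier (A x y)" "r \<in> carrier (A x y)" for p r
    by (assumption | rule hopf_intros x y w Fc that)+
  have l3: "(\<lambda>r. mul w x x (F p) (mul x y x q (S x y r))) \<in> linear_maps R (A x y) (A w x)"
    if "p \<in> carrier (A x y)" "q \<in> carrier (A x y)" for p q
    by (assumption | rule hopf_intros x y w Fc that)+
  have inner: "mul w y x (G u) (S x y r) = sweedler (A w x) (A x y) (\<lambda>p q. mul w x x (F p) (mul x y x q (S x y r))) u"
    if u: "u \<in> carrier (A x y)" and r: "r \<in> carrier (A x y)" for u r
  proof -
    have ml: "(\<lambda>t. mul w y x t (S x y r)) \<in> linear_maps R (A w y) (A w x)"
      by (assumption | rule hopf_intros x y w r)+
    have "mul w y x (G u) (S x y r) = sweedler (A w x) (A x y) (\<lambda>p q. mul w y x (mul w x y (F p) q) (S x y r)) u"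
      unfolding G[OF u, symmetric] by (rule C.linear_sweedler[OF ml bilF u Q P])
    also have "\<dots> = sweedler (A w x) (A x y) (\<lambda>p q. mul w x x (F p) (mul x y x q (S x y r))) u"
      by (rule C.sweedler_cong[OF bilinear_comp[OF bilF ml] u P])
        (rule mul_assoc; (assumption | rule x y w r Fc S_closed)+)
    finally show ?thesis .
  qed
  \<comment> \<open>The unit in \<open>F(c) 1\<close> is replaced, giving
    \<open>F(c1) (c2 S(c3))\<close>; reassociating the product and the sum then brings
    \<open>F(c1) c2\<close> together.\<close>
  have "F c = sweedler (A w x) (A x y) (\<lambda>p v. sweedler (A w x) (A x y) (\<lambda>q r. mul w x x (F p) (mul x y x q (S x y r))) v) c"
    using sweedler_antipode_cancel[OF x y c H P] mul_unit_right[OF w x Fc[OF c]] by simp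
  also have "\<dots> = sweedler (A w x) (A x y) (\<lambda>u r. sweedler (A w x) (A x y) (\<lambda>p q. mul w x x (F p) (mul x y x q (S x y r))) u) c"
    by (rule C.sweedler_coassoc[symmetric, OF l1 l2 l3 c P])
  also have "\<dots> = sweedler (A w x) (A x y) (\<lambda>u r. mul w y x (G u) (S x y r)) c"
  proof (rule C.sweedler_cong[OF _ c P])
    show "(\<lambda>u r. sweedler (A w x) (A x y) (\<lambda>p q. mul w x x (F p) (mul x y x q (S x y r))) u) \<in> bilinear_maps R (A x y) (A x y) (A w x)"
      by (assumption | rule bilinearI C.sweedler_linear_arg C.sweedler_linear_body linear_id l1 l2 l3 P C)+
  qed (simp add: inner)
  finally show ?thesis .
qed

text \<open>\<open>convolution_antipode\<close> is used twice, first with \<open>b\<close> as the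
  variable and \<open>a\<close> fixed, then with \<open>a\<close> as the variable and
  \<open>b\<close> fixed. It needs only that convolving with the identity gives something
  computable.\<close>

lemma antipode_mul:
  assumes x: "x \<in> Ob" and y: "y \<in> Ob" and z: "z \<in> Ob" and a: "a \<in> carrier (A x y)" and b: "b \<in> carrier (A y z)"
  shows "S x z (mul x y z a b) = mul z y x (S y z b) (S x y a)"
proof -
  interpret C: coalgebra R "A x y" by (rule hom_coalgebra[OF x y])
  interpret D: coalgebra R "A y z" by (rule hom_coalgebra[OF y z])
  note C = hom_module[OF x y] and D = hom_module[OF y z]
  \<comment> \<open>\<open>S(a1 b) a2 = \<epsilon>(a) S(b)\<close>: the convolution with the
    identity that the second application requires.\<close>
  have half: "sweedler (A z y) (A x y) (\<lambda>p q. mul z x y (S x z (mul x y z p b)) q) a = counit (A x y) a \<odot>\<^bsub>A z y\<^esub> S y z b"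
    if a: "a \<in> carrier (A x y)" and b: "b \<in> carrier (A y z)" for a b
  proof -
    let ?F = "\<lambda>b. sweedler (A z y) (A x y) (\<lambda>p q. mul z x y (S x z (mul x y z p b)) q) a"
    have F: "?F \<in> linear_maps R (A y z) (A z y)"
      by (assumption | rule hopf_intros x y z a)+
    \<comment> \<open>With \<open>F(b) = S(a1 b) a2\<close>, the convolution with the identity is
      \<open>S(a1 u1) a2 u2\<close>. After the two sums are exchanged, this is the antipode axiom
      for the product \<open>a u\<close>, and \<open>\<epsilon>\<close> is multiplicative.\<close>
    have conv: "sweedler (A z z) (A y z) (\<lambda>p q. mul z y z (?F p) q) u
        = (counit (A x y) a \<otimes>\<^bsub>R\<^esub> counit (A y z) u) \<odot>\<^bsub>A z z\<^esub> unit z"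
      if u: "u \<in> carrier (A y z)" for u
    proof -
      have bil: "(\<lambda>p q. mul z y z (?F p) q) \<in> bilinear_maps R (A y z) (A y z) (A z z)"
        by (assumption | rule hopf_intros x y z a)+
      have bil4: "(\<lambda>p q. mul z x z (S x z (mul x y z p p')) (mul x y z q q')) \<in> bilinear_maps R (A x y) (A x y) (A z z)"
        if "p' \<in> carrier (A y z)" "q' \<in> carrier (A y z)" for p' q'
        by (assumption | rule hopf_intros x y z that)+
      have bil4': "(\<lambda>p' q'. mul z x z (S x z (mul x y z p p')) (mul x y z q q')) \<in> bilinear_maps R (A y z) (A y z) (A z z)"
        if "p \<in> carrier (A x y)" "q \<in> carrier (A x y)" for p q
        by (assumption | rule hopf_intros x y z that)+
      have "sweedler (A z z) (A y z) (\<lambda>p' q'. mul z y z (?F p') q') u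
        = sweedler (A z z) (A y z) (\<lambda>p' q'. sweedler (A z z) (A x y) (\<lambda>p q. mul z x z (S x z (mul x y z p p')) (mul x y z q q')) a) u"
      proof (rule D.sweedler_cong[OF bil u hom_module[OF z z]])
        fix p' q' assume p': "p' \<in> carrier (A y z)" and q': "q' \<in> carrier (A y z)"
        have b1: "(\<lambda>p q. mul z x y (S x z (mul x y z p p')) q) \<in> bilinear_maps R (A x y) (A x y) (A z y)"
          by (assumption | rule hopf_intros x y z p')+
        have l: "(\<lambda>t. mul z y z t q') \<in> linear_maps R (A z y) (A z z)"
          by (assumption | rule hopf_intros x y z q')+
        have "mul z y z (?F p') q' = sweedler (A z z) (A x y) (\<lambda>p q. mul z y z (mul z x y (S x z (mul x y z p p')) q) q') a"
          by (rule C.linear_sweedler[OF l b1 a hom_module[OF z y] hom_module[OF z z]])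
        also have "\<dots> = sweedler (A z z) (A x y) (\<lambda>p q. mul z x z (S x z (mul x y z p p')) (mul x y z q q')) a"
          by (rule C.sweedler_cong[OF bilinear_comp[OF b1 l] a hom_module[OF z z]])
            (rule mul_assoc; (assumption | rule x y z p' q' S_closed mul_closed)+)
        finally show "mul z y z (?F p') q' = \<dots>" .
      qed
      also have "\<dots> = sweedler (A z z) (A x y) (\<lambda>p q. sweedler (A z z) (A y z) (\<lambda>p' q'. mul z x z (S x z (mul x y z p p')) (mul x y z q q')) u) a"
        by (rule sweedler_swap[OF D.coalgebra_axioms C.coalgebra_axioms u a bil4 bil4' hom_module[OF z z]])
      also have "\<dots> = sweedler (A z z) (A x z) (\<lambda>p q. mul z x z (S x z p) q) (mul x y z a u)"
      proof (rule sweedler_mul[symmetric, OF x y z a u _ hom_module[OF z z]])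
        show "(\<lambda>p q. mul z x z (S x z p) q) \<in> bilinear_maps R (A x z) (A x z) (A z z)"
          by (assumption | rule hopf_intros x z)+
      qed
      also have "\<dots> = (counit (A x y) a \<otimes>\<^bsub>R\<^esub> counit (A y z) u) \<odot>\<^bsub>A z z\<^esub> unit z"
        using sweedler_antipode_left[OF x z mul_closed[OF x y z a u]] by (simp add: counit_mul[OF x y z a u])
      finally show ?thesis .
    qed
    have bil: "(\<lambda>u r. counit (A y z) u \<odot>\<^bsub>A z y\<^esub> S y z r) \<in> bilinear_maps R (A y z) (A y z) (A z y)"
      by (assumption | rule bilinearI linear_scale linear_scale_left D.counit_linear D.counit_closed
          antipode_linear S_closed hom_module y z)+
    have sc: "(\<lambda>t. counit (A x y) a \<odot>\<^bsub>A z y\<^esub> t) \<in> linear_maps R (A z y) (A z y)"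
      by (assumption | rule linear_scale linear_id C.counit_closed a hom_module y z)+
    have "?F b = sweedler (A z y) (A y z) (\<lambda>u r. mul z z y ((counit (A x y) a \<otimes>\<^bsub>R\<^esub> counit (A y z) u) \<odot>\<^bsub>A z z\<^esub> unit z) (S y z r)) b"
      by (rule convolution_antipode[OF y z z b F conv])
    also have "\<dots> = sweedler (A z y) (A y z) (\<lambda>u r. counit (A x y) a \<odot>\<^bsub>A z y\<^esub> (counit (A y z) u \<odot>\<^bsub>A z y\<^esub> S y z r)) b"
    proof (rule D.sweedler_cong[symmetric, OF bilinear_comp[OF bil sc] b hom_module[OF z y]])
      fix u r assume u: "u \<in> carrier (A y z)" and r: "r \<in> carrier (A y z)"
      note cs = C.counit_closed[OF a] D.counit_closed[OF u] S_closed[OF y z r]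
      show "counit (A x y) a \<odot>\<^bsub>A z y\<^esub> (counit (A y z) u \<odot>\<^bsub>A z y\<^esub> S y z r)
        = mul z z y ((counit (A x y) a \<otimes>\<^bsub>R\<^esub> counit (A y z) u) \<odot>\<^bsub>A z z\<^esub> unit z) (S y z r)"
        using cs by (simp add: mul_smult z y unit_closed mul_unit_left module.smult_assoc1[OF hom_module[OF z y]])
    qed
    also have "\<dots> = counit (A x y) a \<odot>\<^bsub>A z y\<^esub> S y z b"
      using D.linear_sweedler[OF sc bil b hom_module[OF z y] hom_module[OF z y]]
        D.sweedler_counit_left[OF antipode_linear[OF y z] b hom_module[OF z y]] by simp
    finally show ?thesis .
  qed
  \<comment> \<open>Second application, in the variable \<open>a\<close>:
    \<open>S(ab) = \<epsilon>(a1) S(b) S(a2)\<close>, and the counit removes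
    \<open>a1\<close>.\<close>
  have F: "(\<lambda>a. S x z (mul x y z a b)) \<in> linear_maps R (A x y) (A z x)"
    by (assumption | rule hopf_intros x y z b)+
  have bil: "(\<lambda>u r. counit (A x y) u \<odot>\<^bsub>A y x\<^esub> S x y r) \<in> bilinear_maps R (A x y) (A x y) (A y x)"
    by (assumption | rule bilinearI linear_scale linear_scale_left C.counit_linear C.counit_closed
        antipode_linear S_closed hom_module x y)+
  have l: "(\<lambda>t. mul z y x (S y z b) t) \<in> linear_maps R (A y x) (A z x)"
    by (assumption | rule hopf_intros x y z b)+
  have "S x z (mul x y z a b) = sweedler (A z x) (A x y) (\<lambda>u r. mul z y x (counit (A x y) u \<odot>\<^bsub>A z y\<^esub> S y z b) (S x y r)) a"
    by (rule convolution_antipode[OF x y z a F half[OF _ b]])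
  also have "\<dots> = sweedler (A z x) (A x y) (\<lambda>u r. mul z y x (S y z b) (counit (A x y) u \<odot>\<^bsub>A y x\<^esub> S x y r)) a"
    by (rule C.sweedler_cong[symmetric, OF bilinear_comp[OF bil l] a hom_module[OF z x]])
      (simp add: mul_smult x y z S_closed b C.counit_closed)
  also have "\<dots> = mul z y x (S y z b) (S x y a)"
    using C.linear_sweedler[OF l bil a hom_module[OF y x] hom_module[OF z x]]
      C.sweedler_counit_left[OF antipode_linear[OF x y] a hom_module[OF y x]] by simp
  finally show ?thesis .
qed

text \<open>The left antipode axiom at the grouplike element \<open>1\<close> reads
  \<open>S(1) 1 = \<epsilon>(1) 1\<close>.\<close>

lemma antipode_unit:
  assumes x: "x \<in> Ob"
  shows "S x x (unit x) = unit x"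
proof -
  have bil: "(\<lambda>p q. mul x x x (S x x p) q) \<in> bilinear_maps R (A x x) (A x x) (A x x)"
    by (assumption | rule hopf_intros x)+
  show ?thesis
    using sweedler_antipode_left[OF x x unit_closed[OF x]] sweedler_unit[OF x bil hom_module[OF x x]]
      mul_unit_right[OF x x S_closed[OF x x unit_closed[OF x]]]
      module.smult_one[OF hom_module[OF x x] unit_closed[OF x]]
    by (simp add: counit_unit[OF x])
qed

text \<open>In Sweedler notation: \<open>S(c\<^sub>1)\<^sub>1 c\<^sub>2 \<otimes> S(c\<^sub>1)\<^sub>2 = 1 \<otimes> S(c)\<close>. It follows from
  \<open>S(c\<^sub>1)\<^sub>1 c\<^sub>2 \<otimes> S(c\<^sub>1)\<^sub>2 c\<^sub>3 = \<Delta>(S(c\<^sub>1) c\<^sub>2) = \<epsilon>(c) 1 \<otimes> 1\<close> and replaces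
  the anticomultiplicativity of the antipode.\<close>

lemma sweedler_antipode:
  assumes x: "x \<in> Ob" and y: "y \<in> Ob" and c: "c \<in> carrier (A x y)"
    and \<beta>: "\<beta> \<in> bilinear_maps R (A y y) (A y x) P" and P: "module R P"
  shows "sweedler P (A x y) (\<lambda>p q. sweedler P (A y x) (\<lambda>s t. \<beta> (mul y x y s q) t) (S x y p)) c
    = \<beta> (unit y) (S x y c)"
proof -
  interpret C: coalgebra R "A x y" by (rule hom_coalgebra[OF x y])
  interpret D: coalgebra R "A y x" by (rule hom_coalgebra[OF y x])
  note C = hom_module[OF x y] and D = hom_module[OF y x]
  note bl = linear_comp[OF bilinear_left[OF \<beta>]] and br = linear_comp[OF bilinear_right[OF \<beta>]]
  \<comment> \<open>The term \<open>\<beta>(S(p)_1 q, S(p)_2 r S(u))\<close>, where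
    \<open>p\<close>, \<open>q\<close>, \<open>r\<close>, \<open>u\<close> stand for the four legs
    \<open>c1\<close>, \<open>c2\<close>, \<open>c3\<close>, \<open>c4\<close>. Only the bracketing
    of the sum over these legs changes below.\<close>
  let ?K = "\<lambda>p q r u. sweedler P (A y x) (\<lambda>s t. \<beta> (mul y x y s q) (mul y x x t (mul x y x r (S x y u)))) (S x y p)"
  have b0: "(\<lambda>s t. \<beta> (mul y x y s q) (mul y x x t w)) \<in> bilinear_maps R (A y x) (A y x) P"
    if "q \<in> carrier (A x y)" "w \<in> carrier (A x x)" for q w
    by (assumption | rule bilinearI bl br mul_linear_left linear_id mul_closed x y that)+
  \<comment> \<open>\<open>w\<close> in \<open>A x x\<close> stands for the whole factor
    \<open>r S(u)\<close>. Treating it as one variable gives linearity in \<open>r\<close> and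
    \<open>u\<close> by composition, and is also the form required by
    \<open>sweedler_antipode_cancel\<close>.\<close>
  have G1: "(\<lambda>p. sweedler P (A y x) (\<lambda>s t. \<beta> (mul y x y s q) (mul y x x t w)) (S x y p)) \<in> linear_maps R (A x y) P"
    if "q \<in> carrier (A x y)" "w \<in> carrier (A x x)" for q w
    by (assumption | rule D.sweedler_linear_arg b0 antipode_linear x y P that)+
  have G2: "(\<lambda>q. sweedler P (A y x) (\<lambda>s t. \<beta> (mul y x y s q) (mul y x x t w)) (S x y p)) \<in> linear_maps R (A x y) P"
    if "p \<in> carrier (A x y)" "w \<in> carrier (A x x)" for p w
    by (assumption | rule D.sweedler_linear_body b0 S_closed x y P C that bl mul_linear_right linear_id mul_closed)+
  have G3: "(\<lambda>w. sweedler P (A y x) (\<lambda>s t. \<beta> (mul y x y s q) (mul y x x t w)) (S x y p)) \<in> linear_maps R (A x x) P"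
    if "p \<in> carrier (A x y)" "q \<in> carrier (A x y)" for p q
    by (assumption | rule D.sweedler_linear_body b0 S_closed x y P hom_module that br mul_linear_right linear_id mul_closed)+
  have K1: "(\<lambda>p. ?K p q r u) \<in> linear_maps R (A x y) P"
    if "q \<in> carrier (A x y)" "r \<in> carrier (A x y)" "u \<in> carrier (A x y)" for q r u
    by (assumption | rule G1 mul_closed S_closed x y that)+
  have K2: "(\<lambda>q. ?K p q r u) \<in> linear_maps R (A x y) P"
    if "p \<in> carrier (A x y)" "r \<in> carrier (A x y)" "u \<in> carrier (A x y)" for p r u
    by (assumption | rule G2 mul_closed S_closed x y that)+
  have K3: "(\<lambda>r. ?K p q r u) \<in> linear_maps R (A x y) P"
    if "p \<in> carrier (A x y)" "q \<in> carrier (A x y)" "u \<in> carrier (A x y)" for p q u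
    by (rule linear_comp[OF G3]) (assumption | rule mul_linear_left linear_id S_closed x y that)+
  have K4: "(\<lambda>u. ?K p q r u) \<in> linear_maps R (A x y) P"
    if "p \<in> carrier (A x y)" "q \<in> carrier (A x y)" "r \<in> carrier (A x y)" for p q r
    by (rule linear_comp[OF G3]) (assumption | rule mul_linear_right antipode_linear S_closed x y that)+
  note Kc = linear_closed[OF K4]
  let ?sw = "sweedler P (A x y)"
  have sw_lin: "(\<lambda>q. ?sw (\<lambda>q r. ?K p q r u) q) \<in> linear_maps R (A x y) P" (is "?A")
    "(\<lambda>u. ?sw (\<lambda>q r. ?K p q r u) v) \<in> linear_maps R (A x y) P" (is "?B")
    "(\<lambda>p. ?sw (\<lambda>q r. ?K p q r u) v) \<in> linear_maps R (A x y) P" (is "?C")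
    "(\<lambda>v. ?sw (\<lambda>r u. ?K p v r u) u) \<in> linear_maps R (A x y) P" (is "?D")
    if "p \<in> carrier (A x y)" "u \<in> carrier (A x y)" "v \<in> carrier (A x y)" for p u v
  proof -
    show ?A by (assumption | rule C.sweedler_linear_arg linear_id bilinearI K2 K3 P that)+
    show ?B by (assumption | rule C.sweedler_linear_body bilinearI K2 K3 K4 P C that)+
    show ?C by (assumption | rule C.sweedler_linear_body bilinearI K1 K2 K3 K4 P C that)+
    show ?D by (assumption | rule C.sweedler_linear_body bilinearI K1 K2 K3 K4 P C that)+
  qed
  have b\<beta>: "(\<lambda>s t. \<beta> (mul y x y s q) t) \<in> bilinear_maps R (A y x) (A y x) P" if "q \<in> carrier (A x y)" for q
    by (assumption | rule bilinearI bl bilinear_right[OF \<beta>] mul_linear_left linear_id mul_closed x y that)+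
  \<comment> \<open>\<open>S(c1)_2\<close> is multiplied by the unit, which is then expanded to
    \<open>c3 S(c4)\<close> by \<open>sweedler_antipode_cancel\<close>.\<close>
  have "?sw (\<lambda>p q. sweedler P (A y x) (\<lambda>s t. \<beta> (mul y x y s q) t) (S x y p)) c
    = ?sw (\<lambda>p q. ?sw (\<lambda>q' v. ?sw (\<lambda>r u. ?K p q' r u) v) q) c"
  proof (rule C.sweedler_cong[OF _ c P])
    show "(\<lambda>p q. sweedler P (A y x) (\<lambda>s t. \<beta> (mul y x y s q) t) (S x y p)) \<in> bilinear_maps R (A x y) (A x y) P"
      by (assumption | rule bilinearI D.sweedler_linear_arg D.sweedler_linear_body b\<beta> antipode_linear S_closed
          x y P C bl mul_linear_right linear_id)+
    fix p q assume p: "p \<in> carrier (A x y)" and q: "q \<in> carrier (A x y)"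
    have H: "(\<lambda>q w. sweedler P (A y x) (\<lambda>s t. \<beta> (mul y x y s q) (mul y x x t w)) (S x y p)) \<in> bilinear_maps R (A x y) (A x x) P"
      by (assumption | rule bilinearI G2 G3 p)+
    have "sweedler P (A y x) (\<lambda>s t. \<beta> (mul y x y s q) t) (S x y p)
      = sweedler P (A y x) (\<lambda>s t. \<beta> (mul y x y s q) (mul y x x t (unit x))) (S x y p)"
      by (rule D.sweedler_cong[OF b\<beta>[OF q] S_closed[OF x y p] P]) (simp add: mul_unit_right x y)
    then show "sweedler P (A y x) (\<lambda>s t. \<beta> (mul y x y s q) t) (S x y p) = ?sw (\<lambda>q' v. ?sw (\<lambda>r u. ?K p q' r u) v) q"
      using sweedler_antipode_cancel[OF x y q H P] by simp
  qed
  \<comment> \<open>Two applications of coassociativity rebracket \<open>c1, (c2, (c3, c4))\<close>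
    first to \<open>c1, ((c2, c3), c4)\<close> and then to
    \<open>(c1, (c2, c3)), c4\<close>.\<close>
  also have "\<dots> = ?sw (\<lambda>p q. ?sw (\<lambda>v u. ?sw (\<lambda>q' r. ?K p q' r u) v) q) c"
  proof (rule C.sweedler_cong[OF _ c P])
    show "(\<lambda>p q. ?sw (\<lambda>q' v. ?sw (\<lambda>r u. ?K p q' r u) v) q) \<in> bilinear_maps R (A x y) (A x y) P"
      by (assumption | rule bilinearI C.sweedler_linear_arg C.sweedler_linear_body linear_id K1 K2 K3 K4 P C)+
    fix p q assume p: "p \<in> carrier (A x y)" and q: "q \<in> carrier (A x y)"
    show "?sw (\<lambda>q' v. ?sw (\<lambda>r u. ?K p q' r u) v) q = ?sw (\<lambda>v u. ?sw (\<lambda>q' r. ?K p q' r u) v) q"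
      by (rule C.sweedler_coassoc[symmetric, OF K2 K3 K4 q P]; (assumption | rule p)+)
  qed
  also have "\<dots> = ?sw (\<lambda>v u. ?sw (\<lambda>p q. ?sw (\<lambda>q' r. ?K p q' r u) q) v) c"
    by (rule C.sweedler_coassoc[symmetric, OF _ _ _ c P]) (rule sw_lin; assumption)+
  also have "\<dots> = ?sw (\<lambda>v u. counit (A x y) v \<odot>\<^bsub>P\<^esub> \<beta> (unit y) (S x y u)) c"
  proof (rule C.sweedler_cong[OF _ c P])
    show "(\<lambda>v u. ?sw (\<lambda>p q. ?sw (\<lambda>q' r. ?K p q' r u) q) v) \<in> bilinear_maps R (A x y) (A x y) P"
      by (assumption | rule bilinearI C.sweedler_linear_arg C.sweedler_linear_body linear_id K1 K2 K3 K4 P C)+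
    fix v u assume v: "v \<in> carrier (A x y)" and u: "u \<in> carrier (A x y)"
    let ?\<beta> = "\<lambda>s t. \<beta> s (mul y y x t (S x y u))"
    have \<beta>': "?\<beta> \<in> bilinear_maps R (A y y) (A y y) P"
      by (assumption | rule bilinearI br bilinear_left[OF \<beta>] mul_linear_left linear_id mul_closed S_closed x y u)+
    have bS: "(\<lambda>p q. mul y x y (S x y p) q) \<in> bilinear_maps R (A x y) (A x y) (A y y)"
      by (assumption | rule hopf_intros x y)+
    interpret E: coalgebra R "A y y" by (rule hom_coalgebra[OF y y])
    have swl: "sweedler P (A y y) ?\<beta> \<in> linear_maps R (A y y) P"
      by (rule E.sweedler_linear_arg[OF linear_id \<beta>' P])
    \<comment> \<open>With \<open>u\<close> fixed, the inner sums contain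
      \<open>S(p)_1 q1 \<otimes> S(p)_2 q2\<close>, which is \<open>\<Delta>(S(p) q)\<close> by
      \<open>sweedler_mul\<close>. Summed over the legs of \<open>v\<close>, the argument
      \<open>S(p) q\<close> collapses to \<open>\<epsilon>(v) 1\<close>.\<close>
    have "?sw (\<lambda>p q. ?sw (\<lambda>q' r. ?K p q' r u) q) v = ?sw (\<lambda>p q. sweedler P (A y y) ?\<beta> (mul y x y (S x y p) q)) v"
    proof (rule C.sweedler_cong[symmetric, OF bilinear_comp[OF bS swl] v P])
      fix p q assume p: "p \<in> carrier (A x y)" and q: "q \<in> carrier (A x y)"
      let ?L = "\<lambda>s t q' r. \<beta> (mul y x y s q') (mul y x x t (mul x y x r (S x y u)))"
      have L1: "?L s t \<in> bilinear_maps R (A x y) (A x y) P" if "s \<in> carrier (A y x)" "t \<in> carrier (A y x)" for s t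
        by (assumption | rule bilinearI bl br mul_linear_left mul_linear_right linear_id mul_closed S_closed x y u that)+
      have L2: "(\<lambda>s t. ?L s t q' r) \<in> bilinear_maps R (A y x) (A y x) P" if "q' \<in> carrier (A x y)" "r \<in> carrier (A x y)" for q' r
        by (assumption | rule bilinearI bl br mul_linear_left mul_linear_right linear_id mul_closed S_closed x y u that)+
      have "sweedler P (A y y) ?\<beta> (mul y x y (S x y p) q)
        = sweedler P (A y x) (\<lambda>s t. ?sw (\<lambda>q' r. ?\<beta> (mul y x y s q') (mul y x y t r)) q) (S x y p)"
        by (rule sweedler_mul[OF y x y S_closed[OF x y p] q \<beta>' P])
      also have "\<dots> = sweedler P (A y x) (\<lambda>s t. ?sw (?L s t) q) (S x y p)"
      proof (rule D.sweedler_cong[symmetric, OF _ S_closed[OF x y p] P])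
        show "(\<lambda>s t. ?sw (?L s t) q) \<in> bilinear_maps R (A y x) (A y x) P"
          by (rule bilinearI; rule C.sweedler_linear_body[OF q _ L1 P D])
            (assumption | rule bilinear_left[OF L2] bilinear_right[OF L2])+
        fix s t assume s: "s \<in> carrier (A y x)" and t: "t \<in> carrier (A y x)"
        show "?sw (?L s t) q = ?sw (\<lambda>q' r. ?\<beta> (mul y x y s q') (mul y x y t r)) q"
          by (rule C.sweedler_cong[OF L1[OF s t] q P]) (simp add: mul_assoc x y t S_closed u)
      qed
      also have "\<dots> = ?sw (\<lambda>q' r. ?K p q' r u) q"
        by (rule sweedler_swap[OF D.coalgebra_axioms C.coalgebra_axioms S_closed[OF x y p] q L1 L2 P])
      finally show "sweedler P (A y y) ?\<beta> (mul y x y (S x y p) q) = ?sw (\<lambda>q' r. ?K p q' r u) q" .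
    qed
    also have "\<dots> = sweedler P (A y y) ?\<beta> (sweedler (A y y) (A x y) (\<lambda>p q. mul y x y (S x y p) q) v)"
      by (rule C.linear_sweedler[symmetric, OF swl bS v hom_module[OF y y] P])
    also have "\<dots> = counit (A x y) v \<odot>\<^bsub>P\<^esub> \<beta> (unit y) (S x y u)"
      using linear_smult[OF swl C.counit_closed[OF v] unit_closed[OF y]]
      by (simp add: sweedler_antipode_left x y v sweedler_unit[OF y \<beta>' P] mul_unit_left S_closed u)
    finally show "?sw (\<lambda>p q. ?sw (\<lambda>q' r. ?K p q' r u) q) v = counit (A x y) v \<odot>\<^bsub>P\<^esub> \<beta> (unit y) (S x y u)" .
  qed
  also have "\<dots> = \<beta> (unit y) (S x y c)"
    by (rule C.sweedler_counit_left[OF linear_comp[OF bilinear_right[OF \<beta> unit_closed[OF y]] antipode_linear[OF x y]] c P])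
  finally show ?thesis .
qed

section \<open>The dual as a Hopf module\<close>

abbreviation "harpoon \<equiv> dual_harpoon R A \<mu> S"

lemma harpoon_apply: "b \<in> carrier (A x z) \<Longrightarrow> harpoon x y z a' a b = a' (mul x z y b (S y z a))"
  by (simp add: dual_harpoon_def mul_def)

lemma harpoon_closed:
  assumes x: "x \<in> Ob" and y: "y \<in> Ob" and z: "z \<in> Ob"
    and a': "a' \<in> carrier (dual R (A x y))" and a: "a \<in> carrier (A y z)"
  shows "harpoon x y z a' a \<in> carrier (dual R (A x z))"
  unfolding dual_harpoon_def mul_def[symmetric]
  by (rule restrict_dual[OF hom_module[OF x z]], rule linear_comp[OF dual_linear[OF a']])
    (rule hopf_intros x y z a)+

lemma harpoon_bilinear:
  assumes x: "x \<in> Ob" and y: "y \<in> Ob" and z: "z \<in> Ob"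
  shows "harpoon x y z \<in> bilinear_maps R (dual R (A x y)) (A y z) (dual R (A x z))"
proof (rule bilinearI)
  note D = dual_module[OF hom_module[OF x y]]
  show "(\<lambda>a'. harpoon x y z a' a) \<in> linear_maps R (dual R (A x y)) (dual R (A x z))"
    if a: "a \<in> carrier (A y z)" for a
  proof (rule linear_into_dual[OF D hom_module[OF x z] harpoon_closed[OF x y z _ a]])
    fix h assume h: "h \<in> carrier (A x z)"
    show "(\<lambda>a'. harpoon x y z a' a h) \<in> linear_maps R (dual R (A x y)) (regular_module R)"
      unfolding harpoon_apply[OF h]
      by (rule dual_apply_linear) (rule hopf_intros x y z a h)+
  qed
  show "(\<lambda>a. harpoon x y z a' a) \<in> linear_maps R (A y z) (dual R (A x z))"
    if a': "a' \<in> carrier (dual R (A x y))" for a'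
  proof (rule linear_into_dual[OF hom_module[OF y z] hom_module[OF x z] harpoon_closed[OF x y z a']])
    fix h assume h: "h \<in> carrier (A x z)"
    show "(\<lambda>a. harpoon x y z a' a h) \<in> linear_maps R (A y z) (regular_module R)"
      unfolding harpoon_apply[OF h]
      by (rule linear_comp[OF dual_linear[OF a']]) (rule hopf_intros x y z h)+
  qed
qed

lemma dual_action_pure:
  assumes x: "x \<in> Ob" and y: "y \<in> Ob" and z: "z \<in> Ob"
    and a': "a' \<in> carrier (dual R (A x y))" and a: "a \<in> carrier (A y z)"
  shows "dual_action R A \<mu> S x y z (pure_tensor R (dual R (A x y)) (A y z) a' a) = harpoon x y z a' a"
  unfolding dual_action_def
  by (rule tensor_lift_pure[OF _ _ _ harpoon_bilinear[OF x y z] a' a]) (rule dual_module hom_module x y z)+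

lemma dual_action_linear:
  assumes x: "x \<in> Ob" and y: "y \<in> Ob" and z: "z \<in> Ob"
  shows "dual_action R A \<mu> S x y z \<in> linear_maps R (tensor_product R (dual R (A x y)) (A y z)) (dual R (A x z))"
  unfolding dual_action_def
  by (rule tensor_lift_linear[OF _ _ _ harpoon_bilinear[OF x y z]]) (rule dual_module hom_module x y z)+

text \<open>At \<open>c\<close> the two sides are \<open><m, (c S(b)) S(a)>\<close> and
  \<open><m, c S(ab)>\<close>; the order reversal of the antipode turns this into a right
  action.\<close>

lemma harpoon_mul:
  assumes x: "x \<in> Ob" and y: "y \<in> Ob" and z: "z \<in> Ob" and w: "w \<in> Ob"
    and m: "m \<in> carrier (dual R (A x y))" and a: "a \<in> carrier (A y z)" and b: "b \<in> carrier (A z w)"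
  shows "harpoon x z w (harpoon x y z m a) b = harpoon x y w m (mul y z w a b)"
proof (rule dual_eqI[of _ R "A x w"])
  show "harpoon x z w (harpoon x y z m a) b \<in> carrier (dual R (A x w))"
    "harpoon x y w m (mul y z w a b) \<in> carrier (dual R (A x w))"
    by (rule harpoon_closed mul_closed x y z w m a b)+
  fix c assume c: "c \<in> carrier (A x w)"
  show "harpoon x z w (harpoon x y z m a) b c = harpoon x y w m (mul y z w a b) c"
    using x y z w a b c
    by (simp add: harpoon_apply mul_closed S_closed antipode_mul mul_assoc)
qed

lemma harpoon_unit:
  assumes x: "x \<in> Ob" and y: "y \<in> Ob" and m: "m \<in> carrier (dual R (A x y))"
  shows "harpoon x y y m (unit y) = m"
  by (rule dual_eqI[of _ R "A x y"])
    (use x y m in \<open>simp_all add: harpoon_closed unit_closed harpoon_apply antipode_unit mul_unit_right\<close>)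

text \<open>On pure tensors \<open>m \<otimes> n\<close> and \<open>p \<otimes> q\<close>,
  evaluating the first factor at \<open>h\<close> gives \<open><m, h S(p)> n q\<close>. Thus only
  the evaluation of \<open>s\<close> at \<open>h S(p)\<close> remains, and for a coaction that value
  is known.\<close>

lemma tensor_eval_action:
  assumes x: "x \<in> Ob" and y: "y \<in> Ob" and z: "z \<in> Ob" and h: "h \<in> carrier (A x z)"
    and s: "s \<in> carrier (tensor_product R (dual R (A x y)) (A x y))"
    and t: "t \<in> carrier (tensor_product R (A y z) (A y z))"
  shows "tensor_eval (A x z) h (tensor_map R (dual R (A x z)) (A x z) (dual_action R A \<mu> S x y z) (\<mu> x y z)
      (tensor_swap_middle R (dual R (A x y)) (A x y) (A y z) (A y z)
        (pure_tensor R (tensor_product R (dual R (A x y)) (A x y)) (tensor_product R (A y z) (A y z)) s t)))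
    = tensor_lift (A x z) (\<lambda>p q. mul x y z (tensor_eval (A x y) (mul x z y h (S y z p)) s) q) t"
    (is "?lhs = ?rhs")
proof -
  note C = hom_module[OF x y] and D = hom_module[OF y z] and E = hom_module[OF x z]
  note C' = dual_module[OF C] and E' = dual_module[OF E]
  note \<psi> = dual_action_linear[OF x y z] and \<mu> = \<mu>_linear[OF x y z]
  let ?g = "\<lambda>m n p q. m (mul x z y h (S y z p)) \<odot>\<^bsub>A x z\<^esub> mul x y z n q"
  have mods: "module R (tensor_product R (dual R (A x y)) (A y z))" "module R (tensor_product R (A x y) (A y z))"
    by (rule lin_closed C D)+
  have hS: "mul x z y h (S y z p) \<in> carrier (A x y)" if "p \<in> carrier (A y z)" for p
    by (rule mul_closed S_closed x y z h that)+
  have hSl: "(\<lambda>p. mul x z y h (S y z p)) \<in> linear_maps R (A y z) (A x y)"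
    by (rule mul_linear_right antipode_linear x y z h)+
  have mc: "mul x y z n q \<in> carrier (A x z)" if "n \<in> carrier (A x y)" "q \<in> carrier (A y z)" for n q
    by (rule mul_closed x y z that)+
  have dlin: "(\<lambda>p. m (mul x z y h (S y z p))) \<in> linear_maps R (A y z) (regular_module R)"
    if "m \<in> carrier (dual R (A x y))" for m
    by (rule linear_comp[OF dual_linear[OF that] hSl])
  have dc: "m (mul x z y h (S y z p)) \<in> carrier R" if "m \<in> carrier (dual R (A x y))" "p \<in> carrier (A y z)" for m p
    by (rule dual_closed[OF that(1) hS[OF that(2)]])
  have b1: "?g m n \<in> bilinear_maps R (A y z) (A y z) (A x z)"
    if "m \<in> carrier (dual R (A x y))" "n \<in> carrier (A x y)" for m n
    by (assumption | rule bilinearI linear_scale linear_scale_left E mul_linear_right linear_id dlin dc mc x y z that)+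
  have b2: "(\<lambda>m n. ?g m n p q) \<in> bilinear_maps R (dual R (A x y)) (A x y) (A x z)"
    if "p \<in> carrier (A y z)" "q \<in> carrier (A y z)" for p q
    by (assumption | rule bilinearI linear_scale linear_scale_left E mul_linear_left linear_id dual_apply_linear hS dc mc x y z that)+
  have b12: "(\<lambda>m n. tensor_lift (A x z) (?g m n) t) \<in> bilinear_maps R (dual R (A x y)) (A x y) (A x z)"
    by (rule bilinearI; rule tensor_lift_linear_body[OF t _ b1 D D E])
      (assumption | rule bilinear_left[OF b2] bilinear_right[OF b2] C C')+
  have val: "tensor_eval (A x z) h (tensor_map R (dual R (A x z)) (A x z) (dual_action R A \<mu> S x y z) (\<mu> x y z)
      (pure_tensor R (tensor_product R (dual R (A x y)) (A y z)) (tensor_product R (A x y) (A y z))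
        (pure_tensor R (dual R (A x y)) (A y z) m p) (pure_tensor R (A x y) (A y z) n q))) = ?g m n p q"
    if m: "m \<in> carrier (dual R (A x y))" and n: "n \<in> carrier (A x y)" and p: "p \<in> carrier (A y z)" and q: "q \<in> carrier (A y z)"
    for m n p q
    unfolding tensor_map_pure[OF \<psi> \<mu> pure_closed[OF C' D m p] pure_closed[OF C D n q] mods E' E]
      dual_action_pure[OF x y z m p] mul_def[symmetric]
      tensor_eval_pure[OF E E h harpoon_closed[OF x y z m p] mc[OF n q]] harpoon_apply[OF h] ..
  have "?lhs = tensor_lift (A x z) (\<lambda>m n. tensor_lift (A x z) (\<lambda>p q.
      tensor_eval (A x z) h (tensor_map R (dual R (A x z)) (A x z) (dual_action R A \<mu> S x y z) (\<mu> x y z)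
      (pure_tensor R (tensor_product R (dual R (A x y)) (A y z)) (tensor_product R (A x y) (A y z))
        (pure_tensor R (dual R (A x y)) (A y z) m p) (pure_tensor R (A x y) (A y z) n q)))) t) s"
    by (rule linear_tensor_swap_middle[OF linear_comp[OF tensor_eval_linear[OF E E h] tensor_map_linear[OF \<psi> \<mu> mods E' E]]
        s t C' C D D E])
  also have "\<dots> = tensor_lift (A x z) (\<lambda>m n. tensor_lift (A x z) (?g m n) t) s"
    by (rule tensor_lift_cong[symmetric, OF b12 s C' C E], rule tensor_lift_cong[OF b1 t D D E])
      (simp_all add: val)
  \<comment> \<open>The sum over \<open>s\<close> is moved inside, so that for fixed
    \<open>p\<close> and \<open>q\<close> it becomes one evaluation of \<open>s\<close>.\<close>
  also have "\<dots> = tensor_lift (A x z) (\<lambda>p q. tensor_lift (A x z) (\<lambda>m n. ?g m n p q) s) t"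
    by (rule tensor_lift_swap[where \<gamma> = ?g, OF s t b1 b2 C' C D D E])
  also have "\<dots> = ?rhs"
  proof (rule tensor_lift_cong[OF _ t D D E])
    show "(\<lambda>p q. tensor_lift (A x z) (\<lambda>m n. ?g m n p q) s) \<in> bilinear_maps R (A y z) (A y z) (A x z)"
      by (rule bilinearI; rule tensor_lift_linear_body[OF s _ b2 C' C E])
        (assumption | rule bilinear_left[OF b1] bilinear_right[OF b1] D)+
    fix p q assume p: "p \<in> carrier (A y z)" and q: "q \<in> carrier (A y z)"
    have l: "(\<lambda>n. mul x y z n q) \<in> linear_maps R (A x y) (A x z)"
      by (rule mul_linear_left linear_id x y z q)+
    have "mul x y z (tensor_eval (A x y) (mul x z y h (S y z p)) s) q
      = tensor_lift (A x z) (\<lambda>m n. mul x y z (m (mul x z y h (S y z p)) \<odot>\<^bsub>A x y\<^esub> n) q) s"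
      unfolding tensor_eval_def
      by (rule linear_tensor_lift[OF l tensor_eval_bilinear[OF C C hS[OF p]] s C' C C E])
    also have "\<dots> = tensor_lift (A x z) (\<lambda>m n. ?g m n p q) s"
      by (rule tensor_lift_cong[OF bilinear_comp[OF tensor_eval_bilinear[OF C C hS[OF p]] l] s C' C E])
        (simp add: mul_smult x y z q dc p)
    finally show "tensor_lift (A x z) (\<lambda>m n. ?g m n p q) s = mul x y z (tensor_eval (A x y) (mul x z y h (S y z p)) s) q"
      by simp
  qed
  finally show ?thesis .
qed

text \<open>Evaluated at \<open>h\<close>, the left-hand side is \<open><m, h2 S(a)> h1\<close>. By
  \<open>tensor_eval_action\<close> and \<open>sweedler_mul\<close>, the right-hand side is
  \<open><m, h2 S(a1)_2> h1 S(a1)_1 a2\<close>. The two dual bases are unrelated; evaluation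
  eliminates both.\<close>

lemma dual_coaction_harpoon:
  assumes x: "x \<in> Ob" and y: "y \<in> Ob" and z: "z \<in> Ob"
    and m: "m \<in> carrier (dual R (A x y))" and a: "a \<in> carrier (A y z)"
    and fdb: "finite_dual_basis R (A x y) n f e" and fdb': "finite_dual_basis R (A x z) n' f' e'"
  shows "dual_coaction R (A x z) n' f' e' (harpoon x y z m a)
    = tensor_map R (dual R (A x z)) (A x z) (dual_action R A \<mu> S x y z) (\<mu> x y z)
      (tensor_swap_middle R (dual R (A x y)) (A x y) (A y z) (A y z)
        (pure_tensor R (tensor_product R (dual R (A x y)) (A x y)) (tensor_product R (A y z) (A y z))
          (dual_coaction R (A x y) n f e m) (comult (A y z) a)))"
    (is "?lhs = ?rhs")
proof -
  interpret C: coalgebra R "A x y" by (rule hom_coalgebra[OF x y])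
  interpret D: coalgebra R "A y z" by (rule hom_coalgebra[OF y z])
  interpret E: coalgebra R "A x z" by (rule hom_coalgebra[OF x z])
  interpret Z: coalgebra R "A z y" by (rule hom_coalgebra[OF z y])
  note C = hom_module[OF x y] and D = hom_module[OF y z] and E = hom_module[OF x z] and Z = hom_module[OF z y]
  note C' = dual_module[OF C] and E' = dual_module[OF E]
  note \<psi> = dual_action_linear[OF x y z] and \<mu> = \<mu>_linear[OF x y z]
  note harp = harpoon_closed[OF x y z m a]
  note \<rho>c = C.dual_coaction_closed[OF fdb m]
  have mods: "module R (tensor_product R (dual R (A x y)) (A y z))" "module R (tensor_product R (A x y) (A y z))"
    "module R (tensor_product R (dual R (A x y)) (A x y))" "module R (tensor_product R (A y z) (A y z))"
    by (rule lin_closed C D)+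
  have dc: "m u \<in> carrier R" if "u \<in> carrier (A x y)" for u
    by (rule dual_closed[OF m that])
  show ?thesis
  proof (rule tensor_eval_inject[OF E E fdb' E.dual_coaction_closed[OF fdb' harp]])
    show "?rhs \<in> carrier (tensor_product R (dual R (A x z)) (A x z))"
      by (rule linear_closed[OF tensor_map_linear[OF \<psi> \<mu> mods(1,2) E' E]],
          rule linear_closed[OF tensor_swap_middle_linear[OF C' C D D]],
          rule pure_closed[OF mods(3,4) \<rho>c D.comult_closed[OF a]])
    fix h assume h: "h \<in> carrier (A x z)"
    let ?m = "\<lambda>v u. m v \<odot>\<^bsub>A x z\<^esub> u"
    \<comment> \<open>\<open>s\<close> and \<open>t\<close> are the legs of \<open>S(a1)\<close>,
      and \<open>q\<close> is \<open>a2\<close>. The product is bracketed as \<open>h1 (s q)\<close>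
      so that \<open>s q\<close> and \<open>t\<close> appear as the two arguments to which
      \<open>sweedler_antipode\<close> applies.\<close>
    let ?L = "\<lambda>h1 h2 s t q. m (mul x z y h2 t) \<odot>\<^bsub>A x z\<^esub> mul x z z h1 (mul z y z s q)"
    have Sp: "S y z p \<in> carrier (A z y)" if "p \<in> carrier (A y z)" for p
      by (rule S_closed y z that)+
    have ml1: "(\<lambda>v. m (mul x z y v t)) \<in> linear_maps R (A x z) (regular_module R)" if "t \<in> carrier (A z y)" for t
      by (rule linear_comp[OF dual_linear[OF m]]) (rule mul_linear_left linear_id x y z that)+
    have ml2: "(\<lambda>t. m (mul x z y v t)) \<in> linear_maps R (A z y) (regular_module R)" if "v \<in> carrier (A x z)" for v
      by (rule linear_comp[OF dual_linear[OF m]]) (rule mul_linear_right linear_id x y z that)+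
    note rules = bilinearI linear_scale linear_scale_left ml1 ml2 mul_linear_left mul_linear_right linear_id
      mul_closed unit_closed dc Sp x y z E
    have b\<beta>: "(\<lambda>s t. m (mul x z y h2 t) \<odot>\<^bsub>A x z\<^esub> mul x z z h1 s) \<in> bilinear_maps R (A z z) (A z y) (A x z)"
      if "h1 \<in> carrier (A x z)" "h2 \<in> carrier (A x z)" for h1 h2
      by (assumption | rule rules that)+
    have Lst: "(\<lambda>s t. ?L h1 h2 s t q) \<in> bilinear_maps R (A z y) (A z y) (A x z)"
      if "h1 \<in> carrier (A x z)" "h2 \<in> carrier (A x z)" "q \<in> carrier (A y z)" for h1 h2 q
      by (assumption | rule rules that)+
    have Lh: "(\<lambda>h1 h2. ?L h1 h2 s t q) \<in> bilinear_maps R (A x z) (A x z) (A x z)"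
      if "s \<in> carrier (A z y)" "t \<in> carrier (A z y)" "q \<in> carrier (A y z)" for s t q
      by (assumption | rule rules that)+
    have Lq: "(\<lambda>q. ?L h1 h2 s t q) \<in> linear_maps R (A y z) (A x z)"
      if "h1 \<in> carrier (A x z)" "h2 \<in> carrier (A x z)" "s \<in> carrier (A z y)" "t \<in> carrier (A z y)" for h1 h2 s t
      by (assumption | rule rules that)+
    let ?Z = "\<lambda>h1 h2 p q. sweedler (A x z) (A z y) (\<lambda>s t. ?L h1 h2 s t q) (S y z p)"
    have Zpq: "?Z h1 h2 \<in> bilinear_maps R (A y z) (A y z) (A x z)"
      if "h1 \<in> carrier (A x z)" "h2 \<in> carrier (A x z)" for h1 h2
      by (assumption | rule bilinearI Z.sweedler_linear_arg Z.sweedler_linear_body antipode_linear Lst Lq Sp y z E D that)+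
    have Zh: "(\<lambda>h1 h2. ?Z h1 h2 p q) \<in> bilinear_maps R (A x z) (A x z) (A x z)"
      if "p \<in> carrier (A y z)" "q \<in> carrier (A y z)" for p q
      by (rule bilinearI; rule Z.sweedler_linear_body[OF Sp _ Lst E E])
        (assumption | rule bilinear_left[OF Lh] bilinear_right[OF Lh] that)+
    have eb: "(\<lambda>u v. m v \<odot>\<^bsub>A x y\<^esub> u) \<in> bilinear_maps R (A x y) (A x y) (A x y)"
      by (rule C.coaction_bilinear[OF m C linear_id])
    have inner: "mul x y z (tensor_eval (A x y) (mul x z y h (S y z p)) (dual_coaction R (A x y) n f e m)) q
      = sweedler (A x z) (A x z) (\<lambda>h1 h2. ?Z h1 h2 p q) h"
      if p: "p \<in> carrier (A y z)" and q: "q \<in> carrier (A y z)" for p q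
    proof -
      have l: "(\<lambda>u. mul x y z u q) \<in> linear_maps R (A x y) (A x z)"
        by (rule mul_linear_left linear_id x y z q)+
      have hS: "mul x z y h (S y z p) \<in> carrier (A x y)"
        by (rule mul_closed Sp x y z h p)+
      have "mul x y z (tensor_eval (A x y) (mul x z y h (S y z p)) (dual_coaction R (A x y) n f e m)) q
        = sweedler (A x z) (A x y) (\<lambda>u v. mul x y z (m v \<odot>\<^bsub>A x y\<^esub> u) q) (mul x z y h (S y z p))"
        unfolding C.tensor_eval_dual_coaction[OF fdb m hS]
        by (rule C.linear_sweedler[OF l eb hS C E])
      also have "\<dots> = sweedler (A x z) (A x z) (\<lambda>h1 h2. sweedler (A x z) (A z y)
          (\<lambda>s t. mul x y z (m (mul x z y h2 t) \<odot>\<^bsub>A x y\<^esub> mul x z y h1 s) q) (S y z p)) h"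
        by (rule sweedler_mul[OF x z y h Sp[OF p] bilinear_comp[OF eb l] E])
      also have "\<dots> = sweedler (A x z) (A x z) (\<lambda>h1 h2. ?Z h1 h2 p q) h"
        by (rule E.sweedler_cong[symmetric, OF Zh[OF p q] h E], rule Z.sweedler_cong[OF Lst[OF _ _ q] Sp[OF p] E])
          (simp_all add: mul_smult mul_assoc mul_closed x y z q dc)
      finally show ?thesis .
    qed
    have "tensor_eval (A x z) h ?rhs
      = sweedler (A x z) (A y z) (\<lambda>p q. mul x y z (tensor_eval (A x y) (mul x z y h (S y z p)) (dual_coaction R (A x y) n f e m)) q) a"
      unfolding tensor_eval_action[OF x y z h \<rho>c D.comult_closed[OF a]] sweedler_def ..
    also have "\<dots> = sweedler (A x z) (A y z) (\<lambda>p q. sweedler (A x z) (A x z) (\<lambda>h1 h2. ?Z h1 h2 p q) h) a"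
    proof (rule D.sweedler_cong[symmetric, OF _ a E])
      show "(\<lambda>p q. sweedler (A x z) (A x z) (\<lambda>h1 h2. ?Z h1 h2 p q) h) \<in> bilinear_maps R (A y z) (A y z) (A x z)"
        by (rule bilinearI; rule E.sweedler_linear_body[OF h _ Zh E D])
          (assumption | rule bilinear_left[OF Zpq] bilinear_right[OF Zpq])+
    qed (simp add: inner)
    \<comment> \<open>The sum over the legs of \<open>a\<close> goes inside:
      \<open>sweedler_antipode\<close> needs a fixed bilinear map, here the one determined by
      \<open>h1\<close> and \<open>h2\<close>.\<close>
    also have "\<dots> = sweedler (A x z) (A x z) (\<lambda>h1 h2. sweedler (A x z) (A y z) (?Z h1 h2) a) h"
      by (rule sweedler_swap[OF D.coalgebra_axioms E.coalgebra_axioms a h Zh Zpq E])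
    also have "\<dots> = sweedler (A x z) (A x z) (\<lambda>h1 h2. harpoon x y z m a h2 \<odot>\<^bsub>A x z\<^esub> h1) h"
    proof (rule E.sweedler_cong[symmetric, OF E.coaction_bilinear[OF harp E linear_id] h E])
      fix h1 h2 assume h1: "h1 \<in> carrier (A x z)" and h2: "h2 \<in> carrier (A x z)"
      show "harpoon x y z m a h2 \<odot>\<^bsub>A x z\<^esub> h1 = sweedler (A x z) (A y z) (?Z h1 h2) a"
        using sweedler_antipode[OF y z a b\<beta>[OF h1 h2] E]
        by (simp add: harpoon_apply[OF h2] mul_unit_right x z h1)
    qed
    also have "\<dots> = tensor_eval (A x z) h ?lhs"
      by (rule E.tensor_eval_dual_coaction[symmetric, OF fdb' harp h])
    finally show "tensor_eval (A x z) h ?lhs = tensor_eval (A x z) h ?rhs" by simp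
  qed
qed

lemma dual_hopf_module:
  assumes fdb: "\<And>x y. \<lbrakk>x \<in> Ob; y \<in> Ob\<rbrakk> \<Longrightarrow> finite_dual_basis R (A x y) (n x y) (f x y) (e x y)"
  shows "hopf_module R Ob A \<mu> \<eta> (\<lambda>x y. dual R (A x y)) (dual_action R A \<mu> S)
    (\<lambda>x y. dual_coaction R (A x y) (n x y) (f x y) (e x y))"
proof (rule hopf_module.intro)
  show "fg_projective_module R (dual R (A x y))" if "x \<in> Ob" "y \<in> Ob" for x y
    by (rule finite_dual_basis_fg_projective[OF dual_module finite_dual_basis_dual[OF _ fdb]])
      (rule hom_module that)+
  show "right_comodule R (A x y) (dual R (A x y)) (dual_coaction R (A x y) (n x y) (f x y) (e x y))"
    if "x \<in> Ob" "y \<in> Ob" for x y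
    by (rule coalgebra.dual_comodule[OF hom_coalgebra[OF that] fdb[OF that]])
qed (simp_all add: dual_action_linear dual_action_pure harpoon_closed harpoon_mul[unfolded mul_def]
    mul_closed[unfolded mul_def] harpoon_unit[unfolded unit_def] unit_closed[unfolded unit_def]
    dual_coaction_harpoon fdb)

end

text \<open>The first conjunct keeps the second from being vacuous. Quantifying over all families of
  dual bases records that no particular choice matters, and the last conjunct ties the lifted action
  to its defining formula on pure tensors.\<close>

theorem proposition9p4:
  fixes R :: "'k ring" and Ob :: "'x set"
    and A :: "'x \<Rightarrow> 'x \<Rightarrow> ('k, 'a) coalgebra"
    and \<mu> :: "'x \<Rightarrow> 'x \<Rightarrow> 'x \<Rightarrow> ('a, 'a) tensor \<Rightarrow> 'a"
    and \<eta> :: "'x \<Rightarrow> 'k \<Rightarrow> 'a"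
    and S :: "'x \<Rightarrow> 'x \<Rightarrow> 'a \<Rightarrow> 'a"
  assumes "hopf_category R Ob A \<mu> \<eta> S"
  shows "(\<forall>x\<in>Ob. \<forall>y\<in>Ob. \<exists>n f e. finite_dual_basis R (A x y) n f e) \<and>
    (\<forall>n f e. (\<forall>x\<in>Ob. \<forall>y\<in>Ob. finite_dual_basis R (A x y) (n x y) (f x y) (e x y)) \<longrightarrow>
      hopf_module R Ob A \<mu> \<eta> (\<lambda>x y. dual R (A x y))
        (dual_action R A \<mu> S)
        (\<lambda>x y. dual_coaction R (A x y) (n x y) (f x y) (e x y))) \<and>
    (\<forall>x\<in>Ob. \<forall>y\<in>Ob. \<forall>z\<in>Ob. \<forall>a'\<in>carrier (dual R (A x y)). \<forall>a\<in>carrier (A y z). \<forall>b\<in>carrier (A x z).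
      dual_action R A \<mu> S x y z (pure_tensor R (dual R (A x y)) (A y z) a' a) b
        = a' (\<mu> x z y (pure_tensor R (A x z) (A z y) b (S y z a))))"
proof -
  interpret hopf_category R Ob A \<mu> \<eta> S by (rule assms)
  show ?thesis
  proof (intro conjI ballI allI impI)
    show "\<exists>n f e. finite_dual_basis R (A x y) n f e" if "x \<in> Ob" "y \<in> Ob" for x y
      using finite_dual_basis_exists[OF fg_projective[OF that]] by metis
  qed (simp_all add: dual_hopf_module dual_action_pure dual_harpoon_def)
qed

end
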